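(* Suppose $P$ is a submonoid of the group $G$. A unital $*$-homomorphism $\rho\colon\mathcal T_u(P)\to B$ into a $\mathrm C^*$-algebra $B$ is faithful on the full diagonal subalgebra $D_u$ if and only if it is jointly proper.
   Context: $e$ is the identity of $G$. A word is a finite sequence $\alpha=(p_1,p_2,\ldots,p_{2k-1},p_{2k})$ of even length $2k\ge 0$ with entries in $P$ (the empty word is allowed). Put $\dot\alpha:=p_1^{-1}p_2\cdots p_{2k-1}^{-1}p_{2k}\in G$ (equal to $e$ for the empty word); $\alpha$ is neutral if $\dot\alpha=e$. Put $K(\alpha):=P\cap p_{2k}^{-1}p_{2k-1}P\cap p_{2k}^{-1}p_{2k-1}p_{2k-2}^{-1}p_{2k-3}P\cap\cdots\cap p_{2k}^{-1}p_{2k-1}\cdots p_2^{-1}p_1P\subseteq P$ (equal to $P$ for the empty word); sets of this form are the constructible right ideals of $P$. For a map $w\colon P\to B$ into a unital $\mathrm C^*$-algebra, $\dot w_\alpha:=w_{p_1}^*w_{p_2}\cdots w_{p_{2k-1}}^*w_{p_{2k}}$ ($=1$ for the empty word). $\mathcal T_u(P)$ is the universal $\mathrm C^*$-algebra with generators $\{t_p:p\in P\}$ subject to: (T1) $t_e=1$; (T2) $\dot t_\alpha=0$ if $\alpha$ is neutral and $K(\alpha)=\emptyset$; (T3) $\dot t_\alpha=\dot t_\beta$ if $\alpha,\beta$ are neutral and $K(\alpha)=K(\beta)$; (T4) $\prod_{\beta\in F}(\dot t_\alpha-\dot t_\beta)=0$ if $\alpha$ is a neutral word and $F$ is a finite set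 of neutral words with $K(\alpha)=\bigcup_{\beta\in F}K(\beta)$. The full diagonal is $D_u:=\overline{\mathrm{span}}\{\dot t_\alpha:\dot\alpha=e\}\subseteq\mathcal T_u(P)$, a commutative unital $\mathrm C^*$-subalgebra. A unital $*$-homomorphism $\rho$ of $\mathcal T_u(P)$ is jointly proper if $\prod_{\alpha\in F}(1-\rho(\dot t_\alpha))\neq0$ for every finite collection $F$ of neutral words such that $K(\alpha)$ is a proper constructible right ideal (i.e. $K(\alpha)\neq P$) for each $\alpha\in F$.
   Formalization: In relation (T4) the finite set F is taken to be nonempty; with F empty and K(α) empty, as for the free monoid on two generators, the empty product would force 1 = 0, making T_u(P) zero and the claim false; the case of empty K(α) is covered by (T2). *)

theory Defs
  imports Complex_Main "HOL-Algebra.Coset" "HOL-Algebra.Ring"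
begin

section \<open>Unital *-algebras and unital C*-algebras\<close>

text \<open>
  The algebras are carrier based, in the style of HOL-Algebra: the carrier of the universal
  C*-algebra of a submonoid depends on the submonoid, so it cannot be a type.
\<close>

record 'a star_ring = "'a ring" +
  cscale :: "complex \<Rightarrow> 'a \<Rightarrow> 'a"
  cadj :: "'a \<Rightarrow> 'a"

record 'a cstar_ring = "'a star_ring" +
  cnorm :: "'a \<Rightarrow> real"

locale unital_star_algebra = ring A for A (structure) +
  assumes cscale_closed: "x \<in> carrier A \<Longrightarrow> cscale A c x \<in> carrier A"
    and cscale_add_right:
      "x \<in> carrier A \<Longrightarrow> y \<in> carrier A \<Longrightarrow> cscale A c (x \<oplus> y) = cscale A c x \<oplus> cscale A c y"
    and cscale_add_left: "x \<in> carrier A \<Longrightarrow> cscale A (c + d) x = cscale A c x \<oplus> cscale A d x"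
    and cscale_cscale: "x \<in> carrier A \<Longrightarrow> cscale A c (cscale A d x) = cscale A (c * d) x"
    and cscale_one: "x \<in> carrier A \<Longrightarrow> cscale A 1 x = x"
    and cscale_mult_left:
      "x \<in> carrier A \<Longrightarrow> y \<in> carrier A \<Longrightarrow> cscale A c x \<otimes> y = cscale A c (x \<otimes> y)"
    and cscale_mult_right:
      "x \<in> carrier A \<Longrightarrow> y \<in> carrier A \<Longrightarrow> x \<otimes> cscale A c y = cscale A c (x \<otimes> y)"
    and cadj_closed: "x \<in> carrier A \<Longrightarrow> cadj A x \<in> carrier A"
    and cadj_cadj: "x \<in> carrier A \<Longrightarrow> cadj A (cadj A x) = x"
    and cadj_add:
      "x \<in> carrier A \<Longrightarrow> y \<in> carrier A \<Longrightarrow> cadj A (x \<oplus> y) = cadj A x \<oplus> cadj A y"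
    and cadj_cscale: "x \<in> carrier A \<Longrightarrow> cadj A (cscale A c x) = cscale A (cnj c) (cadj A x)"
    and cadj_mult:
      "x \<in> carrier A \<Longrightarrow> y \<in> carrier A \<Longrightarrow> cadj A (x \<otimes> y) = cadj A y \<otimes> cadj A x"

definition cstar_seminorm :: "('a, 'm) star_ring_scheme \<Rightarrow> ('a \<Rightarrow> real) \<Rightarrow> bool" where
  "cstar_seminorm A N \<longleftrightarrow>
     (\<forall>x\<in>carrier A. 0 \<le> N x) \<and>
     (\<forall>x\<in>carrier A. \<forall>y\<in>carrier A. N (x \<oplus>\<^bsub>A\<^esub> y) \<le> N x + N y) \<and>
     (\<forall>c. \<forall>x\<in>carrier A. N (cscale A c x) = cmod c * N x) \<and>
     (\<forall>x\<in>carrier A. \<forall>y\<in>carrier A. N (x \<otimes>\<^bsub>A\<^esub> y) \<le> N x * N y) \<and>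
     (\<forall>x\<in>carrier A. N (cadj A x \<otimes>\<^bsub>A\<^esub> x) = (N x)\<^sup>2)"

text \<open>Cauchy sequences in \<open>A\<close> with respect to a seminorm \<open>N\<close>.\<close>

definition cauchy_seqs :: "('a, 'm) star_ring_scheme \<Rightarrow> ('a \<Rightarrow> real) \<Rightarrow> (nat \<Rightarrow> 'a) set" where
  "cauchy_seqs A N =
     {x. range x \<subseteq> carrier A \<and>
         (\<forall>\<epsilon>>0. \<exists>M. \<forall>m\<ge>M. \<forall>n\<ge>M. N (x m \<ominus>\<^bsub>A\<^esub> x n) < \<epsilon>)}"

text \<open>The zero algebra is not excluded.\<close>

locale unital_cstar_algebra = unital_star_algebra +
  assumes cnorm_cstar_seminorm: "cstar_seminorm A (cnorm A)"
    and cnorm_eq_zero: "x \<in> carrier A \<Longrightarrow> cnorm A x = 0 \<Longrightarrow> x = \<zero>"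
    and cnorm_complete:
      "s \<in> cauchy_seqs A (cnorm A) \<Longrightarrow> \<exists>l\<in>carrier A. (\<lambda>n. cnorm A (s n \<ominus> l)) \<longlonglongrightarrow> 0"

definition unital_star_hom ::
    "('a, 'm) star_ring_scheme \<Rightarrow> ('b, 'n) star_ring_scheme \<Rightarrow> ('a \<Rightarrow> 'b) set" where
  "unital_star_hom A B =
     {\<rho> \<in> ring_hom A B.
        (\<forall>c. \<forall>x\<in>carrier A. \<rho> (cscale A c x) = cscale B c (\<rho> x)) \<and>
        (\<forall>x\<in>carrier A. \<rho> (cadj A x) = cadj B (\<rho> x))}"

inductive_set clin_span :: "('a, 'm) star_ring_scheme \<Rightarrow> 'a set \<Rightarrow> 'a set"
  for A (structure) and S where
  zero: "\<zero> \<in> clin_span A S"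
| step: "s \<in> S \<Longrightarrow> v \<in> clin_span A S \<Longrightarrow> cscale A c s \<oplus> v \<in> clin_span A S"

definition cnorm_closure :: "('a, 'm) cstar_ring_scheme \<Rightarrow> 'a set \<Rightarrow> 'a set" where
  "cnorm_closure A S = {x \<in> carrier A. \<forall>\<epsilon>>0. \<exists>s\<in>S. cnorm A (x \<ominus>\<^bsub>A\<^esub> s) < \<epsilon>}"


section \<open>Universal C*-algebras given by generators and relations\<close>

text \<open>
  The free unital *-algebra on \<open>X\<close>: finitely supported complex functions on words in the letters
  \<open>x\<close> and \<open>x\<^sup>*\<close> for \<open>x \<in> X\<close>, with convolution over all factorisations of a word.
\<close>

datatype 'x letter = Gen 'x | Adj 'x

fun flip_letter :: "'x letter \<Rightarrow> 'x letter" where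
  "flip_letter (Gen x) = Adj x"
| "flip_letter (Adj x) = Gen x"

definition free_star_algebra :: "'x set \<Rightarrow> ('x letter list \<Rightarrow> complex) star_ring" where
  "free_star_algebra X =
    \<lparr> carrier = {f. finite {w. f w \<noteq> 0} \<and> (\<forall>w. f w \<noteq> 0 \<longrightarrow> set w \<subseteq> Gen ` X \<union> Adj ` X)},
      mult = (\<lambda>f g w. \<Sum>k\<le>length w. f (take k w) * g (drop k w)),
      one = (\<lambda>w. if w = [] then 1 else 0),
      zero = (\<lambda>w. 0),
      add = (\<lambda>f g w. f w + g w),
      cscale = (\<lambda>c f w. c * f w),
      cadj = (\<lambda>f w. cnj (f (rev (map flip_letter w)))) \<rparr>"

definition free_gen :: "'x \<Rightarrow> 'x letter list \<Rightarrow> complex" where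
  "free_gen x = (\<lambda>w. if w = [Gen x] then 1 else 0)"

text \<open>
  The Hausdorff completion of a *-algebra in a C*-seminorm: Cauchy sequences modulo sequences
  tending to zero.
\<close>

definition cauchy_rel ::
    "('a, 'm) star_ring_scheme \<Rightarrow> ('a \<Rightarrow> real) \<Rightarrow> ((nat \<Rightarrow> 'a) \<times> (nat \<Rightarrow> 'a)) set" where
  "cauchy_rel A N =
     {(x, y). x \<in> cauchy_seqs A N \<and> y \<in> cauchy_seqs A N \<and>
              (\<lambda>n. N (x n \<ominus>\<^bsub>A\<^esub> y n)) \<longlonglongrightarrow> 0}"

definition cauchy_class ::
    "('a, 'm) star_ring_scheme \<Rightarrow> ('a \<Rightarrow> real) \<Rightarrow> (nat \<Rightarrow> 'a) \<Rightarrow> (nat \<Rightarrow> 'a) set" where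
  "cauchy_class A N x = cauchy_rel A N `` {x}"

definition cstar_completion ::
    "('a, 'm) star_ring_scheme \<Rightarrow> ('a \<Rightarrow> real) \<Rightarrow> (nat \<Rightarrow> 'a) set cstar_ring" where
  "cstar_completion A N =
    \<lparr> carrier = cauchy_seqs A N // cauchy_rel A N,
      mult = (\<lambda>U V. \<Union>x\<in>U. \<Union>y\<in>V. cauchy_class A N (\<lambda>n. x n \<otimes>\<^bsub>A\<^esub> y n)),
      one = cauchy_class A N (\<lambda>n. \<one>\<^bsub>A\<^esub>),
      zero = cauchy_class A N (\<lambda>n. \<zero>\<^bsub>A\<^esub>),
      add = (\<lambda>U V. \<Union>x\<in>U. \<Union>y\<in>V. cauchy_class A N (\<lambda>n. x n \<oplus>\<^bsub>A\<^esub> y n)),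
      cscale = (\<lambda>c U. \<Union>x\<in>U. cauchy_class A N (\<lambda>n. cscale A c (x n))),
      cadj = (\<lambda>U. \<Union>x\<in>U. cauchy_class A N (\<lambda>n. cadj A (x n))),
      cnorm = (\<lambda>U. THE r. \<exists>x\<in>U. (\<lambda>n. N (x n)) \<longlonglongrightarrow> r) \<rparr>"

text \<open>
  The universal C*-algebra on generators \<open>X\<close> in which the relators \<open>R\<close> vanish is the completion of
  the free *-algebra in the largest C*-seminorm vanishing on \<open>R\<close>.  The supremum is meaningful only
  if the relations bound the norms of the generators; the relations used below make every
  generator an isometry (take the words \<open>[(p, p)]\<close> and \<open>[]\<close> in the third family).
\<close>

definition universal_seminorm ::
    "'x set \<Rightarrow> ('x letter list \<Rightarrow> complex) set \<Rightarrow> ('x letter list \<Rightarrow> complex) \<Rightarrow> real" where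
  "universal_seminorm X R f =
     (SUP N\<in>{N. cstar_seminorm (free_star_algebra X) N \<and> (\<forall>r\<in>R. N r = 0)}. N f)"

definition universal_cstar ::
    "'x set \<Rightarrow> ('x letter list \<Rightarrow> complex) set \<Rightarrow> (nat \<Rightarrow> 'x letter list \<Rightarrow> complex) set cstar_ring"
  where "universal_cstar X R = cstar_completion (free_star_algebra X) (universal_seminorm X R)"

definition universal_gen ::
    "'x set \<Rightarrow> ('x letter list \<Rightarrow> complex) set \<Rightarrow> 'x \<Rightarrow> (nat \<Rightarrow> 'x letter list \<Rightarrow> complex) set"
  where "universal_gen X R x =
    cauchy_class (free_star_algebra X) (universal_seminorm X R) (\<lambda>n. free_gen x)"


section \<open>Words and constructible right ideals\<close>

text \<open>
  A word \<open>(p\<^sub>1, p\<^sub>2, \<dots>, p\<^sub>2\<^sub>k\<^sub>-\<^sub>1, p\<^sub>2\<^sub>k)\<close> of even length is the list of pairs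
  \<open>[(p\<^sub>1, p\<^sub>2), \<dots>, (p\<^sub>2\<^sub>k\<^sub>-\<^sub>1, p\<^sub>2\<^sub>k)]\<close>.
\<close>

fun word_val :: "('g, 'm) monoid_scheme \<Rightarrow> ('g \<times> 'g) list \<Rightarrow> 'g" where
  "word_val G [] = \<one>\<^bsub>G\<^esub>"
| "word_val G ((p, q) # \<alpha>) = inv\<^bsub>G\<^esub> p \<otimes>\<^bsub>G\<^esub> (q \<otimes>\<^bsub>G\<^esub> word_val G \<alpha>)"

definition neutral_words :: "('g, 'm) monoid_scheme \<Rightarrow> 'g set \<Rightarrow> ('g \<times> 'g) list set" where
  "neutral_words G P = {\<alpha>. set \<alpha> \<subseteq> P \<times> P \<and> word_val G \<alpha> = \<one>\<^bsub>G\<^esub>}"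

text \<open>
  The translating elements in the definition of \<open>K(\<alpha>)\<close> are the inverses of the values of the
  suffixes of \<open>\<alpha>\<close>: \<open>p\<^sub>2\<^sub>k\<^sup>-\<^sup>1 p\<^sub>2\<^sub>k\<^sub>-\<^sub>1 \<cdots> p\<^sub>2\<^sub>j\<^sup>-\<^sup>1 p\<^sub>2\<^sub>j\<^sub>-\<^sub>1\<close> inverts \<open>p\<^sub>2\<^sub>j\<^sub>-\<^sub>1\<^sup>-\<^sup>1 p\<^sub>2\<^sub>j \<cdots> p\<^sub>2\<^sub>k\<^sub>-\<^sub>1\<^sup>-\<^sup>1 p\<^sub>2\<^sub>k\<close>.
\<close>

fun constr_ideal :: "('g, 'm) monoid_scheme \<Rightarrow> 'g set \<Rightarrow> ('g \<times> 'g) list \<Rightarrow> 'g set" where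
  "constr_ideal G P [] = P"
| "constr_ideal G P (pq # \<alpha>) =
     constr_ideal G P \<alpha> \<inter> (inv\<^bsub>G\<^esub> (word_val G (pq # \<alpha>)) <#\<^bsub>G\<^esub> P)"

fun word_op :: "('a, 'm) star_ring_scheme \<Rightarrow> ('g \<Rightarrow> 'a) \<Rightarrow> ('g \<times> 'g) list \<Rightarrow> 'a" where
  "word_op A w [] = \<one>\<^bsub>A\<^esub>"
| "word_op A w ((p, q) # \<alpha>) = cadj A (w p) \<otimes>\<^bsub>A\<^esub> (w q \<otimes>\<^bsub>A\<^esub> word_op A w \<alpha>)"


section \<open>The universal Toeplitz algebra of a submonoid\<close>

definition list_mult :: "('a, 'm) monoid_scheme \<Rightarrow> 'a list \<Rightarrow> 'a" where
  "list_mult A xs = foldr (\<otimes>\<^bsub>A\<^esub>) xs \<one>\<^bsub>A\<^esub>"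

text \<open>
  Finite sets of words are given by duplicate-free enumerations, and products are required to vanish
  for every enumeration; by the third family the factors commute, so the order is immaterial.
  In the fourth family the finite set is nonempty: an empty product would be \<open>1\<close>, and for
  \<open>K(\<alpha>) = \<emptyset>\<close> the relation would collapse the algebra to zero.
\<close>

definition toeplitz_relators ::
    "('g, 'm) monoid_scheme \<Rightarrow> 'g set \<Rightarrow> ('a, 'n) star_ring_scheme \<Rightarrow> ('g \<Rightarrow> 'a) \<Rightarrow> 'a set" where
  "toeplitz_relators G P A w =
     {w \<one>\<^bsub>G\<^esub> \<ominus>\<^bsub>A\<^esub> \<one>\<^bsub>A\<^esub>} \<union>
     {word_op A w \<alpha> | \<alpha>. \<alpha> \<in> neutral_words G P \<and> constr_ideal G P \<alpha> = {}} \<union>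
     {word_op A w \<alpha> \<ominus>\<^bsub>A\<^esub> word_op A w \<beta> | \<alpha> \<beta>.
        \<alpha> \<in> neutral_words G P \<and> \<beta> \<in> neutral_words G P \<and>
        constr_ideal G P \<alpha> = constr_ideal G P \<beta>} \<union>
     {list_mult A (map (\<lambda>\<beta>. word_op A w \<alpha> \<ominus>\<^bsub>A\<^esub> word_op A w \<beta>) F) | \<alpha> F.
        \<alpha> \<in> neutral_words G P \<and> F \<noteq> [] \<and> distinct F \<and> set F \<subseteq> neutral_words G P \<and>
        constr_ideal G P \<alpha> = (\<Union>\<beta>\<in>set F. constr_ideal G P \<beta>)}"

definition free_toeplitz_relators ::
    "('g, 'm) monoid_scheme \<Rightarrow> 'g set \<Rightarrow> ('g letter list \<Rightarrow> complex) set" where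
  "free_toeplitz_relators G P = toeplitz_relators G P (free_star_algebra P) free_gen"

definition toeplitz_univ ::
    "('g, 'm) monoid_scheme \<Rightarrow> 'g set \<Rightarrow> (nat \<Rightarrow> 'g letter list \<Rightarrow> complex) set cstar_ring" where
  "toeplitz_univ G P = universal_cstar P (free_toeplitz_relators G P)"

definition toeplitz_gen ::
    "('g, 'm) monoid_scheme \<Rightarrow> 'g set \<Rightarrow> 'g \<Rightarrow> (nat \<Rightarrow> 'g letter list \<Rightarrow> complex) set" where
  "toeplitz_gen G P = universal_gen P (free_toeplitz_relators G P)"

definition toeplitz_word ::
    "('g, 'm) monoid_scheme \<Rightarrow> 'g set \<Rightarrow> ('g \<times> 'g) list
      \<Rightarrow> (nat \<Rightarrow> 'g letter list \<Rightarrow> complex) set" where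
  "toeplitz_word G P \<alpha> = word_op (toeplitz_univ G P) (toeplitz_gen G P) \<alpha>"

definition full_diagonal ::
    "('g, 'm) monoid_scheme \<Rightarrow> 'g set \<Rightarrow> (nat \<Rightarrow> 'g letter list \<Rightarrow> complex) set set" where
  "full_diagonal G P =
     cnorm_closure (toeplitz_univ G P)
       (clin_span (toeplitz_univ G P) (toeplitz_word G P ` neutral_words G P))"

text \<open>
  The empty collection is allowed here, so a jointly proper homomorphism has nonzero codomain.
\<close>

definition jointly_proper ::
    "('g, 'm) monoid_scheme \<Rightarrow> 'g set \<Rightarrow> ('b, 'n) star_ring_scheme
      \<Rightarrow> ((nat \<Rightarrow> 'g letter list \<Rightarrow> complex) set \<Rightarrow> 'b) \<Rightarrow> bool" where
  "jointly_proper G P B \<rho> \<longleftrightarrow>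
     (\<forall>F. distinct F \<and> set F \<subseteq> neutral_words G P \<and> (\<forall>\<alpha>\<in>set F. constr_ideal G P \<alpha> \<noteq> P) \<longrightarrow>
        list_mult B (map (\<lambda>\<alpha>. \<one>\<^bsub>B\<^esub> \<ominus>\<^bsub>B\<^esub> \<rho> (toeplitz_word G P \<alpha>)) F) \<noteq> \<zero>\<^bsub>B\<^esub>)"

end

(*
  Joint properness is necessary because the product of the 1 - t(alpha), for proper ideals K(alpha),
  is not zero in the universal algebra: in the left regular representation of P it fixes the basis
  vector at the identity, which lies in no proper right ideal.

  Conversely, let rho be jointly proper and let x in D_u satisfy rho(x) = 0. The projections
  t(alpha) commute, so x is approximated by a combination y of the products
  q = t(alpha) (1 - t(gamma_1)) ... (1 - t(gamma_n)), on each of which y acts as a scalar c.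
  If rho(q) = 0, then the ideals K(gamma_i) cover K(alpha): otherwise compress q by the isometry of
  a point of K(alpha) outside all K(gamma_i) to contradict joint properness. Then q = 0 by (T4).
  If rho(q) is not 0, then |c| is at most the norm of (y - x) q, since otherwise q - x q / c would
  have norm less than 1, and its image, the nonzero idempotent rho(q), cannot be the image of u with
  1 - u invertible. So y has norm at most that of y - x, and x = 0. This needs neither continuity
  of rho nor spectral theory in the codomain.
*)

theory Submission
  imports Defs "HOL-Analysis.L2_Norm"
begin

section \<open>Star algebras and C*-seminorms\<close>

text \<open>The approximant \<open>y\<close> need not lie in the kernel of \<open>\<rho>\<close>, so
  applying \<open>\<rho>\<close> to it gives nothing. What is carried along instead is the norm of
  \<open>(c 1 + y) q - x q\<close>: \<open>\<rho>\<close> kills the second term, and on small enough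
  \<open>q\<close> the first is scalar. Adding up over the products \<open>q\<close> would cost a
  factor growing with their number, which depends on the approximation. So \<open>q\<close> is split
  by one projection at a time, and the C*-identity bounds the norm by the maximum over the two
  pieces rather than by their sum. The universal norm is a supremum of seminorms on the free
  algebra. It must be finite, which follows from the relation making every generator an isometry,
  and it must not vanish on the products of complements, for which a single competing seminorm
  suffices. That competitor is the operator norm of the regular representation. The basis vector at
  the identity is cyclic for it, so the free algebra, mapped onto the finitely supported vectors by
  applying its elements to that basis vector, takes the place of a Hilbert space.\<close>

context unital_star_algebra
begin

lemmas star_closed [simp, intro] = cscale_closed cadj_closed

lemma cscale_zero_left [simp]:
  assumes "x \<in> carrier A" shows "cscale A 0 x = \<zero>"
proof -
  have "cscale A 0 x \<oplus> cscale A 0 x = cscale A 0 x"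
    using cscale_add_left[of x 0 0] assms by simp
  then show ?thesis
    using assms by (metis add.l_cancel_one cscale_closed)
qed

lemma cscale_zero_right [simp]: "cscale A c \<zero> = \<zero>"
  using cscale_cscale[of \<zero> c 0] by simp

lemma a_inv_eq_cscale: "x \<in> carrier A \<Longrightarrow> \<ominus> x = cscale A (- 1) x"
  using cscale_add_left[of x "1" "- 1"] cscale_one[of x]
  by (metis add.inv_solve_left' add.inv_closed add_0_right add.right_inverse cscale_closed
      cscale_zero_left minus_equality add.r_inv a_comm)

text \<open>Turns subtraction into operations that the star, homomorphisms and Cauchy sequences are
  already known to respect.\<close>

lemma minus_eq_cscale: "x \<in> carrier A \<Longrightarrow> y \<in> carrier A \<Longrightarrow> x \<ominus> y = x \<oplus> cscale A (- 1) y"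
  by (simp add: a_minus_def a_inv_eq_cscale)

lemma cadj_zero [simp]: "cadj A \<zero> = \<zero>"
  using cadj_cscale[of \<zero> 0] by simp

lemma cadj_one [simp]: "cadj A \<one> = \<one>"
  using cadj_mult[of "cadj A \<one>" \<one>] cadj_cadj[of \<one>] by simp

lemma cadj_minus: "x \<in> carrier A \<Longrightarrow> y \<in> carrier A \<Longrightarrow> cadj A (x \<ominus> y) = cadj A x \<ominus> cadj A y"
  by (simp add: minus_eq_cscale cadj_add cadj_cscale)

lemma minus_mult_left:
  "\<lbrakk>x \<in> carrier A; y \<in> carrier A; z \<in> carrier A\<rbrakk> \<Longrightarrow> (x \<ominus> y) \<otimes> z = x \<otimes> z \<ominus> y \<otimes> z"
  by (simp add: a_minus_def l_distr l_minus)

lemma minus_mult_right: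
  "\<lbrakk>x \<in> carrier A; y \<in> carrier A; z \<in> carrier A\<rbrakk> \<Longrightarrow> z \<otimes> (x \<ominus> y) = z \<otimes> x \<ominus> z \<otimes> y"
  by (simp add: a_minus_def r_distr r_minus)

lemma minus_self [simp]: "x \<in> carrier A \<Longrightarrow> x \<ominus> x = \<zero>"
  by (simp add: a_minus_def r_neg)

end

text \<open>The seminorm is a parameter apart from the algebra: the same facts then serve the norm
  of a completion, the universal seminorm and every seminorm in its defining supremum.\<close>

locale star_algebra_seminorm = unital_star_algebra A for A (structure) +
  fixes N :: "'a \<Rightarrow> real"
  assumes cstar_seminorm: "cstar_seminorm A N"
begin

lemma norm_nonneg [simp]: "x \<in> carrier A \<Longrightarrow> 0 \<le> N x"
  and norm_triangle: "x \<in> carrier A \<Longrightarrow> y \<in> carrier A \<Longrightarrow> N (x \<oplus> y) \<le> N x + N y"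
  and norm_cscale: "x \<in> carrier A \<Longrightarrow> N (cscale A c x) = cmod c * N x"
  and norm_mult: "x \<in> carrier A \<Longrightarrow> y \<in> carrier A \<Longrightarrow> N (x \<otimes> y) \<le> N x * N y"
  and norm_cstar: "x \<in> carrier A \<Longrightarrow> N (cadj A x \<otimes> x) = (N x)\<^sup>2"
  using cstar_seminorm unfolding cstar_seminorm_def by blast+

lemma norm_zero [simp]: "N \<zero> = 0"
  using norm_cscale[of \<zero> 0] by simp

text \<open>One factor \<open>N x\<close> cancels between the C*-identity and submultiplicativity; a
  seminorm may vanish at \<open>x\<close>, hence the case split.\<close>

lemma norm_adj_le: "x \<in> carrier A \<Longrightarrow> N x \<le> N (cadj A x)"
proof -
  assume x: "x \<in> carrier A"
  have "N x * N x \<le> N (cadj A x) * N x"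
    using norm_cstar[OF x] norm_mult[of "cadj A x" x] x by (simp add: power2_eq_square)
  then show ?thesis
    using x norm_nonneg[OF x] norm_nonneg[of "cadj A x"] by (cases "N x = 0") auto
qed

lemma norm_cadj [simp]: "x \<in> carrier A \<Longrightarrow> N (cadj A x) = N x"
  using norm_adj_le[of x] norm_adj_le[of "cadj A x"] by (simp add: cadj_cadj)

text \<open>The C*-identity gives \<open>N e * N e = N e\<close>, so \<open>N e\<close> is 0 or 1.
  Both occur, even for \<open>e = \<one>\<close>, since the seminorm may be zero.\<close>

lemma norm_projection_le:
  assumes "e \<in> carrier A" "cadj A e = e" "e \<otimes> e = e" shows "N e \<le> 1"
proof -
  have "N e * N e = N e"
    using norm_cstar[of e] assms by (simp add: power2_eq_square)
  then show ?thesis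
    by (cases "N e = 0") auto
qed

lemma norm_one_le: "N \<one> \<le> 1"
  by (rule norm_projection_le) auto

lemma norm_uminus [simp]: "x \<in> carrier A \<Longrightarrow> N (\<ominus> x) = N x"
  by (simp add: a_inv_eq_cscale norm_cscale)

lemma norm_minus_commute: "x \<in> carrier A \<Longrightarrow> y \<in> carrier A \<Longrightarrow> N (x \<ominus> y) = N (y \<ominus> x)"
proof -
  assume "x \<in> carrier A" "y \<in> carrier A"
  then have "x \<ominus> y = \<ominus> (y \<ominus> x)"
    by (simp add: a_minus_def minus_add a_comm)
  then show ?thesis
    using \<open>x \<in> carrier A\<close> \<open>y \<in> carrier A\<close> by simp
qed

lemma norm_minus_triangle:
  assumes "x \<in> carrier A" "y \<in> carrier A" "z \<in> carrier A"
  shows "N (x \<ominus> z) \<le> N (x \<ominus> y) + N (y \<ominus> z)"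
proof -
  have "x \<ominus> z = (x \<ominus> y) \<oplus> (y \<ominus> z)"
    using assms by (simp add: a_minus_def a_assoc[symmetric]) (simp add: a_assoc l_neg)
  then show ?thesis
    using norm_triangle[of "x \<ominus> y" "y \<ominus> z"] assms by simp
qed

lemma norm_le_minus:
  assumes "x \<in> carrier A" "y \<in> carrier A" shows "N x \<le> N (x \<ominus> y) + N y"
  using norm_minus_triangle[of x y \<zero>] assms by (simp add: a_minus_def)

lemma norm_minus_le:
  assumes "x \<in> carrier A" "y \<in> carrier A" shows "N (x \<ominus> y) \<le> N x + N y"
  using norm_triangle[of x "\<ominus> y"] assms by (simp add: a_minus_def)

lemma abs_norm_diff_le:
  assumes "x \<in> carrier A" "y \<in> carrier A" shows "\<bar>N x - N y\<bar> \<le> N (x \<ominus> y)"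
  using norm_le_minus[of x y] norm_le_minus[of y x] norm_minus_commute[of x y] assms by simp

lemma norm_add_diff_le:
  assumes "x \<in> carrier A" "y \<in> carrier A" "x' \<in> carrier A" "y' \<in> carrier A"
  shows "N ((x \<oplus> y) \<ominus> (x' \<oplus> y')) \<le> N (x \<ominus> x') + N (y \<ominus> y')"
proof -
  have "(x \<oplus> y) \<ominus> (x' \<oplus> y') = (x \<ominus> x') \<oplus> (y \<ominus> y')"
    using assms by (simp add: a_minus_def minus_add a_ac)
  then show ?thesis
    using norm_triangle assms by simp
qed

lemma norm_mult_diff_le:
  assumes "x \<in> carrier A" "y \<in> carrier A" "x' \<in> carrier A" "y' \<in> carrier A"
  shows "N (x \<otimes> y \<ominus> x' \<otimes> y') \<le> N (x \<ominus> x') * N y + N x' * N (y \<ominus> y')"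
proof -
  have "x \<otimes> y \<ominus> x' \<otimes> y' = (x \<ominus> x') \<otimes> y \<oplus> x' \<otimes> (y \<ominus> y')"
    using assms by (simp add: minus_mult_left minus_mult_right)
      (simp add: a_minus_def a_assoc[symmetric], simp add: a_assoc l_neg)
  then have "N (x \<otimes> y \<ominus> x' \<otimes> y') \<le> N ((x \<ominus> x') \<otimes> y) + N (x' \<otimes> (y \<ominus> y'))"
    using norm_triangle[of "(x \<ominus> x') \<otimes> y" "x' \<otimes> (y \<ominus> y')"] assms by simp
  also have "\<dots> \<le> N (x \<ominus> x') * N y + N x' * N (y \<ominus> y')"
    using assms by (intro add_mono norm_mult) auto
  finally show ?thesis .
qed

lemma norm_cscale_diff:
  assumes "x \<in> carrier A" "y \<in> carrier A"
  shows "N (cscale A c x \<ominus> cscale A c y) = cmod c * N (x \<ominus> y)"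
proof -
  have "cscale A c x \<ominus> cscale A c y = cscale A c (x \<ominus> y)"
    using assms by (simp add: minus_eq_cscale cscale_cscale cscale_add_right mult.commute)
  then show ?thesis
    using assms by (simp add: norm_cscale)
qed

lemma norm_cadj_diff:
  assumes "x \<in> carrier A" "y \<in> carrier A"
  shows "N (cadj A x \<ominus> cadj A y) = N (x \<ominus> y)"
  using assms by (simp add: cadj_minus[symmetric])

text \<open>The factor 2 arises once, from the triangle inequality at \<open>n = 0\<close>. Passing
  from \<open>y\<close> to \<open>cadj A y \<otimes> y\<close> squares the left side and
  \<open>K\<close> but leaves the 2 alone, and the new element still commutes with
  \<open>e\<close>.\<close>

lemma norm_pow_le_projection:
  assumes e: "e \<in> carrier A" "cadj A e = e" "e \<otimes> e = e"
    and "y \<in> carrier A" "e \<otimes> y = y \<otimes> e"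
    and "N (y \<otimes> e) \<le> K" "N (y \<otimes> (\<one> \<ominus> e)) \<le> K"
  shows "N y ^ (2 ^ n) \<le> 2 * K ^ (2 ^ n)"
  using assms(4-)
proof (induction n arbitrary: y K)
  case 0
  have "y = y \<otimes> e \<oplus> y \<otimes> (\<one> \<ominus> e)"
    using 0(1) e by (simp add: minus_mult_right)
      (simp add: a_minus_def a_lcomm[of "y \<otimes> e" y] r_neg)
  then have "N y \<le> N (y \<otimes> e) + N (y \<otimes> (\<one> \<ominus> e))"
    using norm_triangle[of "y \<otimes> e" "y \<otimes> (\<one> \<ominus> e)"] 0(1) e by simp
  then show ?case using 0 by simp
next
  case (Suc n)
  note y = Suc.prems(1)
  have e': "(\<one> \<ominus> e) \<in> carrier A" "cadj A (\<one> \<ominus> e) = \<one> \<ominus> e"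
    using e by (simp_all add: cadj_minus)
  have e'': "(\<one> \<ominus> e) \<otimes> (\<one> \<ominus> e) = \<one> \<ominus> e" "(\<one> \<ominus> e) \<otimes> y = y \<otimes> (\<one> \<ominus> e)"
    using e Suc.prems by (simp_all add: minus_mult_left minus_mult_right) (simp add: a_minus_def r_neg)
  \<comment> \<open>Stated for a general projection \<open>f\<close> because both \<open>e\<close>
    and \<open>\<one> \<ominus> e\<close> are inserted.\<close>
  have *: "cadj A y \<otimes> y \<otimes> f = cadj A (y \<otimes> f) \<otimes> (y \<otimes> f)" "f \<otimes> (cadj A y \<otimes> y) = cadj A y \<otimes> y \<otimes> f"
    if f: "f \<in> carrier A" "cadj A f = f" "f \<otimes> f = f" "f \<otimes> y = y \<otimes> f" for f
  proof -
    have c: "f \<otimes> cadj A y = cadj A y \<otimes> f"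
      using cadj_mult[OF f(1) y] cadj_mult[OF y f(1)] f by simp
    then show "f \<otimes> (cadj A y \<otimes> y) = cadj A y \<otimes> y \<otimes> f"
      using f y by (metis cadj_closed m_assoc)
    have "cadj A (y \<otimes> f) \<otimes> (y \<otimes> f) = cadj A y \<otimes> (f \<otimes> y \<otimes> f)"
      using f(1,2) y c by (simp add: cadj_mult m_assoc)
    also have "f \<otimes> y \<otimes> f = y \<otimes> f"
      unfolding f(4) using f(1,3) y by (simp add: m_assoc)
    also have "cadj A y \<otimes> (y \<otimes> f) = cadj A y \<otimes> y \<otimes> f"
      using f(1) y by (simp add: m_assoc)
    finally show "cadj A y \<otimes> y \<otimes> f = cadj A (y \<otimes> f) \<otimes> (y \<otimes> f)" by simp
  qed
  have bound: "N (cadj A y \<otimes> y \<otimes> f) \<le> K\<^sup>2"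
    if "f \<in> carrier A" "cadj A f = f" "f \<otimes> f = f" "f \<otimes> y = y \<otimes> f" "N (y \<otimes> f) \<le> K" for f
    using *(1)[of f] norm_cstar[of "y \<otimes> f"] y that by (simp add: power_mono)
  have "N (cadj A y \<otimes> y) ^ 2 ^ n \<le> 2 * (K\<^sup>2) ^ 2 ^ n"
    using Suc.prems y e e' e'' by (intro Suc.IH * bound) auto
  then show ?case
    using y by (simp add: norm_cstar power_mult)
qed

text \<open>
  The triangle inequality loses a factor \<open>2\<close>; since \<open>N (y\<^sup>*y) = (N y)\<^sup>2\<close>, passing repeatedly from \<open>y\<close> to
  \<open>y\<^sup>*y\<close> removes it.
\<close>

lemma norm_le_projection:
  assumes "e \<in> carrier A" "cadj A e = e" "e \<otimes> e = e"
    and "y \<in> carrier A" "e \<otimes> y = y \<otimes> e"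
    and "N (y \<otimes> e) \<le> K" "N (y \<otimes> (\<one> \<ominus> e)) \<le> K"
  shows "N y \<le> K"
proof (rule ccontr)
  assume "\<not> N y \<le> K"
  have K: "0 \<le> K"
    using norm_nonneg[of "y \<otimes> e"] assms by (meson m_closed order_trans)
  have le: "N y ^ (2 ^ n) \<le> 2 * K ^ (2 ^ n)" for n
    using assms by (rule norm_pow_le_projection)
  have "K \<noteq> 0"
    using le[of 0] \<open>\<not> N y \<le> K\<close> by auto
  with K have "0 < K" by simp
  \<comment> \<open>The powers of \<open>N y / K > 1\<close> are unbounded, yet those with exponent
    \<open>2 ^ n\<close> stay at most 2.\<close>
  obtain n where n: "2 < (N y / K) ^ n"
    using \<open>\<not> N y \<le> K\<close> \<open>0 < K\<close> real_arch_pow[of "N y / K" 2] by auto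
  also have "\<dots> \<le> (N y / K) ^ (2 ^ n)"
    using \<open>\<not> N y \<le> K\<close> \<open>0 < K\<close> by (intro power_increasing) auto
  finally show False
    using le[of n] \<open>0 < K\<close> by (simp add: power_divide field_simps)
qed

end


section \<open>Completion in a C*-seminorm\<close>

lemma (in unital_cstar_algebra) star_algebra_seminorm_cnorm: "star_algebra_seminorm A (cnorm A)"
  using unital_star_algebra_axioms cnorm_cstar_seminorm
  by (intro star_algebra_seminorm.intro star_algebra_seminorm_axioms.intro)

sublocale unital_cstar_algebra \<subseteq> star_algebra_seminorm A "cnorm A"
  by (rule star_algebra_seminorm_cnorm)

lemma LIMSEQ_null_comparison:
  fixes f g :: "nat \<Rightarrow> real"
  assumes "\<And>n. \<bar>f n\<bar> \<le> g n" "g \<longlonglongrightarrow> 0" shows "f \<longlonglongrightarrow> 0"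
  using tendsto_0_le[OF assms(2), of f 1] assms(1) abs_le_iff
  by (metis (mono_tags, lifting) abs_ge_self always_eventually mult.right_neutral order_trans real_norm_def)

context star_algebra_seminorm
begin

section \<open>Cauchy sequences under the algebra operations\<close>

lemma cauchy_seqs_carrier: "x \<in> cauchy_seqs A N \<Longrightarrow> x n \<in> carrier A"
  by (auto simp: cauchy_seqs_def)

lemma cauchy_seqsD:
  "x \<in> cauchy_seqs A N \<Longrightarrow> 0 < \<epsilon> \<Longrightarrow> \<exists>M. \<forall>m\<ge>M. \<forall>n\<ge>M. N (x m \<ominus> x n) < \<epsilon>"
  by (auto simp: cauchy_seqs_def)

lemma cauchy_seqsI:
  assumes "\<And>n. x n \<in> carrier A"
    and "\<And>\<epsilon>. 0 < \<epsilon> \<Longrightarrow> \<exists>M. \<forall>m\<ge>M. \<forall>n\<ge>M. N (x m \<ominus> x n) < \<epsilon>"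
  shows "x \<in> cauchy_seqs A N"
  using assms by (auto simp: cauchy_seqs_def)

lemma cauchy_seqs_const: "a \<in> carrier A \<Longrightarrow> (\<lambda>n. a) \<in> cauchy_seqs A N"
  by (rule cauchy_seqsI) auto

text \<open>Besides boundedness, this supplies the limit that becomes the norm of the class in the
  completion.\<close>

lemma convergent_norm_cauchy:
  assumes "x \<in> cauchy_seqs A N" shows "convergent (\<lambda>n. N (x n))"
proof (rule real_Cauchy_convergent, rule CauchyI)
  fix \<epsilon> :: real assume "0 < \<epsilon>"
  then obtain M where M: "\<forall>m\<ge>M. \<forall>n\<ge>M. N (x m \<ominus> x n) < \<epsilon>"
    using cauchy_seqsD[OF assms] by blast
  have "norm (N (x m) - N (x n)) < \<epsilon>" if "M \<le> m" "M \<le> n" for m n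
    using abs_norm_diff_le[of "x m" "x n"] M that cauchy_seqs_carrier[OF assms] by fastforce
  then show "\<exists>M. \<forall>m\<ge>M. \<forall>n\<ge>M. norm (N (x m) - N (x n)) < \<epsilon>"
    by blast
qed

lemma bounded_norm_cauchy:
  assumes "x \<in> cauchy_seqs A N"
  obtains K where "0 < K" "\<And>n. N (x n) \<le> K"
proof -
  have "Bseq (\<lambda>n. N (x n))"
    using convergent_norm_cauchy[OF assms] by (rule convergent_imp_Bseq)
  then obtain K where "0 < K" "\<forall>n. norm (N (x n)) \<le> K"
    by (rule BseqE)
  then show thesis
    using that by (metis abs_le_D1 real_norm_def)
qed

lemma cauchy_seqs_add:
  assumes "x \<in> cauchy_seqs A N" "y \<in> cauchy_seqs A N"
  shows "(\<lambda>n. x n \<oplus> y n) \<in> cauchy_seqs A N"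
proof (rule cauchy_seqsI)
  note [simp] = assms[THEN cauchy_seqs_carrier]
  show "x n \<oplus> y n \<in> carrier A" for n
    by simp
  fix \<epsilon> :: real assume "0 < \<epsilon>"
  then obtain M1 M2 where M: "\<forall>m\<ge>M1. \<forall>n\<ge>M1. N (x m \<ominus> x n) < \<epsilon> / 2"
    "\<forall>m\<ge>M2. \<forall>n\<ge>M2. N (y m \<ominus> y n) < \<epsilon> / 2"
    using assms[THEN cauchy_seqsD] half_gt_zero by meson
  have "N (x m \<oplus> y m \<ominus> (x n \<oplus> y n)) < \<epsilon>" if "max M1 M2 \<le> m" "max M1 M2 \<le> n" for m n
  proof -
    have "N (x m \<oplus> y m \<ominus> (x n \<oplus> y n)) \<le> N (x m \<ominus> x n) + N (y m \<ominus> y n)"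
      by (rule norm_add_diff_le) auto
    also have "\<dots> < \<epsilon> / 2 + \<epsilon> / 2"
      using M that by (intro add_strict_mono) auto
    finally show ?thesis by simp
  qed
  then show "\<exists>M. \<forall>m\<ge>M. \<forall>n\<ge>M. N (x m \<oplus> y m \<ominus> (x n \<oplus> y n)) < \<epsilon>"
    by blast
qed

lemma cauchy_seqs_mult:
  assumes "x \<in> cauchy_seqs A N" "y \<in> cauchy_seqs A N"
  shows "(\<lambda>n. x n \<otimes> y n) \<in> cauchy_seqs A N"
proof (rule cauchy_seqsI)
  note [simp] = assms[THEN cauchy_seqs_carrier]
  show "x n \<otimes> y n \<in> carrier A" for n
    by simp
  obtain K L where K: "0 < K" "\<And>n. N (x n) \<le> K" and L: "0 < L" "\<And>n. N (y n) \<le> L"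
    using bounded_norm_cauchy[OF assms(1)] bounded_norm_cauchy[OF assms(2)] by metis
  fix \<epsilon> :: real assume "0 < \<epsilon>"
  then have "0 < \<epsilon> / (2 * K)" "0 < \<epsilon> / (2 * L)"
    using K L by auto
  then obtain M1 M2 where M: "\<forall>m\<ge>M1. \<forall>n\<ge>M1. N (x m \<ominus> x n) < \<epsilon> / (2 * L)"
    "\<forall>m\<ge>M2. \<forall>n\<ge>M2. N (y m \<ominus> y n) < \<epsilon> / (2 * K)"
    using assms[THEN cauchy_seqsD] by meson
  have "N (x m \<otimes> y m \<ominus> x n \<otimes> y n) < \<epsilon>" if "max M1 M2 \<le> m" "max M1 M2 \<le> n" for m n
  proof -
    have "N (x m \<otimes> y m \<ominus> x n \<otimes> y n) \<le> N (x m \<ominus> x n) * N (y m) + N (x n) * N (y m \<ominus> y n)"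
      by (rule norm_mult_diff_le) auto
    also have "\<dots> \<le> N (x m \<ominus> x n) * L + K * N (y m \<ominus> y n)"
      using K L by (intro add_mono mult_left_mono mult_right_mono) auto
    also have "\<dots> < \<epsilon> / (2 * L) * L + K * (\<epsilon> / (2 * K))"
      using M that K L by (intro add_strict_mono mult_strict_left_mono mult_strict_right_mono) auto
    also have "\<dots> = \<epsilon>"
      using K L by simp
    finally show ?thesis .
  qed
  then show "\<exists>M. \<forall>m\<ge>M. \<forall>n\<ge>M. N (x m \<otimes> y m \<ominus> x n \<otimes> y n) < \<epsilon>"
    by blast
qed

lemma cauchy_seqs_cscale:
  assumes "x \<in> cauchy_seqs A N"
  shows "(\<lambda>n. cscale A c (x n)) \<in> cauchy_seqs A N"
proof (rule cauchy_seqsI)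
  note [simp] = assms[THEN cauchy_seqs_carrier]
  show "cscale A c (x n) \<in> carrier A" for n
    by simp
  fix \<epsilon> :: real assume "0 < \<epsilon>"
  \<comment> \<open>Adding 1 avoids division by zero when \<open>c = 0\<close>.\<close>
  then have "0 < \<epsilon> / (cmod c + 1)"
    by (simp add: add_nonneg_pos)
  then obtain M where M: "\<forall>m\<ge>M. \<forall>n\<ge>M. N (x m \<ominus> x n) < \<epsilon> / (cmod c + 1)"
    using cauchy_seqsD[OF assms] by blast
  have "N (cscale A c (x m) \<ominus> cscale A c (x n)) < \<epsilon>" if "M \<le> m" "M \<le> n" for m n
  proof -
    have "N (cscale A c (x m) \<ominus> cscale A c (x n)) \<le> (cmod c + 1) * N (x m \<ominus> x n)"
      by (simp add: norm_cscale_diff mult_right_mono)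
    also have "\<dots> < (cmod c + 1) * (\<epsilon> / (cmod c + 1))"
      using M that by (intro mult_strict_left_mono) (auto simp: add_nonneg_pos)
    also have "\<dots> = \<epsilon>"
      using norm_ge_zero[of c] by (simp add: add_nonneg_eq_0_iff)
    finally show ?thesis .
  qed
  then show "\<exists>M. \<forall>m\<ge>M. \<forall>n\<ge>M. N (cscale A c (x m) \<ominus> cscale A c (x n)) < \<epsilon>"
    by blast
qed

lemma cauchy_seqs_cadj:
  assumes "x \<in> cauchy_seqs A N"
  shows "(\<lambda>n. cadj A (x n)) \<in> cauchy_seqs A N"
  using cauchy_seqsD[OF assms] cauchy_seqs_carrier[OF assms]
  by (intro cauchy_seqsI) (auto simp: norm_cadj_diff)

section \<open>Cauchy classes and the operations on them\<close>

lemma equiv_cauchy_rel: "equiv (cauchy_seqs A N) (cauchy_rel A N)"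
proof (rule equivI)
  show "cauchy_rel A N \<subseteq> cauchy_seqs A N \<times> cauchy_seqs A N"
    by (auto simp: cauchy_rel_def)
  show "refl_on (cauchy_seqs A N) (cauchy_rel A N)"
    by (auto simp: refl_on_def cauchy_rel_def cauchy_seqs_carrier)
  show "sym (cauchy_rel A N)"
    by (auto simp: sym_def cauchy_rel_def norm_minus_commute[OF cauchy_seqs_carrier cauchy_seqs_carrier])
  show "trans (cauchy_rel A N)"
  proof (rule transI)
    fix x y z assume xy: "(x, y) \<in> cauchy_rel A N" and yz: "(y, z) \<in> cauchy_rel A N"
    then have c: "x n \<in> carrier A" "y n \<in> carrier A" "z n \<in> carrier A" for n
      by (auto simp: cauchy_rel_def cauchy_seqs_carrier)
    have "(\<lambda>n. N (x n \<ominus> y n) + N (y n \<ominus> z n)) \<longlonglongrightarrow> 0 + 0"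
      using xy yz by (intro tendsto_add) (auto simp: cauchy_rel_def)
    then have "(\<lambda>n. N (x n \<ominus> z n)) \<longlonglongrightarrow> 0"
      using c by (intro LIMSEQ_null_comparison[of "\<lambda>n. N (x n \<ominus> z n)"])
        (auto simp: norm_minus_triangle)
    then show "(x, z) \<in> cauchy_rel A N"
      using xy yz by (auto simp: cauchy_rel_def)
  qed
qed

lemma cauchy_class_eq_iff:
  assumes "x \<in> cauchy_seqs A N" "y \<in> cauchy_seqs A N"
  shows "cauchy_class A N x = cauchy_class A N y \<longleftrightarrow> (\<lambda>n. N (x n \<ominus> y n)) \<longlonglongrightarrow> 0"
  unfolding cauchy_class_def eq_equiv_class_iff[OF equiv_cauchy_rel assms]
  using assms by (simp add: cauchy_rel_def)

lemma mem_cauchy_class_iff: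
  assumes "x \<in> cauchy_seqs A N"
  shows "y \<in> cauchy_class A N x \<longleftrightarrow> y \<in> cauchy_seqs A N \<and> (\<lambda>n. N (y n \<ominus> x n)) \<longlonglongrightarrow> 0"
  using assms norm_minus_commute[OF cauchy_seqs_carrier[OF assms] cauchy_seqs_carrier]
  by (auto simp: cauchy_class_def cauchy_rel_def cong: conj_cong)

lemma cauchy_class_self: "x \<in> cauchy_seqs A N \<Longrightarrow> x \<in> cauchy_class A N x"
  by (simp add: mem_cauchy_class_iff cauchy_seqs_carrier)

lemma cauchy_class_nonempty: "x \<in> cauchy_seqs A N \<Longrightarrow> cauchy_class A N x \<noteq> {}"
  using cauchy_class_self by blast

lemma carrier_completion: "carrier (cstar_completion A N) = cauchy_class A N ` cauchy_seqs A N"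
  by (auto simp: cstar_completion_def quotient_def cauchy_class_def)

lemma completion_one: "\<one>\<^bsub>cstar_completion A N\<^esub> = cauchy_class A N (\<lambda>n. \<one>)"
  and completion_zero: "\<zero>\<^bsub>cstar_completion A N\<^esub> = cauchy_class A N (\<lambda>n. \<zero>)"
  by (simp_all add: cstar_completion_def)

text \<open>The sum in the completion is a union over representatives. It collapses to one class
  because all representatives yield the same class and the classes are nonempty; the other
  operations are treated alike.\<close>

lemma completion_add:
  assumes x: "x \<in> cauchy_seqs A N" and y: "y \<in> cauchy_seqs A N"
  shows "cauchy_class A N x \<oplus>\<^bsub>cstar_completion A N\<^esub> cauchy_class A N y =
    cauchy_class A N (\<lambda>n. x n \<oplus> y n)"
proof -
  have "cauchy_class A N (\<lambda>n. x' n \<oplus> y' n) = cauchy_class A N (\<lambda>n. x n \<oplus> y n)"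
    if "x' \<in> cauchy_class A N x" "y' \<in> cauchy_class A N y" for x' y'
  proof -
    have *: "x' \<in> cauchy_seqs A N" "y' \<in> cauchy_seqs A N"
        "(\<lambda>n. N (x' n \<ominus> x n)) \<longlonglongrightarrow> 0" "(\<lambda>n. N (y' n \<ominus> y n)) \<longlonglongrightarrow> 0"
      using that x y by (auto simp: mem_cauchy_class_iff)
    have "(\<lambda>n. N (x' n \<ominus> x n) + N (y' n \<ominus> y n)) \<longlonglongrightarrow> 0"
      using tendsto_add[OF *(3,4)] by simp
    then have "(\<lambda>n. N ((x' n \<oplus> y' n) \<ominus> (x n \<oplus> y n))) \<longlonglongrightarrow> 0"
      using x y * by (intro LIMSEQ_null_comparison[of "\<lambda>n. N ((x' n \<oplus> y' n) \<ominus> (x n \<oplus> y n))"])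
        (auto simp: norm_add_diff_le cauchy_seqs_carrier)
    then show ?thesis
      using x y * by (simp add: cauchy_class_eq_iff cauchy_seqs_add)
  qed
  then show ?thesis
    using cauchy_class_nonempty[OF x] cauchy_class_nonempty[OF y] by (simp add: cstar_completion_def)
qed

lemma completion_mult:
  assumes x: "x \<in> cauchy_seqs A N" and y: "y \<in> cauchy_seqs A N"
  shows "cauchy_class A N x \<otimes>\<^bsub>cstar_completion A N\<^esub> cauchy_class A N y =
    cauchy_class A N (\<lambda>n. x n \<otimes> y n)"
proof -
  have "cauchy_class A N (\<lambda>n. x' n \<otimes> y' n) = cauchy_class A N (\<lambda>n. x n \<otimes> y n)"
    if "x' \<in> cauchy_class A N x" "y' \<in> cauchy_class A N y" for x' y'
  proof -
    have *: "x' \<in> cauchy_seqs A N" "y' \<in> cauchy_seqs A N"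
        "(\<lambda>n. N (x' n \<ominus> x n)) \<longlonglongrightarrow> 0" "(\<lambda>n. N (y' n \<ominus> y n)) \<longlonglongrightarrow> 0"
      using that x y by (auto simp: mem_cauchy_class_iff)
    \<comment> \<open>The error estimate multiplies each null difference by the norm of another
      sequence, so these norms must converge too.\<close>
    obtain a b where "(\<lambda>n. N (y' n)) \<longlonglongrightarrow> a" "(\<lambda>n. N (x n)) \<longlonglongrightarrow> b"
      using convergent_norm_cauchy[OF *(2)] convergent_norm_cauchy[OF x] by (auto simp: convergent_def)
    then have "(\<lambda>n. N (x' n \<ominus> x n) * N (y' n) + N (x n) * N (y' n \<ominus> y n)) \<longlonglongrightarrow> 0 * a + b * 0"
      using * by (intro tendsto_intros)
    then have "(\<lambda>n. N (x' n \<otimes> y' n \<ominus> x n \<otimes> y n)) \<longlonglongrightarrow> 0"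
      using x y * by (intro LIMSEQ_null_comparison[of "\<lambda>n. N (x' n \<otimes> y' n \<ominus> x n \<otimes> y n)"])
        (auto simp: norm_mult_diff_le cauchy_seqs_carrier)
    then show ?thesis
      using x y * by (simp add: cauchy_class_eq_iff cauchy_seqs_mult)
  qed
  then show ?thesis
    using cauchy_class_nonempty[OF x] cauchy_class_nonempty[OF y] by (simp add: cstar_completion_def)
qed

lemma completion_cscale:
  assumes x: "x \<in> cauchy_seqs A N"
  shows "cscale (cstar_completion A N) c (cauchy_class A N x) = cauchy_class A N (\<lambda>n. cscale A c (x n))"
proof -
  have "cauchy_class A N (\<lambda>n. cscale A c (x' n)) = cauchy_class A N (\<lambda>n. cscale A c (x n))"
    if "x' \<in> cauchy_class A N x" for x'
    using that x tendsto_mult_right_zero[of "\<lambda>n. N (x' n \<ominus> x n)" sequentially "cmod c"]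
    by (simp add: mem_cauchy_class_iff cauchy_class_eq_iff cauchy_seqs_cscale norm_cscale_diff
        cauchy_seqs_carrier)
  then show ?thesis
    using cauchy_class_nonempty[OF x] by (simp add: cstar_completion_def)
qed

lemma completion_cadj:
  assumes x: "x \<in> cauchy_seqs A N"
  shows "cadj (cstar_completion A N) (cauchy_class A N x) = cauchy_class A N (\<lambda>n. cadj A (x n))"
proof -
  have "cauchy_class A N (\<lambda>n. cadj A (x' n)) = cauchy_class A N (\<lambda>n. cadj A (x n))"
    if "x' \<in> cauchy_class A N x" for x'
    using that x
    by (simp add: mem_cauchy_class_iff cauchy_class_eq_iff cauchy_seqs_cadj norm_cadj_diff
        cauchy_seqs_carrier)
  then show ?thesis
    using cauchy_class_nonempty[OF x] by (simp add: cstar_completion_def)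
qed

text \<open>Representatives differ by a null sequence, so their norms share one limit; this gives
  the \<open>THE\<close> in the definition its value.\<close>

lemma completion_norm:
  assumes x: "x \<in> cauchy_seqs A N"
  shows "(\<lambda>n. N (x n)) \<longlonglongrightarrow> cnorm (cstar_completion A N) (cauchy_class A N x)"
proof -
  obtain r where r: "(\<lambda>n. N (x n)) \<longlonglongrightarrow> r"
    using convergent_norm_cauchy[OF x] by (auto simp: convergent_def)
  have "r' = r" if "y \<in> cauchy_class A N x" "(\<lambda>n. N (y n)) \<longlonglongrightarrow> r'" for y r'
  proof -
    have y: "y \<in> cauchy_seqs A N" "(\<lambda>n. N (y n \<ominus> x n)) \<longlonglongrightarrow> 0"
      using that x by (auto simp: mem_cauchy_class_iff)
    have "(\<lambda>n. N (y n) - N (x n)) \<longlonglongrightarrow> 0"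
      using x y by (intro LIMSEQ_null_comparison[OF _ y(2)])
        (auto simp: abs_norm_diff_le cauchy_seqs_carrier)
    then have "(\<lambda>n. N (y n) - N (x n) + N (x n)) \<longlonglongrightarrow> 0 + r"
      using r by (intro tendsto_add)
    then show ?thesis
      using that LIMSEQ_unique by force
  qed
  then have "(THE r. \<exists>y\<in>cauchy_class A N x. (\<lambda>n. N (y n)) \<longlonglongrightarrow> r) = r"
    using r cauchy_class_self[OF x] by (intro the_equality) blast+
  then have "cnorm (cstar_completion A N) (cauchy_class A N x) = r"
    by (simp add: cstar_completion_def)
  then show ?thesis
    using r by simp
qed

section \<open>The completion as a C*-algebra\<close>

lemma completion_closedE:
  assumes "U \<in> carrier (cstar_completion A N)"
  obtains x where "x \<in> cauchy_seqs A N" "U = cauchy_class A N x"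
  using assms by (auto simp: carrier_completion)

lemma cauchy_class_closed:
  "x \<in> cauchy_seqs A N \<Longrightarrow> cauchy_class A N x \<in> carrier (cstar_completion A N)"
  by (simp add: carrier_completion)

lemmas completion_simps = completion_zero completion_one completion_add completion_mult
  completion_cscale completion_cadj cauchy_seqs_add cauchy_seqs_mult cauchy_seqs_cscale
  cauchy_seqs_cadj cauchy_seqs_const cauchy_seqs_carrier cauchy_class_closed

lemma ring_completion: "ring (cstar_completion A N)"
proof (rule ringI)
  show "abelian_group (cstar_completion A N)"
  proof (rule abelian_groupI)
    fix U assume "U \<in> carrier (cstar_completion A N)"
    then obtain x where x: "x \<in> cauchy_seqs A N" "U = cauchy_class A N x"
      by (rule completion_closedE)
    then have "(\<lambda>n. \<ominus> x n) \<in> cauchy_seqs A N"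
      using cauchy_seqs_cscale[of x "- 1"] by (simp add: a_inv_eq_cscale cauchy_seqs_carrier)
    with x show "\<exists>V\<in>carrier (cstar_completion A N).
        V \<oplus>\<^bsub>cstar_completion A N\<^esub> U = \<zero>\<^bsub>cstar_completion A N\<^esub>"
      by (intro bexI[of _ "cauchy_class A N (\<lambda>n. \<ominus> x n)"]) (simp_all add: completion_simps l_neg)
  qed (auto elim!: completion_closedE simp: completion_simps a_ac)
  show "Group.monoid (cstar_completion A N)"
    by (rule Group.monoid.intro) (auto elim!: completion_closedE simp: completion_simps m_assoc)
qed (auto elim!: completion_closedE simp: completion_simps l_distr r_distr)

lemma unital_star_algebra_completion: "unital_star_algebra (cstar_completion A N)"
proof (rule unital_star_algebra.intro[OF ring_completion])
  show "unital_star_algebra_axioms (cstar_completion A N)"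
    by (rule unital_star_algebra_axioms.intro)
      (auto elim!: completion_closedE simp: completion_simps cscale_add_right cscale_add_left
        cscale_cscale cscale_one cscale_mult_left cscale_mult_right cadj_cadj cadj_add cadj_cscale
        cadj_mult)
qed

lemma cauchy_seqs_minus:
  assumes "x \<in> cauchy_seqs A N" "y \<in> cauchy_seqs A N"
  shows "(\<lambda>n. x n \<ominus> y n) \<in> cauchy_seqs A N"
  using cauchy_seqs_add[OF assms(1) cauchy_seqs_cscale[OF assms(2), of "- 1"]] assms
  by (simp add: minus_eq_cscale cauchy_seqs_carrier)

lemma completion_minus:
  assumes "x \<in> cauchy_seqs A N" "y \<in> cauchy_seqs A N"
  shows "cauchy_class A N x \<ominus>\<^bsub>cstar_completion A N\<^esub> cauchy_class A N y =
    cauchy_class A N (\<lambda>n. x n \<ominus> y n)"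
  using assms by (simp add: unital_star_algebra.minus_eq_cscale[OF unital_star_algebra_completion]
      completion_simps minus_eq_cscale)

text \<open>Each inequality and identity for \<open>N\<close> passes to the limit along
  representatives.\<close>

lemma cstar_seminorm_completion:
  "cstar_seminorm (cstar_completion A N) (cnorm (cstar_completion A N))"
proof -
  let ?T = "cstar_completion A N"
  have "0 \<le> cnorm ?T (cauchy_class A N x)" if "x \<in> cauchy_seqs A N" for x
    using that by (intro LIMSEQ_le_const[OF completion_norm]) (auto simp: cauchy_seqs_carrier)
  moreover have "cnorm ?T (cauchy_class A N (\<lambda>n. x n \<oplus> y n)) \<le>
      cnorm ?T (cauchy_class A N x) + cnorm ?T (cauchy_class A N y)"
    if "x \<in> cauchy_seqs A N" "y \<in> cauchy_seqs A N" for x y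
    using that by (intro LIMSEQ_le[OF completion_norm tendsto_add[OF completion_norm completion_norm]])
      (auto simp: cauchy_seqs_carrier cauchy_seqs_add norm_triangle)
  moreover have "cnorm ?T (cauchy_class A N (\<lambda>n. x n \<otimes> y n)) \<le>
      cnorm ?T (cauchy_class A N x) * cnorm ?T (cauchy_class A N y)"
    if "x \<in> cauchy_seqs A N" "y \<in> cauchy_seqs A N" for x y
    using that by (intro LIMSEQ_le[OF completion_norm tendsto_mult[OF completion_norm completion_norm]])
      (auto simp: cauchy_seqs_carrier cauchy_seqs_mult norm_mult)
  moreover have "cnorm ?T (cauchy_class A N (\<lambda>n. cscale A c (x n))) =
      cmod c * cnorm ?T (cauchy_class A N x)"
    if "x \<in> cauchy_seqs A N" for x c
    using LIMSEQ_unique[OF completion_norm[OF cauchy_seqs_cscale[OF that, of c]],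
        of "cmod c * cnorm ?T (cauchy_class A N x)"] tendsto_mult_left[OF completion_norm[OF that]] that
    by (simp add: norm_cscale cauchy_seqs_carrier)
  moreover have "cnorm ?T (cauchy_class A N (\<lambda>n. cadj A (x n) \<otimes> x n)) =
      (cnorm ?T (cauchy_class A N x))\<^sup>2"
    if "x \<in> cauchy_seqs A N" for x
    using LIMSEQ_unique[OF completion_norm[OF cauchy_seqs_mult[OF cauchy_seqs_cadj[OF that] that]],
        of "(cnorm ?T (cauchy_class A N x))\<^sup>2"] tendsto_power[OF completion_norm[OF that], of 2] that
    by (simp add: norm_cstar cauchy_seqs_carrier)
  ultimately show ?thesis
    unfolding cstar_seminorm_def by (auto simp: carrier_completion completion_simps)
qed

lemma completion_norm_const:
  assumes "a \<in> carrier A"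
  shows "cnorm (cstar_completion A N) (cauchy_class A N (\<lambda>n. a)) = N a"
  using LIMSEQ_unique[OF completion_norm[OF cauchy_seqs_const[OF assms]] tendsto_const] .

text \<open>A late term of a representing sequence is the approximant. The strict Cauchy bound
  survives in the limit only as \<open>\<le>\<close>.\<close>

lemma completion_dense:
  assumes "U \<in> carrier (cstar_completion A N)" "0 < \<epsilon>"
  shows "\<exists>a\<in>carrier A. cnorm (cstar_completion A N)
    (U \<ominus>\<^bsub>cstar_completion A N\<^esub> cauchy_class A N (\<lambda>n. a)) \<le> \<epsilon>"
proof -
  obtain x where x: "x \<in> cauchy_seqs A N" "U = cauchy_class A N x"
    using assms by (blast elim: completion_closedE)
  obtain M where M: "\<forall>m\<ge>M. \<forall>n\<ge>M. N (x m \<ominus> x n) < \<epsilon>"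
    using cauchy_seqsD[OF x(1) assms(2)] by blast
  have c: "(\<lambda>n. x M) \<in> cauchy_seqs A N"
    using x by (simp add: cauchy_seqs_const cauchy_seqs_carrier)
  have "cnorm (cstar_completion A N) (cauchy_class A N (\<lambda>n. x n \<ominus> x M)) \<le> \<epsilon>"
    using M by (intro LIMSEQ_le_const2[OF completion_norm[OF cauchy_seqs_minus[OF x(1) c]]])
      (auto intro!: exI[of _ M] less_imp_le)
  then show ?thesis
    using x c by (auto simp: completion_minus cauchy_seqs_carrier intro!: bexI[of _ "x M"])
qed

text \<open>For completeness, each \<open>s n\<close> is replaced by a constant class within
  \<open>1 / (n + 1)\<close>. The elements so chosen form a Cauchy sequence in \<open>A\<close>, and
  its class is the limit of \<open>s\<close>.\<close>

theorem unital_cstar_algebra_completion: "unital_cstar_algebra (cstar_completion A N)"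
proof -
  let ?T = "cstar_completion A N" and ?k = "\<lambda>a. cauchy_class A N (\<lambda>n. a)"
  interpret T: star_algebra_seminorm ?T "cnorm ?T"
    by (intro star_algebra_seminorm.intro star_algebra_seminorm_axioms.intro
        unital_star_algebra_completion cstar_seminorm_completion)
  have k: "?k a \<in> carrier ?T" if "a \<in> carrier A" for a
    using that by (simp add: completion_simps)
  show ?thesis
  proof (intro unital_cstar_algebra.intro unital_cstar_algebra_axioms.intro
      unital_star_algebra_completion cstar_seminorm_completion)
    fix U assume "U \<in> carrier ?T" "cnorm ?T U = 0"
    then obtain x where x: "x \<in> cauchy_seqs A N" "U = cauchy_class A N x" "(\<lambda>n. N (x n)) \<longlonglongrightarrow> 0"
      using completion_norm by (metis completion_closedE)
    have "(\<lambda>n. x n \<ominus> \<zero>) = x"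
      using x by (auto simp: a_minus_def cauchy_seqs_carrier)
    with x show "U = \<zero>\<^bsub>?T\<^esub>"
      by (simp add: completion_zero cauchy_class_eq_iff cauchy_seqs_const fun_eq_iff)
  next
    fix s assume s: "s \<in> cauchy_seqs ?T (cnorm ?T)"
    note sT [simp] = T.cauchy_seqs_carrier[OF s]
    have "\<forall>n. \<exists>a\<in>carrier A. cnorm ?T (s n \<ominus>\<^bsub>?T\<^esub> ?k a) \<le> inverse (real (Suc n))"
      using completion_dense[OF sT] by simp
    then obtain a where a [simp]: "\<And>n. a n \<in> carrier A"
      and sa: "\<And>n. cnorm ?T (s n \<ominus>\<^bsub>?T\<^esub> ?k (a n)) \<le> inverse (real (Suc n))"
      by metis
    have small: "\<exists>M. \<forall>n\<ge>M. cnorm ?T (s n \<ominus>\<^bsub>?T\<^esub> ?k (a n)) < \<epsilon>" if "0 < \<epsilon>" for \<epsilon>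
    proof -
      obtain M where M: "inverse (real (Suc M)) < \<epsilon>"
        using reals_Archimedean[OF \<open>0 < \<epsilon>\<close>] by blast
      have "cnorm ?T (s n \<ominus>\<^bsub>?T\<^esub> ?k (a n)) < \<epsilon>" if "M \<le> n" for n
      proof -
        have "inverse (real (Suc n)) \<le> inverse (real (Suc M))"
          using that by simp
        with sa[of n] M show ?thesis by linarith
      qed
      then show ?thesis by blast
    qed
    have dist: "N (a m \<ominus> a n) = cnorm ?T (?k (a m) \<ominus>\<^bsub>?T\<^esub> ?k (a n))" for m n
      by (simp add: completion_minus cauchy_seqs_const completion_norm_const)
    have ac: "a \<in> cauchy_seqs A N"
    proof (rule cauchy_seqsI)
      fix \<epsilon> :: real assume "0 < \<epsilon>"
      then have "0 < \<epsilon> / 3" by simp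
      then obtain M1 M2 where M: "\<forall>n\<ge>M1. cnorm ?T (s n \<ominus>\<^bsub>?T\<^esub> ?k (a n)) < \<epsilon> / 3"
        "\<forall>m\<ge>M2. \<forall>n\<ge>M2. cnorm ?T (s m \<ominus>\<^bsub>?T\<^esub> s n) < \<epsilon> / 3"
        using small T.cauchy_seqsD[OF s] by meson
      have "N (a m \<ominus> a n) < \<epsilon>" if "max M1 M2 \<le> m" "max M1 M2 \<le> n" for m n
      proof -
        have "cnorm ?T (?k (a m) \<ominus>\<^bsub>?T\<^esub> ?k (a n)) \<le>
            cnorm ?T (s m \<ominus>\<^bsub>?T\<^esub> ?k (a m)) + cnorm ?T (s m \<ominus>\<^bsub>?T\<^esub> ?k (a n))"
          using T.norm_minus_triangle[of "?k (a m)" "s m" "?k (a n)"]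
            T.norm_minus_commute[of "?k (a m)" "s m"] k by simp
        also have "\<dots> \<le> cnorm ?T (s m \<ominus>\<^bsub>?T\<^esub> ?k (a m)) +
            (cnorm ?T (s m \<ominus>\<^bsub>?T\<^esub> s n) + cnorm ?T (s n \<ominus>\<^bsub>?T\<^esub> ?k (a n)))"
          using T.norm_minus_triangle[of "s m" "s n" "?k (a n)"] k by simp
        also have "\<dots> < \<epsilon> / 3 + (\<epsilon> / 3 + \<epsilon> / 3)"
          using M that by (intro add_strict_mono) auto
        finally show ?thesis
          by (simp add: dist)
      qed
      then show "\<exists>M. \<forall>m\<ge>M. \<forall>n\<ge>M. N (a m \<ominus> a n) < \<epsilon>" by blast
    qed simp
    define l where "l = cauchy_class A N a"
    have l [simp]: "l \<in> carrier ?T"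
      using ac by (simp add: l_def completion_simps)
    have "(\<lambda>n. cnorm ?T (s n \<ominus>\<^bsub>?T\<^esub> l)) \<longlonglongrightarrow> 0"
    proof (rule LIMSEQ_I)
      fix \<epsilon> :: real assume "0 < \<epsilon>"
      then have "0 < \<epsilon> / 2" by simp
      then obtain M1 M2 where M: "\<forall>n\<ge>M1. cnorm ?T (s n \<ominus>\<^bsub>?T\<^esub> ?k (a n)) < \<epsilon> / 2"
        "\<forall>m\<ge>M2. \<forall>n\<ge>M2. N (a m \<ominus> a n) < \<epsilon> / 2"
        using small cauchy_seqsD[OF ac] by meson
      have "cnorm ?T (s n \<ominus>\<^bsub>?T\<^esub> l) < \<epsilon>" if "max M1 M2 \<le> n" for n
      proof -
        have "cnorm ?T (cauchy_class A N (\<lambda>m. a n \<ominus> a m)) \<le> \<epsilon> / 2"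
          using M that ac by (intro LIMSEQ_le_const2[OF completion_norm])
            (auto simp: cauchy_seqs_minus cauchy_seqs_const intro!: exI[of _ M2] less_imp_le)
        then have "cnorm ?T (?k (a n) \<ominus>\<^bsub>?T\<^esub> l) \<le> \<epsilon> / 2"
          using ac by (simp add: l_def completion_minus cauchy_seqs_const)
        moreover have "cnorm ?T (s n \<ominus>\<^bsub>?T\<^esub> ?k (a n)) < \<epsilon> / 2"
          using M that by simp
        ultimately show ?thesis
          using T.norm_minus_triangle[of "s n" "?k (a n)" l] k by simp
      qed
      then show "\<exists>M. \<forall>n\<ge>M. norm (cnorm ?T (s n \<ominus>\<^bsub>?T\<^esub> l) - 0) < \<epsilon>"
        by (intro exI[of _ "max M1 M2"]) simp
    qed
    then show "\<exists>l\<in>carrier ?T. (\<lambda>n. cnorm ?T (s n \<ominus>\<^bsub>?T\<^esub> l)) \<longlonglongrightarrow> 0"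
      using l by blast
  qed
qed

end



section \<open>Inverses near the unit\<close>

lemma (in unital_star_algebra) minus_eq_zero_iff:
  "x \<in> carrier A \<Longrightarrow> y \<in> carrier A \<Longrightarrow> x \<ominus> y = \<zero> \<longleftrightarrow> x = y"
  by (metis a_inv_closed a_minus_def minus_equality minus_minus minus_self)

text \<open>The Neumann series \<open>1 + u + u\<^sup>2 + \<dots>\<close>, as the limit of the iterates of \<open>z \<mapsto> 1 + uz\<close>.\<close>

lemma (in unital_cstar_algebra) neumann_series:
  assumes u: "u \<in> carrier A" and norm_u: "cnorm A u < 1"
  obtains v where "v \<in> carrier A" "(\<one> \<ominus> u) \<otimes> v = \<one>"
proof -
  define r where "r = cnorm A u"
  have r: "0 \<le> r" "r < 1"
    using u norm_u by (auto simp: r_def)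
  define s where "s = rec_nat \<zero> (\<lambda>n z. \<one> \<oplus> u \<otimes> z)"
  have s_rec: "s 0 = \<zero>" "s (Suc n) = \<one> \<oplus> u \<otimes> s n" for n
    by (auto simp: s_def)
  have s [simp]: "s n \<in> carrier A" for n
    by (induction n) (auto simp: s_rec u)
  \<comment> \<open>\<open>1 / (1 - r)\<close> is the fixed point of
    \<open>z \<mapsto> 1 + r z\<close>, so the recursion preserves the bound.\<close>
  have s_le: "cnorm A (s n) \<le> 1 / (1 - r)" for n
  proof (induction n)
    case (Suc n)
    have "cnorm A (s (Suc n)) \<le> cnorm A \<one> + cnorm A (u \<otimes> s n)"
      using u by (simp add: s_rec norm_triangle)
    also have "\<dots> \<le> 1 + r * (1 / (1 - r))"
      using norm_mult[OF u s[of n]] norm_one_le mult_left_mono[OF Suc r(1)] by (simp add: r_def)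
    also have "\<dots> = 1 / (1 - r)"
      using r by (simp add: field_simps)
    finally show ?case .
  qed (use r in \<open>simp add: s_rec\<close>)
  have step: "s (Suc m) \<ominus> s (Suc n) = u \<otimes> (s m \<ominus> s n)" for m n
  proof -
    have "\<one> \<oplus> a \<ominus> (\<one> \<oplus> b) = a \<ominus> b" if "a \<in> carrier A" "b \<in> carrier A" for a b
    proof -
      have "\<one> \<oplus> a \<ominus> (\<one> \<oplus> b) = (\<one> \<oplus> \<ominus> \<one>) \<oplus> (a \<oplus> \<ominus> b)"
        using that by (simp only: a_minus_def minus_add a_ac a_inv_closed one_closed add.m_closed)
      then show ?thesis
        using that by (simp add: r_neg a_minus_def)
    qed
    then show ?thesis
      using u by (simp add: s_rec minus_mult_right)
  qed
  \<comment> \<open>Lowering both indices by one extracts a factor \<open>u\<close>; after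
    \<open>n\<close> times only \<open>s k\<close> remains.\<close>
  have diff: "cnorm A (s (n + k) \<ominus> s n) \<le> r ^ n * (1 / (1 - r))" for n k
  proof (induction n)
    case 0
    then show ?case
      using s_le[of k] by (simp add: s_rec a_minus_def)
  next
    case (Suc n)
    have "cnorm A (s (Suc n + k) \<ominus> s (Suc n)) \<le> r * cnorm A (s (n + k) \<ominus> s n)"
      using step[of "n + k" n] norm_mult[OF u, of "s (n + k) \<ominus> s n"] by (simp add: r_def)
    also have "\<dots> \<le> r * (r ^ n * (1 / (1 - r)))"
      using Suc r by (intro mult_left_mono)
    finally show ?case by simp
  qed
  have "(\<lambda>n. r ^ n * (1 / (1 - r))) \<longlonglongrightarrow> 0 * (1 / (1 - r))"
    using r by (intro tendsto_intros LIMSEQ_realpow_zero)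
  then have lim0: "(\<lambda>n. r ^ n * (1 / (1 - r))) \<longlonglongrightarrow> 0"
    by simp
  have "s \<in> cauchy_seqs A (cnorm A)"
  proof (rule cauchy_seqsI)
    fix \<epsilon> :: real assume "0 < \<epsilon>"
    then obtain M where M: "\<forall>n\<ge>M. r ^ n * (1 / (1 - r)) < \<epsilon>"
      using order_tendstoD(2)[OF lim0] by (meson eventually_sequentially)
    have le: "cnorm A (s m \<ominus> s n) < \<epsilon>" if "M \<le> n" "n \<le> m" for m n
      using diff[of n "m - n"] M that by (force intro: order_le_less_trans)
    have "cnorm A (s m \<ominus> s n) < \<epsilon>" if "M \<le> n" "M \<le> m" for m n
      using le[of n m] le[of m n] that norm_minus_commute[of "s m" "s n"] by (cases "n \<le> m") auto
    then show "\<exists>M. \<forall>m\<ge>M. \<forall>n\<ge>M. cnorm A (s m \<ominus> s n) < \<epsilon>" by blast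
  qed simp
  then obtain v where v: "v \<in> carrier A" "(\<lambda>n. cnorm A (s n \<ominus> v)) \<longlonglongrightarrow> 0"
    using cnorm_complete by blast
  have v': "(\<lambda>n. cnorm A (s (Suc n) \<ominus> v)) \<longlonglongrightarrow> 0"
    using v(2) by (rule LIMSEQ_Suc)
  \<comment> \<open>The left side is the defect of \<open>v\<close> in the equation
    \<open>v = 1 + u v\<close>. It does not depend on \<open>n\<close>, while the right side tends
    to zero.\<close>
  have "cnorm A ((\<one> \<oplus> u \<otimes> v) \<ominus> v) \<le> r * cnorm A (s n \<ominus> v) + cnorm A (s (Suc n) \<ominus> v)" for n
  proof -
    have "cnorm A ((\<one> \<oplus> u \<otimes> v) \<ominus> v) \<le>
        cnorm A ((\<one> \<oplus> u \<otimes> v) \<ominus> s (Suc n)) + cnorm A (s (Suc n) \<ominus> v)"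
      using u v by (intro norm_minus_triangle) auto
    also have "cnorm A ((\<one> \<oplus> u \<otimes> v) \<ominus> s (Suc n)) \<le>
        cnorm A (\<one> \<ominus> \<one>) + cnorm A (u \<otimes> v \<ominus> u \<otimes> s n)"
      unfolding s_rec using u v by (intro norm_add_diff_le) auto
    also have "\<dots> = cnorm A (u \<otimes> (v \<ominus> s n))"
      using u v by (simp add: minus_mult_right)
    also have "\<dots> \<le> r * cnorm A (v \<ominus> s n)"
      using u v norm_mult by (simp add: r_def)
    finally show ?thesis
      using v norm_minus_commute by simp
  qed
  then have "cnorm A ((\<one> \<oplus> u \<otimes> v) \<ominus> v) \<le> r * 0 + 0"
    by (intro LIMSEQ_le_const[OF tendsto_add[OF tendsto_mult_left[OF v(2)] v']]) auto
  then have "(\<one> \<oplus> u \<otimes> v) \<ominus> v = \<zero>"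
    using u v by (intro cnorm_eq_zero order_antisym norm_nonneg) auto
  moreover have "(\<one> \<oplus> u \<otimes> v) \<ominus> v = \<one> \<ominus> (v \<ominus> u \<otimes> v)"
    using u v by (simp add: a_minus_def minus_add a_ac)
  ultimately have "\<one> \<ominus> (\<one> \<ominus> u) \<otimes> v = \<zero>"
    using u v by (simp add: minus_mult_left)
  then have "(\<one> \<ominus> u) \<otimes> v = \<one>"
    using u v by (simp add: minus_eq_zero_iff)
  with v show thesis
    using that by blast
qed


section \<open>The free star algebra\<close>

definition word_basis :: "'x letter list \<Rightarrow> 'x letter list \<Rightarrow> complex" where
  "word_basis w = (\<lambda>v. if v = w then 1 else 0)"

definition star_word :: "'x letter list \<Rightarrow> 'x letter list" where
  "star_word w = rev (map flip_letter w)"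

definition letters :: "'x set \<Rightarrow> 'x letter set" where
  "letters X = Gen ` X \<union> Adj ` X"

lemma flip_flip [simp]: "flip_letter (flip_letter l) = l"
  by (cases l) auto

lemma flip_in_letters [simp]: "flip_letter l \<in> letters X \<longleftrightarrow> l \<in> letters X"
  by (cases l) (auto simp: letters_def)

lemma star_word_star_word [simp]: "star_word (star_word w) = w"
  by (simp add: star_word_def rev_map[symmetric] comp_def)

lemma length_star_word [simp]: "length (star_word w) = length w"
  by (simp add: star_word_def)

lemma set_star_word_subset [simp]: "set (star_word w) \<subseteq> letters X \<longleftrightarrow> set w \<subseteq> letters X"
  by (auto simp: star_word_def subset_iff)

lemma carrier_free_iff:
  "f \<in> carrier (free_star_algebra X) \<longleftrightarrow>
    finite {w. f w \<noteq> 0} \<and> (\<forall>w. f w \<noteq> 0 \<longrightarrow> set w \<subseteq> letters X)"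
  by (simp add: free_star_algebra_def letters_def)

lemma free_mult: "(f \<otimes>\<^bsub>free_star_algebra X\<^esub> g) = (\<lambda>w. \<Sum>k\<le>length w. f (take k w) * g (drop k w))"
  and free_one: "\<one>\<^bsub>free_star_algebra X\<^esub> = word_basis []"
  and free_zero: "\<zero>\<^bsub>free_star_algebra X\<^esub> = (\<lambda>w. 0)"
  and free_add: "f \<oplus>\<^bsub>free_star_algebra X\<^esub> g = (\<lambda>w. f w + g w)"
  and free_cscale: "cscale (free_star_algebra X) c f = (\<lambda>w. c * f w)"
  and free_cadj: "cadj (free_star_algebra X) f = (\<lambda>w. cnj (f (star_word w)))"
  by (simp_all add: free_star_algebra_def word_basis_def star_word_def)

lemma word_basis_closed: "set w \<subseteq> letters X \<Longrightarrow> word_basis w \<in> carrier (free_star_algebra X)"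
  by (auto simp: carrier_free_iff word_basis_def)

lemma free_zero_closed: "(\<lambda>w. 0) \<in> carrier (free_star_algebra X)"
  by (simp add: carrier_free_iff)

lemma free_add_closed:
  assumes "f \<in> carrier (free_star_algebra X)" "g \<in> carrier (free_star_algebra X)"
  shows "(\<lambda>w. f w + g w) \<in> carrier (free_star_algebra X)"
proof -
  have "finite {w. f w + g w \<noteq> 0}"
    by (rule finite_subset[of _ "{w. f w \<noteq> 0} \<union> {w. g w \<noteq> 0}"])
      (use assms in \<open>auto simp: carrier_free_iff\<close>)
  moreover have "f w \<noteq> 0 \<or> g w \<noteq> 0" if "f w + g w \<noteq> 0" for w
    using that by auto
  ultimately show ?thesis
    using assms by (fastforce simp: carrier_free_iff)
qed

lemma free_cscale_closed:
  assumes "f \<in> carrier (free_star_algebra X)"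
  shows "(\<lambda>w. c * f w) \<in> carrier (free_star_algebra X)"
proof -
  have "finite {w. c * f w \<noteq> 0}"
    by (rule finite_subset[of _ "{w. f w \<noteq> 0}"]) (use assms in \<open>auto simp: carrier_free_iff\<close>)
  then show ?thesis
    using assms by (auto simp: carrier_free_iff)
qed

lemma free_mult_nonzeroE:
  fixes f g :: "'x letter list \<Rightarrow> complex"
  assumes "(\<Sum>k\<le>length w. f (take k w) * g (drop k w)) \<noteq> 0"
  obtains u v where "w = u @ v" "f u \<noteq> 0" "g v \<noteq> 0"
proof -
  obtain k where "f (take k w) * g (drop k w) \<noteq> 0"
    using assms by (meson sum.not_neutral_contains_not_neutral)
  then show thesis
    using that[of "take k w" "drop k w"] by auto
qed

lemma free_mult_closed:
  assumes "f \<in> carrier (free_star_algebra X)" "g \<in> carrier (free_star_algebra X)"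
  shows "(\<lambda>w. \<Sum>k\<le>length w. f (take k w) * g (drop k w)) \<in> carrier (free_star_algebra X)"
proof -
  have "finite {w. (\<Sum>k\<le>length w. f (take k w) * g (drop k w)) \<noteq> 0}"
  proof (rule finite_subset)
    show "finite ((\<lambda>(u, v). u @ v) ` ({u. f u \<noteq> 0} \<times> {v. g v \<noteq> 0}))"
      using assms by (auto simp: carrier_free_iff)
    show "{w. (\<Sum>k\<le>length w. f (take k w) * g (drop k w)) \<noteq> 0} \<subseteq>
        (\<lambda>(u, v). u @ v) ` ({u. f u \<noteq> 0} \<times> {v. g v \<noteq> 0})"
      by (auto elim!: free_mult_nonzeroE)
  qed
  moreover have "set w \<subseteq> letters X" if "(\<Sum>k\<le>length w. f (take k w) * g (drop k w)) \<noteq> 0" for w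
    using that assms by (elim free_mult_nonzeroE) (auto simp: carrier_free_iff)
  ultimately show ?thesis
    by (auto simp: carrier_free_iff)
qed

lemma free_cadj_closed:
  assumes "f \<in> carrier (free_star_algebra X)"
  shows "(\<lambda>w. cnj (f (star_word w))) \<in> carrier (free_star_algebra X)"
proof -
  have "{w. cnj (f (star_word w)) \<noteq> 0} = star_word ` {w. f w \<noteq> 0}"
    by (auto simp: image_iff intro!: exI[of _ "star_word _"])
  then show ?thesis
    using assms by (auto simp: carrier_free_iff)
      (metis set_star_word_subset subsetD star_word_star_word)
qed

text \<open>Both sides sum over the ways of cutting \<open>w\<close> into three pieces. The cuts
  \<open>j \<le> k\<close> on the left become, on the right, the cut \<open>j\<close> and a second
  one at distance \<open>k - j\<close> from it.\<close>

lemma free_mult_assoc: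
  fixes f g h :: "'x letter list \<Rightarrow> complex"
  shows "(\<Sum>k\<le>length w. (\<Sum>j\<le>length (take k w). f (take j (take k w)) * g (drop j (take k w))) * h (drop k w)) =
    (\<Sum>j\<le>length w. f (take j w) * (\<Sum>i\<le>length (drop j w). g (take i (drop j w)) * h (drop i (drop j w))))"
    (is "?l = ?r")
proof -
  let ?n = "length w"
  have "?l = (\<Sum>(k, j)\<in>(SIGMA k:{..?n}. {..k}). f (take j w) * g (drop j (take k w)) * h (drop k w))"
    by (subst sum.Sigma[symmetric])
      (auto simp: sum_distrib_right min_def intro!: sum.cong)
  also have "\<dots> = (\<Sum>(j, i)\<in>(SIGMA j:{..?n}. {..?n - j}).
      f (take j w) * (g (take i (drop j w)) * h (drop i (drop j w))))"
    by (rule sum.reindex_bij_witness[of _ "\<lambda>(j, i). (i + j, j)" "\<lambda>(k, j). (j, k - j)"])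
      (auto simp: drop_take mult.assoc)
  also have "\<dots> = ?r"
    by (subst sum.Sigma[symmetric]) (auto simp: sum_distrib_left intro!: sum.cong)
  finally show ?thesis .
qed

lemma free_one_mult:
  fixes f :: "'x letter list \<Rightarrow> complex"
  shows "(\<Sum>k\<le>length w. word_basis [] (take k w) * f (drop k w)) = f w"
    and "(\<Sum>k\<le>length w. f (take k w) * word_basis [] (drop k w)) = f w"
proof -
  have "(\<Sum>k\<le>length w. word_basis [] (take k w) * f (drop k w)) =
      (\<Sum>k\<le>length w. if k = 0 then f w else 0)"
    by (rule sum.cong) (auto simp: word_basis_def)
  then show "(\<Sum>k\<le>length w. word_basis [] (take k w) * f (drop k w)) = f w" by simp
  have "(\<Sum>k\<le>length w. f (take k w) * word_basis [] (drop k w)) =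
      (\<Sum>k\<le>length w. if k = length w then f w else 0)"
    by (rule sum.cong) (auto simp: word_basis_def)
  then show "(\<Sum>k\<le>length w. f (take k w) * word_basis [] (drop k w)) = f w" by simp
qed

text \<open>Reversal turns the cut after \<open>k\<close> letters into the cut after
  \<open>length w - k\<close> letters.\<close>

lemma free_cadj_mult:
  fixes f g :: "'x letter list \<Rightarrow> complex"
  shows "cnj (\<Sum>k\<le>length (star_word w). f (take k (star_word w)) * g (drop k (star_word w))) =
    (\<Sum>k\<le>length w. cnj (g (star_word (take k w))) * cnj (f (star_word (drop k w))))"
  unfolding cnj_sum
  by (rule sum.reindex_bij_witness[of _ "\<lambda>k. length w - k" "\<lambda>k. length w - k"])
    (auto simp: star_word_def take_rev drop_rev take_map drop_map mult.commute)

lemmas free_simps = free_mult free_one free_zero free_add free_cscale free_cadj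
  free_zero_closed free_add_closed free_cscale_closed free_mult_closed free_cadj_closed
  word_basis_closed

lemma ring_free_star_algebra: "ring (free_star_algebra X)"
proof (rule ringI)
  show "abelian_group (free_star_algebra X)"
  proof (rule abelian_groupI)
    fix f assume "f \<in> carrier (free_star_algebra X)"
    then show "\<exists>g\<in>carrier (free_star_algebra X). g \<oplus>\<^bsub>free_star_algebra X\<^esub> f = \<zero>\<^bsub>free_star_algebra X\<^esub>"
      using free_cscale_closed[of f X "- 1"]
      by (intro bexI[of _ "\<lambda>w. - 1 * f w"]) (simp_all add: free_simps)
  qed (simp_all add: free_simps add_ac)
  show "Group.monoid (free_star_algebra X)"
    by (rule Group.monoid.intro) (simp_all only: free_simps free_mult_assoc free_one_mult
        empty_subsetI list.set(1))
qed (simp_all add: free_simps algebra_simps sum.distrib)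

lemma unital_star_algebra_free: "unital_star_algebra (free_star_algebra X)"
proof (rule unital_star_algebra.intro[OF ring_free_star_algebra])
  show "unital_star_algebra_axioms (free_star_algebra X)"
    by (rule unital_star_algebra_axioms.intro)
      (simp_all only: free_simps free_cadj_mult complex_cnj_add complex_cnj_mult complex_cnj_cnj
        star_word_star_word, simp_all add: algebra_simps sum_distrib_left)
qed

text \<open>Supports are finite, so an element can be stripped of one word at a time; this reduces
  statements about the free algebra to words.\<close>

lemma free_star_induct [consumes 1, case_names zero add]:
  assumes "f \<in> carrier (free_star_algebra X)"
    and "Q \<zero>\<^bsub>free_star_algebra X\<^esub>"
    and "\<And>c w f. \<lbrakk>set w \<subseteq> letters X; f \<in> carrier (free_star_algebra X); Q f\<rbrakk> \<Longrightarrow>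
      Q (cscale (free_star_algebra X) c (word_basis w) \<oplus>\<^bsub>free_star_algebra X\<^esub> f)"
  shows "Q f"
proof -
  have "finite {w. f w \<noteq> 0}"
    using assms(1) by (simp add: carrier_free_iff)
  then show ?thesis
    using assms(1)
  proof (induction "{w. f w \<noteq> 0}" arbitrary: f rule: finite_induct)
    case empty
    then have "f = \<zero>\<^bsub>free_star_algebra X\<^esub>"
      by (auto simp: free_zero)
    then show ?case
      using assms(2) by simp
  next
    case (insert w W)
    have supp: "f v \<noteq> 0 \<longleftrightarrow> v = w \<or> v \<in> W" for v
      using insert.hyps(4) by blast
    have W: "W = {v. (f(w := 0)) v \<noteq> 0}"
      using supp insert.hyps(2) by (auto simp: set_eq_iff)
    have letters: "set v \<subseteq> letters X" if "v = w \<or> v \<in> W" for v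
      using insert.prems supp[of v] that by (simp add: carrier_free_iff)
    have "f(w := 0) \<in> carrier (free_star_algebra X)"
      unfolding carrier_free_iff W[symmetric] using insert.hyps(1) letters W by blast
    moreover from this have "Q (f(w := 0))"
      by (rule insert.hyps(3)[OF W])
    moreover have "set w \<subseteq> letters X"
      using letters by blast
    moreover have "f = cscale (free_star_algebra X) (f w) (word_basis w) \<oplus>\<^bsub>free_star_algebra X\<^esub> f(w := 0)"
      by (auto simp: free_simps word_basis_def)
    ultimately show ?case
      using assms(3) by metis
  qed
qed

lemma word_basis_mult:
  "word_basis u \<otimes>\<^bsub>free_star_algebra X\<^esub> word_basis v = word_basis (u @ v)"
proof
  fix w
  \<comment> \<open>Only the cut after \<open>length u\<close> letters can contribute to the
    convolution.\<close>
  have *: "take k w = u \<and> drop k w = v \<longleftrightarrow> k = length u \<and> w = u @ v" if "k \<le> length w" for k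
    using that by (metis append_eq_conv_conj append_take_drop_id length_take min.absorb2)
  have "(\<Sum>k\<le>length w. word_basis u (take k w) * word_basis v (drop k w)) =
      (\<Sum>k\<le>length w. if take k w = u \<and> drop k w = v then 1 else 0)"
    by (intro sum.cong) (simp_all add: word_basis_def)
  also have "\<dots> = (\<Sum>k\<le>length w. if k = length u \<and> w = u @ v then 1 else 0)"
    using * by (intro sum.cong) (simp_all only: atMost_iff)
  also have "\<dots> = word_basis (u @ v) w"
    by (cases "w = u @ v") (simp_all add: word_basis_def)
  finally show "(word_basis u \<otimes>\<^bsub>free_star_algebra X\<^esub> word_basis v) w = word_basis (u @ v) w"
    by (simp add: free_mult)
qed

lemma word_basis_cadj: "cadj (free_star_algebra X) (word_basis w) = word_basis (star_word w)"
proof -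
  have "star_word v = w \<longleftrightarrow> v = star_word w" for v
    by (metis star_word_star_word)
  then show ?thesis
    by (simp add: free_cadj word_basis_def fun_eq_iff)
qed

lemma free_gen_eq: "free_gen x = word_basis [Gen x]"
  by (simp add: free_gen_def word_basis_def)


section \<open>The largest C*-seminorm vanishing on relators\<close>

text \<open>The star is isometric, so \<open>Adj\<close> letters inherit the bound on the
  generators, and submultiplicativity carries it along the word.\<close>

lemma cstar_seminorm_free_word_basis_le:
  assumes N: "cstar_seminorm (free_star_algebra X) N"
    and gen: "\<And>x. x \<in> X \<Longrightarrow> N (free_gen x) \<le> 1"
    and "set w \<subseteq> letters X"
  shows "N (word_basis w) \<le> 1"
proof -
  interpret star_algebra_seminorm "free_star_algebra X" N
    by (intro star_algebra_seminorm.intro star_algebra_seminorm_axioms.intro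
        unital_star_algebra_free N)
  have letter: "N (word_basis [l]) \<le> 1" if "l \<in> letters X" for l
  proof (cases l)
    case (Gen x)
    then show ?thesis
      using that gen by (auto simp: letters_def free_gen_eq)
  next
    case (Adj x)
    then have x: "x \<in> X"
      using that by (auto simp: letters_def)
    then have "N (cadj (free_star_algebra X) (word_basis [Gen x])) = N (free_gen x)"
      by (subst norm_cadj) (auto simp: free_gen_eq letters_def intro: word_basis_closed)
    with Adj x gen show ?thesis
      by (simp add: word_basis_cadj star_word_def)
  qed
  show ?thesis
    using assms(3)
  proof (induction w)
    case Nil
    then show ?case
      using norm_one_le by (simp add: free_one)
  next
    case (Cons l w)
    have "N (word_basis (l # w)) \<le> N (word_basis [l]) * N (word_basis w)"
      using Cons.prems norm_mult[of "word_basis [l]" "word_basis w"]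
      by (simp add: word_basis_mult word_basis_closed)
    also have "\<dots> \<le> 1 * 1"
      using Cons letter by (intro mult_mono) (auto intro!: norm_nonneg word_basis_closed)
    finally show ?case by simp
  qed
qed

text \<open>The bound in \<open>gen_le_one\<close> is uniform in \<open>N\<close>; it makes the
  supremum over all admissible seminorms finite.\<close>

locale bounded_relators =
  fixes X :: "'x set" and R :: "('x letter list \<Rightarrow> complex) set"
  assumes relators_closed: "R \<subseteq> carrier (free_star_algebra X)"
    and gen_le_one: "\<lbrakk>cstar_seminorm (free_star_algebra X) N; \<forall>r\<in>R. N r = 0; x \<in> X\<rbrakk> \<Longrightarrow>
      N (free_gen x) \<le> 1"
begin

abbreviation "F \<equiv> free_star_algebra X"

abbreviation "seminorms \<equiv> {N. cstar_seminorm F N \<and> (\<forall>r\<in>R. N r = 0)}"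

abbreviation "U \<equiv> universal_seminorm X R"

lemma star_algebra_seminorm_of_seminorms: "N \<in> seminorms \<Longrightarrow> star_algebra_seminorm F N"
  by (intro star_algebra_seminorm.intro star_algebra_seminorm_axioms.intro unital_star_algebra_free) simp

text \<open>Keeps the supremum from ranging over the empty set and bounds it below by zero.\<close>

lemma zero_seminorm: "(\<lambda>_. 0) \<in> seminorms"
  by (simp add: cstar_seminorm_def)

lemma seminorms_bounded:
  assumes "f \<in> carrier F" shows "\<exists>C. \<forall>N\<in>seminorms. N f \<le> C"
  using assms
proof (induction rule: free_star_induct)
  case zero
  have "N \<zero>\<^bsub>F\<^esub> \<le> 0" if "N \<in> seminorms" for N
    using star_algebra_seminorm.norm_zero[OF star_algebra_seminorm_of_seminorms[OF that]] by simp
  then show ?case by (intro exI ballI)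
next
  case (add c w f)
  obtain C where C: "\<forall>N\<in>seminorms. N f \<le> C"
    using add.IH by (rule exE)
  have "N (cscale F c (word_basis w) \<oplus>\<^bsub>F\<^esub> f) \<le> cmod c * 1 + C" if N: "N \<in> seminorms" for N
  proof -
    interpret star_algebra_seminorm F N
      using N by (rule star_algebra_seminorm_of_seminorms)
    have w: "word_basis w \<in> carrier F"
      using add by (simp add: word_basis_closed)
    have "N (word_basis w) \<le> 1"
    proof (rule cstar_seminorm_free_word_basis_le[OF _ _ add.hyps(1)])
      show N': "cstar_seminorm F N"
        using N by simp
      show "N (free_gen x) \<le> 1" if "x \<in> X" for x
        using gen_le_one[OF N' _ that] N by blast
    qed
    have "N (cscale F c (word_basis w) \<oplus>\<^bsub>F\<^esub> f) \<le> cmod c * N (word_basis w) + N f"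
      using norm_triangle[of "cscale F c (word_basis w)" f] w add by (simp add: norm_cscale)
    also have "\<dots> \<le> cmod c * 1 + C"
      using bspec[OF C N] \<open>N (word_basis w) \<le> 1\<close> by (intro add_mono mult_left_mono) simp_all
    finally show ?thesis .
  qed
  then show ?case by (intro exI ballI)
qed

lemma le_universal: "\<lbrakk>f \<in> carrier F; N \<in> seminorms\<rbrakk> \<Longrightarrow> N f \<le> U f"
  unfolding universal_seminorm_def using seminorms_bounded[of f]
  by (intro cSUP_upper) (auto simp: bdd_above_def)

lemma universal_le: "(\<And>N. N \<in> seminorms \<Longrightarrow> N f \<le> C) \<Longrightarrow> U f \<le> C"
  unfolding universal_seminorm_def using zero_seminorm by (intro cSUP_least) blast+

lemma universal_nonneg: "f \<in> carrier F \<Longrightarrow> 0 \<le> U f"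
  using le_universal[OF _ zero_seminorm] by simp

lemma universal_relator: "r \<in> R \<Longrightarrow> U r = 0"
  using relators_closed by (intro antisym universal_nonneg universal_le) auto

lemma universal_cscale_le: "f \<in> carrier F \<Longrightarrow> U (cscale F c f) \<le> cmod c * U f"
proof (rule universal_le)
  fix N assume f: "f \<in> carrier F" and N: "N \<in> seminorms"
  interpret star_algebra_seminorm F N
    using N by (rule star_algebra_seminorm_of_seminorms)
  show "N (cscale F c f) \<le> cmod c * U f"
    using le_universal[OF f N] f by (simp add: norm_cscale mult_left_mono)
qed

lemma cstar_seminorm_universal: "cstar_seminorm F U"
proof -
  interpret F: unital_star_algebra F
    by (rule unital_star_algebra_free)
  have add: "U (f \<oplus>\<^bsub>F\<^esub> g) \<le> U f + U g" if "f \<in> carrier F" "g \<in> carrier F" for f g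
  proof (rule universal_le)
    fix N assume N: "N \<in> seminorms"
    interpret star_algebra_seminorm F N
      using N by (rule star_algebra_seminorm_of_seminorms)
    show "N (f \<oplus>\<^bsub>F\<^esub> g) \<le> U f + U g"
      using norm_triangle[OF that] le_universal[OF that(1) N] le_universal[OF that(2) N] by simp
  qed
  have scale: "U (cscale F c f) = cmod c * U f" if f: "f \<in> carrier F" for c f
  proof (cases "c = 0")
    case True
    then show ?thesis
      using universal_cscale_le[OF f, of 0] universal_nonneg[OF F.cscale_closed[OF f], of 0] by simp
  next
    case False
    \<comment> \<open>The reverse inequality is the proved one, applied to the inverse
      scalar.\<close>
    have "U f = U (cscale F (inverse c) (cscale F c f))"
      using False f by (simp add: F.cscale_cscale F.cscale_one)
    also have "\<dots> \<le> cmod (inverse c) * U (cscale F c f)"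
      using f by (intro universal_cscale_le) simp
    finally have "cmod c * U f \<le> cmod c * (cmod (inverse c) * U (cscale F c f))"
      by (rule mult_left_mono) simp
    also have "\<dots> = U (cscale F c f)"
      using False by (simp add: norm_inverse mult.assoc[symmetric])
    finally have "cmod c * U f \<le> U (cscale F c f)" .
    with universal_cscale_le[OF f] show ?thesis by (simp add: antisym)
  qed
  have mult: "U (f \<otimes>\<^bsub>F\<^esub> g) \<le> U f * U g" if "f \<in> carrier F" "g \<in> carrier F" for f g
  proof (rule universal_le)
    fix N assume N: "N \<in> seminorms"
    interpret star_algebra_seminorm F N
      using N by (rule star_algebra_seminorm_of_seminorms)
    show "N (f \<otimes>\<^bsub>F\<^esub> g) \<le> U f * U g"
      using norm_mult[OF that] mult_mono[OF le_universal[OF that(1) N] le_universal[OF that(2) N]]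
        universal_nonneg that by simp
  qed
  have star: "U (cadj F f \<otimes>\<^bsub>F\<^esub> f) = (U f)\<^sup>2" if f: "f \<in> carrier F" for f
  proof (rule antisym)
    have N: "N (cadj F f \<otimes>\<^bsub>F\<^esub> f) = (N f)\<^sup>2" "0 \<le> N f" if "N \<in> seminorms" for N
      using that f by (auto simp: cstar_seminorm_def)
    show "U (cadj F f \<otimes>\<^bsub>F\<^esub> f) \<le> (U f)\<^sup>2"
    proof (rule universal_le)
      fix N assume "N \<in> seminorms"
      then show "N (cadj F f \<otimes>\<^bsub>F\<^esub> f) \<le> (U f)\<^sup>2"
        unfolding N(1)[OF \<open>N \<in> seminorms\<close>]
        by (intro power_mono le_universal f N(2))
    qed
    \<comment> \<open>Taking roots gives a bound on \<open>N f\<close> itself, over which the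
      supremum runs.\<close>
    have "N f \<le> sqrt (U (cadj F f \<otimes>\<^bsub>F\<^esub> f))" if "N \<in> seminorms" for N
    proof (rule real_le_rsqrt)
      show "(N f)\<^sup>2 \<le> U (cadj F f \<otimes>\<^bsub>F\<^esub> f)"
        unfolding N(1)[OF that, symmetric] using f by (intro le_universal that) simp
    qed
    then have "U f \<le> sqrt (U (cadj F f \<otimes>\<^bsub>F\<^esub> f))"
      by (rule universal_le)
    then show "(U f)\<^sup>2 \<le> U (cadj F f \<otimes>\<^bsub>F\<^esub> f)"
      using power_mono[of "U f" "sqrt (U (cadj F f \<otimes>\<^bsub>F\<^esub> f))" 2] f
      by (simp add: universal_nonneg)
  qed
  show ?thesis
    unfolding cstar_seminorm_def
    by (intro conjI ballI allI universal_nonneg add scale mult star)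
qed

lemma star_algebra_seminorm_universal: "star_algebra_seminorm F U"
  by (intro star_algebra_seminorm.intro star_algebra_seminorm_axioms.intro
      unital_star_algebra_free cstar_seminorm_universal)

lemma unital_cstar_algebra_universal: "unital_cstar_algebra (universal_cstar X R)"
  unfolding universal_cstar_def
  by (rule star_algebra_seminorm.unital_cstar_algebra_completion[OF star_algebra_seminorm_universal])

end


section \<open>Constructible ideals of neutral words\<close>

text \<open>The word of the adjoint operator, after \<open>(a^* b)^* = b^* a\<close> for each
  pair.\<close>

definition word_rev :: "('g \<times> 'g) list \<Rightarrow> ('g \<times> 'g) list" where
  "word_rev \<alpha> = rev (map prod.swap \<alpha>)"

lemma word_rev_simps [simp]:
  "word_rev [] = []" "word_rev ((p, q) # \<alpha>) = word_rev \<alpha> @ [(q, p)]" "word_rev (word_rev \<alpha>) = \<alpha>"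
  by (simp_all add: word_rev_def rev_map[symmetric])

lemma set_word_rev [simp]: "set (word_rev \<alpha>) \<subseteq> P \<times> P \<longleftrightarrow> set \<alpha> \<subseteq> P \<times> P"
  by (auto simp: word_rev_def)

locale submonoid_of_group = group G + P: submonoid P G for G (structure) and P
begin

lemma carrier_P [simp]: "p \<in> P \<Longrightarrow> p \<in> carrier G"
  using P.subset by blast

lemma word_val_closed [simp]: "set \<alpha> \<subseteq> P \<times> P \<Longrightarrow> word_val G \<alpha> \<in> carrier G"
proof (induction \<alpha>)
  case (Cons a \<alpha>)
  then show ?case by (cases a) simp
qed simp

lemma word_val_append:
  "set \<alpha> \<subseteq> P \<times> P \<Longrightarrow> set \<beta> \<subseteq> P \<times> P \<Longrightarrow>
    word_val G (\<alpha> @ \<beta>) = word_val G \<alpha> \<otimes> word_val G \<beta>"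
proof (induction \<alpha>)
  case (Cons a \<alpha>)
  then show ?case by (cases a) (simp add: m_assoc)
qed simp

lemma word_val_rev: "set \<alpha> \<subseteq> P \<times> P \<Longrightarrow> word_val G (word_rev \<alpha>) = inv (word_val G \<alpha>)"
proof (induction \<alpha>)
  case (Cons a \<alpha>)
  then show ?case
    by (cases a) (simp add: word_val_append inv_mult_group m_assoc)
qed simp

section \<open>Constructible ideals as domains of partial translations\<close>

lemma mem_inv_l_coset:
  assumes "x \<in> carrier G" "g \<in> carrier G"
  shows "x \<in> inv g <# P \<longleftrightarrow> g \<otimes> x \<in> P"
proof -
  have "x = inv g \<otimes> p \<longleftrightarrow> g \<otimes> x = p" if "p \<in> P" for p
    using inv_solve_left[of x g p] assms that by auto
  then show ?thesis
    by (auto simp: l_coset_def)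
qed

text \<open>Reads the ideal dynamically: the word is a composite of partial translations of
  \<open>P\<close>, performed from its right end, and \<open>x\<close> belongs to the ideal when
  every stage stays inside \<open>P\<close>.\<close>

lemma mem_constr_ideal_Cons:
  assumes "set (a # \<alpha>) \<subseteq> P \<times> P" "x \<in> carrier G"
  shows "x \<in> constr_ideal G P (a # \<alpha>) \<longleftrightarrow>
    x \<in> constr_ideal G P \<alpha> \<and> word_val G (a # \<alpha>) \<otimes> x \<in> P"
  using mem_inv_l_coset[OF assms(2) word_val_closed[OF assms(1)]] by simp

lemma constr_ideal_subset: "constr_ideal G P \<alpha> \<subseteq> P"
  by (induction \<alpha>) auto

lemma mem_constr_ideal_P: "x \<in> constr_ideal G P \<alpha> \<Longrightarrow> x \<in> P"
  using constr_ideal_subset by blast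

lemma word_val_mem:
  "set \<alpha> \<subseteq> P \<times> P \<Longrightarrow> x \<in> constr_ideal G P \<alpha> \<Longrightarrow> word_val G \<alpha> \<otimes> x \<in> P"
proof (cases \<alpha>)
  case (Cons a \<beta>)
  assume "set \<alpha> \<subseteq> P \<times> P" "x \<in> constr_ideal G P \<alpha>"
  then show ?thesis
    using mem_constr_ideal_Cons[of a \<beta> x] mem_constr_ideal_P[of x \<alpha>] unfolding Cons by simp
qed simp

text \<open>The domain of a composite of partial translations, \<open>\<beta>\<close> being
  performed first.\<close>

lemma mem_constr_ideal_append:
  assumes "set \<alpha> \<subseteq> P \<times> P" "set \<beta> \<subseteq> P \<times> P" "x \<in> carrier G"
  shows "x \<in> constr_ideal G P (\<alpha> @ \<beta>) \<longleftrightarrow>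
    x \<in> constr_ideal G P \<beta> \<and> word_val G \<beta> \<otimes> x \<in> constr_ideal G P \<alpha>"
  using assms(1)
proof (induction \<alpha>)
  case Nil
  then show ?case
    using word_val_mem[OF assms(2)] by auto
next
  case (Cons a \<alpha>)
  have "word_val G (a # \<alpha> @ \<beta>) \<otimes> x = word_val G (a # \<alpha>) \<otimes> (word_val G \<beta> \<otimes> x)"
    using Cons.prems assms word_val_append[of "a # \<alpha>" \<beta>] word_val_closed[of "a # \<alpha>"]
    by (simp add: m_assoc)
  moreover have "x \<in> constr_ideal G P (a # \<alpha> @ \<beta>) \<longleftrightarrow>
      x \<in> constr_ideal G P (\<alpha> @ \<beta>) \<and> word_val G (a # \<alpha> @ \<beta>) \<otimes> x \<in> P"
    using Cons.prems assms by (intro mem_constr_ideal_Cons) auto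
  moreover have "word_val G \<beta> \<otimes> x \<in> constr_ideal G P (a # \<alpha>) \<longleftrightarrow>
      word_val G \<beta> \<otimes> x \<in> constr_ideal G P \<alpha> \<and> word_val G (a # \<alpha>) \<otimes> (word_val G \<beta> \<otimes> x) \<in> P"
    using Cons.prems assms by (intro mem_constr_ideal_Cons) auto
  ultimately show ?case
    using Cons by auto
qed

lemma mem_constr_ideal_pair:
  assumes "p \<in> P" "q \<in> P" "x \<in> carrier G"
  shows "x \<in> constr_ideal G P [(p, q)] \<longleftrightarrow> x \<in> P \<and> inv p \<otimes> q \<otimes> x \<in> P"
  using mem_constr_ideal_Cons[of "(p, q)" "[]" x] assms by simp

text \<open>The reversed word is the inverse partial translation, so it is defined on the image of
  the original one.\<close>

lemma mem_constr_ideal_rev: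
  "set \<alpha> \<subseteq> P \<times> P \<Longrightarrow> x \<in> constr_ideal G P \<alpha> \<Longrightarrow>
    word_val G \<alpha> \<otimes> x \<in> constr_ideal G P (word_rev \<alpha>)"
proof (induction \<alpha>)
  case Nil
  then show ?case by simp
next
  case (Cons a \<alpha>)
  obtain p q where a: "a = (p, q)" by force
  have pq [simp]: "p \<in> P" "q \<in> P" "set \<alpha> \<subseteq> P \<times> P"
    using Cons.prems a by auto
  have x [simp]: "x \<in> carrier G"
    using mem_constr_ideal_P[OF Cons.prems(2)] by simp
  have x\<alpha>: "x \<in> constr_ideal G P \<alpha>" "word_val G (a # \<alpha>) \<otimes> x \<in> P"
    using Cons.prems mem_constr_ideal_Cons[of a \<alpha> x] by auto
  define y where "y = word_val G (a # \<alpha>) \<otimes> x"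
  have y: "y \<in> P"
    using x\<alpha> by (simp add: y_def)
  have y_eq: "y = inv p \<otimes> (q \<otimes> (word_val G \<alpha> \<otimes> x))"
    by (simp add: y_def a m_assoc)
  have "inv q \<otimes> (p \<otimes> y) = word_val G \<alpha> \<otimes> x"
    by (simp add: y_eq m_assoc[symmetric])
  then have "inv q \<otimes> p \<otimes> y = word_val G \<alpha> \<otimes> x" "word_val G [(q, p)] \<otimes> y = word_val G \<alpha> \<otimes> x"
    using y by (simp_all add: m_assoc)
  then show ?case
    using Cons.IH x\<alpha> y word_val_mem[of \<alpha> x]
    by (simp add: a y_def[symmetric, unfolded a] mem_constr_ideal_append mem_constr_ideal_pair
        del: word_val.simps constr_ideal.simps)
qed

lemma constr_ideal_mult_right:
  assumes "set \<alpha> \<subseteq> P \<times> P" "x \<in> constr_ideal G P \<alpha>" "p \<in> P"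
  shows "x \<otimes> p \<in> constr_ideal G P \<alpha>"
  using assms(1,2)
proof (induction \<alpha>)
  case Nil
  then show ?case using assms(3) by simp
next
  case (Cons a \<alpha>)
  have [simp]: "x \<in> carrier G"
    using mem_constr_ideal_P[OF Cons.prems(2)] by simp
  have "x \<in> constr_ideal G P \<alpha>" "word_val G (a # \<alpha>) \<otimes> x \<in> P"
    using Cons.prems mem_constr_ideal_Cons[of a \<alpha> x] by auto
  moreover from this have "word_val G (a # \<alpha>) \<otimes> (x \<otimes> p) \<in> P"
    using assms(3) word_val_closed[OF Cons.prems(1)] P.m_closed
    by (simp add: m_assoc[symmetric] del: word_val.simps)
  ultimately show ?case
    using Cons assms(3) mem_constr_ideal_Cons[of a \<alpha> "x \<otimes> p"] by simp
qed

text \<open>Right ideals are stable under right multiplication by \<open>P\<close>, so properness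
  can be tested at the identity alone.\<close>

lemma constr_ideal_eq_P_iff:
  "set \<alpha> \<subseteq> P \<times> P \<Longrightarrow> constr_ideal G P \<alpha> = P \<longleftrightarrow> \<one> \<in> constr_ideal G P \<alpha>"
  using constr_ideal_mult_right[of \<alpha> \<one>] constr_ideal_subset[of \<alpha>] P.one_closed
  by (auto simp del: constr_ideal.simps)

lemma neutral_wordsD: "\<alpha> \<in> neutral_words G P \<Longrightarrow> set \<alpha> \<subseteq> P \<times> P"
    "\<alpha> \<in> neutral_words G P \<Longrightarrow> word_val G \<alpha> = \<one>"
  by (simp_all add: neutral_words_def)

lemma neutral_Nil [simp]: "[] \<in> neutral_words G P"
  by (simp add: neutral_words_def)

lemma neutral_append [simp]:
  "\<alpha> \<in> neutral_words G P \<Longrightarrow> \<beta> \<in> neutral_words G P \<Longrightarrow> \<alpha> @ \<beta> \<in> neutral_words G P"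
  by (simp add: neutral_words_def word_val_append)

lemma neutral_rev [simp]: "\<alpha> \<in> neutral_words G P \<Longrightarrow> word_rev \<alpha> \<in> neutral_words G P"
  by (simp add: neutral_words_def word_val_rev)

text \<open>A neutral word moves no point, so composing the partial translations merely intersects
  their domains.\<close>

lemma constr_ideal_append:
  assumes "\<alpha> \<in> neutral_words G P" "\<beta> \<in> neutral_words G P"
  shows "constr_ideal G P (\<alpha> @ \<beta>) = constr_ideal G P \<alpha> \<inter> constr_ideal G P \<beta>"
proof -
  have "x \<in> constr_ideal G P (\<alpha> @ \<beta>) \<longleftrightarrow> x \<in> constr_ideal G P \<beta> \<and> x \<in> constr_ideal G P \<alpha>"
    if "x \<in> P" for x
    using mem_constr_ideal_append[of \<alpha> \<beta> x] assms that by (simp add: neutral_wordsD)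
  then show ?thesis
    using mem_constr_ideal_P by blast
qed

lemma constr_ideal_rev:
  assumes "\<alpha> \<in> neutral_words G P"
  shows "constr_ideal G P (word_rev \<alpha>) = constr_ideal G P \<alpha>"
proof -
  have "constr_ideal G P \<beta> \<subseteq> constr_ideal G P (word_rev \<beta>)" if "\<beta> \<in> neutral_words G P" for \<beta>
    using mem_constr_ideal_rev[of \<beta>] mem_constr_ideal_P[of _ \<beta>] that by (auto simp: neutral_wordsD)
  from this[OF assms] this[OF neutral_rev[OF assms]] show ?thesis
    by auto
qed

text \<open>The word of the compression of \<open>t(\<alpha>)\<close> by the isometry of
  \<open>x\<close>. The entries \<open>\<one>\<close> pad it to even length and are represented by
  the unit.\<close>

definition word_conj :: "'a \<Rightarrow> ('a \<times> 'a) list \<Rightarrow> ('a \<times> 'a) list" where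
  "word_conj x \<alpha> = [(x, \<one>)] @ \<alpha> @ [(\<one>, x)]"

text \<open>Conjugated lists have to stay duplicate-free, since joint properness speaks of such
  lists.\<close>

lemma inj_word_conj: "inj (word_conj x)"
  by (auto simp: word_conj_def inj_def)

lemma neutral_word_conj:
  "x \<in> P \<Longrightarrow> \<alpha> \<in> neutral_words G P \<Longrightarrow> word_conj x \<alpha> \<in> neutral_words G P"
  by (auto simp: word_conj_def neutral_words_def word_val_append)

text \<open>This left quotient by \<open>x\<close> is all of \<open>P\<close> when \<open>x\<close>
  lies in \<open>K(\<alpha>)\<close>; otherwise it misses the identity and is proper. The dichotomy
  decides which conjugated projections become 1.\<close>

lemma constr_ideal_word_conj:
  assumes x: "x \<in> P" and \<alpha>: "\<alpha> \<in> neutral_words G P"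
  shows "constr_ideal G P (word_conj x \<alpha>) = {z \<in> P. x \<otimes> z \<in> constr_ideal G P \<alpha>}"
proof -
  have "z \<in> constr_ideal G P (word_conj x \<alpha>) \<longleftrightarrow> x \<otimes> z \<in> constr_ideal G P \<alpha>" if z: "z \<in> P" for z
  proof -
    have "z \<in> constr_ideal G P (\<alpha> @ [(\<one>, x)]) \<longleftrightarrow> x \<otimes> z \<in> constr_ideal G P \<alpha>"
      using x z \<alpha> mem_constr_ideal_append[of \<alpha> "[(\<one>, x)]" z] mem_constr_ideal_pair[of \<one> x z]
      by (simp add: neutral_wordsD)
    moreover have "word_val G (word_conj x \<alpha>) = \<one>"
      using neutral_word_conj[OF x \<alpha>] by (simp add: neutral_wordsD)
    ultimately show ?thesis
      using mem_constr_ideal_Cons[of "(x, \<one>)" "\<alpha> @ [(\<one>, x)]" z] x z \<alpha>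
      by (simp add: word_conj_def neutral_wordsD del: word_val.simps constr_ideal.simps)
  qed
  then show ?thesis
    using mem_constr_ideal_P by blast
qed

end


section \<open>Families satisfying the Toeplitz relations\<close>

lemma list_mult_simps [simp]:
  "list_mult A [] = \<one>\<^bsub>A\<^esub>" "list_mult A (x # xs) = x \<otimes>\<^bsub>A\<^esub> list_mult A xs"
  by (simp_all add: list_mult_def)

context unital_star_algebra
begin

section \<open>Word operators and linear spans in a star algebra\<close>

lemma list_mult_closed: "set xs \<subseteq> carrier A \<Longrightarrow> list_mult A xs \<in> carrier A"
  by (induction xs) auto

lemma word_op_closed:
  assumes w: "w ` P \<subseteq> carrier A"
  shows "set \<alpha> \<subseteq> P \<times> P \<Longrightarrow> word_op A w \<alpha> \<in> carrier A"
proof (induction \<alpha>)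
  case (Cons a \<alpha>)
  then show ?case by (cases a) (simp add: image_subset_iff[THEN iffD1, rule_format, OF w])
qed simp

lemma word_op_append:
  assumes w: "w ` P \<subseteq> carrier A"
  shows "set \<alpha> \<subseteq> P \<times> P \<Longrightarrow> set \<beta> \<subseteq> P \<times> P \<Longrightarrow>
    word_op A w (\<alpha> @ \<beta>) = word_op A w \<alpha> \<otimes> word_op A w \<beta>"
proof (induction \<alpha>)
  case Nil
  then show ?case
    using word_op_closed[OF w, of \<beta>] by simp
next
  case (Cons a \<alpha>)
  then show ?case
    using word_op_closed[OF w, of \<alpha>] word_op_closed[OF w, of \<beta>]
    by (cases a) (simp add: image_subset_iff[THEN iffD1, rule_format, OF w] m_assoc)
qed

lemma word_op_rev:
  assumes w: "w ` P \<subseteq> carrier A"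
  shows "set \<alpha> \<subseteq> P \<times> P \<Longrightarrow> word_op A w (word_rev \<alpha>) = cadj A (word_op A w \<alpha>)"
proof (induction \<alpha>)
  case (Cons a \<alpha>)
  then show ?case
    using word_op_closed[OF w, of \<alpha>] word_op_append[OF w, of "word_rev \<alpha>"]
    by (cases a) (simp add: image_subset_iff[THEN iffD1, rule_format, OF w] m_assoc cadj_mult cadj_cadj)
qed simp

lemma clin_span_closed:
  assumes "S \<subseteq> carrier A" shows "v \<in> clin_span A S \<Longrightarrow> v \<in> carrier A"
proof (induction rule: clin_span.induct)
  case (step s v c)
  then show ?case
    using subsetD[OF assms] by simp
qed simp

lemma clin_span_base: "S \<subseteq> carrier A \<Longrightarrow> s \<in> S \<Longrightarrow> s \<in> clin_span A S"
  using clin_span.step[OF _ clin_span.zero, of s S A 1] by (simp add: subset_iff cscale_one)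

lemma clin_span_add:
  assumes S: "S \<subseteq> carrier A" and v: "v \<in> clin_span A S"
  shows "u \<in> clin_span A S \<Longrightarrow> u \<oplus> v \<in> clin_span A S"
proof (induction rule: clin_span.induct)
  case zero
  then show ?case
    using v clin_span_closed[OF S v] by simp
next
  case (step s u c)
  then have "cscale A c s \<oplus> u \<oplus> v = cscale A c s \<oplus> (u \<oplus> v)"
    using S clin_span_closed[OF S] v by (simp add: a_assoc subset_iff)
  then show ?case
    using clin_span.step[OF step(1,3)] by simp
qed

lemma clin_span_cscale:
  assumes S: "S \<subseteq> carrier A"
  shows "u \<in> clin_span A S \<Longrightarrow> cscale A d u \<in> clin_span A S"
proof (induction rule: clin_span.induct)
  case zero
  then show ?case
    by (simp add: clin_span.zero)
next
  case (step s u c)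
  then have "cscale A d (cscale A c s \<oplus> u) = cscale A (d * c) s \<oplus> cscale A d u"
    using S clin_span_closed[OF S] by (simp add: cscale_add_right cscale_cscale subset_iff)
  then show ?case
    using clin_span.step[OF step(1,3)] by simp
qed

lemma clin_span_minus:
  assumes S: "S \<subseteq> carrier A" and "u \<in> clin_span A S" "v \<in> clin_span A S"
  shows "u \<ominus> v \<in> clin_span A S"
  using clin_span_add[OF S clin_span_cscale[OF S assms(3), of "- 1"] assms(2)] assms
  by (simp add: minus_eq_cscale clin_span_closed[OF S])

end

text \<open>Purely algebraic on both sides, so that it serves \<open>\<rho>\<close> as well as the
  map from the free algebra to its completion.\<close>

locale star_homomorphism = A: unital_star_algebra A + B: unital_star_algebra B
  for A :: "('a, 'm) star_ring_scheme" and B :: "('b, 'n) star_ring_scheme" +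
  fixes h :: "'a \<Rightarrow> 'b"
  assumes star_hom: "h \<in> unital_star_hom A B"
begin

lemma ring_hom: "h \<in> ring_hom A B"
  using star_hom by (simp add: unital_star_hom_def)

lemma hom_closed [simp]: "x \<in> carrier A \<Longrightarrow> h x \<in> carrier B"
  and hom_add: "x \<in> carrier A \<Longrightarrow> y \<in> carrier A \<Longrightarrow> h (x \<oplus>\<^bsub>A\<^esub> y) = h x \<oplus>\<^bsub>B\<^esub> h y"
  and hom_mult: "x \<in> carrier A \<Longrightarrow> y \<in> carrier A \<Longrightarrow> h (x \<otimes>\<^bsub>A\<^esub> y) = h x \<otimes>\<^bsub>B\<^esub> h y"
  and hom_one [simp]: "h \<one>\<^bsub>A\<^esub> = \<one>\<^bsub>B\<^esub>"
  and hom_zero [simp]: "h \<zero>\<^bsub>A\<^esub> = \<zero>\<^bsub>B\<^esub>"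
  using ring_hom_closed[OF ring_hom] ring_hom_add[OF ring_hom] ring_hom_mult[OF ring_hom]
    ring_hom_one[OF ring_hom] ring_hom_zero[OF ring_hom A.ring_axioms B.ring_axioms]
  by simp_all

lemma hom_cscale: "x \<in> carrier A \<Longrightarrow> h (cscale A c x) = cscale B c (h x)"
  and hom_cadj: "x \<in> carrier A \<Longrightarrow> h (cadj A x) = cadj B (h x)"
  using star_hom by (simp_all add: unital_star_hom_def)

lemma hom_minus: "x \<in> carrier A \<Longrightarrow> y \<in> carrier A \<Longrightarrow> h (x \<ominus>\<^bsub>A\<^esub> y) = h x \<ominus>\<^bsub>B\<^esub> h y"
  by (simp add: A.minus_eq_cscale B.minus_eq_cscale hom_add hom_cscale)

lemma hom_list_mult: "set xs \<subseteq> carrier A \<Longrightarrow> h (list_mult A xs) = list_mult B (map h xs)"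
  by (induction xs) (simp_all add: hom_mult A.list_mult_closed)

lemma hom_word_op:
  assumes w: "w ` P \<subseteq> carrier A"
  shows "set \<alpha> \<subseteq> P \<times> P \<Longrightarrow> h (word_op A w \<alpha>) = word_op B (\<lambda>p. h (w p)) \<alpha>"
proof (induction \<alpha>)
  case (Cons a \<alpha>)
  then show ?case
    using A.word_op_closed[OF w, of \<alpha>]
    by (cases a) (simp add: image_subset_iff[THEN iffD1, rule_format, OF w] hom_mult hom_cadj)
qed simp

end

text \<open>The analysis of the diagonal rests only on the relations holding in some C*-algebra.
  Universality matters where the products of complements are shown to be nonzero.\<close>

locale toeplitz_family = submonoid_of_group G P + T: unital_cstar_algebra T
  for G :: "('g, 'm) monoid_scheme" (structure) and P and T :: "('a, 'n) cstar_ring_scheme" +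
  fixes w :: "'g \<Rightarrow> 'a"
  assumes w_closed: "p \<in> P \<Longrightarrow> w p \<in> carrier T"
    and relators_zero: "toeplitz_relators G P T w \<subseteq> {\<zero>\<^bsub>T\<^esub>}"
begin

abbreviation "t \<equiv> word_op T w"

abbreviation "W \<equiv> neutral_words G P"

abbreviation tcompl ("t\<^sup>\<bottom>") where "t\<^sup>\<bottom> \<gamma> \<equiv> \<one>\<^bsub>T\<^esub> \<ominus>\<^bsub>T\<^esub> t \<gamma>"

definition prod_compl :: "('g \<times> 'g) list list \<Rightarrow> 'a" where
  "prod_compl F = list_mult T (map (\<lambda>\<gamma>. t\<^sup>\<bottom> \<gamma>) F)"

text \<open>Stands for the indicator of \<open>K(\<alpha>)\<close> minus the ideals of
  \<open>F\<close>. It is an atom only relative to the finitely many words used so far, and may be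
  zero.\<close>

definition atom :: "('g \<times> 'g) list \<Rightarrow> ('g \<times> 'g) list list \<Rightarrow> 'a" where
  "atom \<alpha> F = t \<alpha> \<otimes>\<^bsub>T\<^esub> prod_compl F"

section \<open>The commuting projections of neutral words\<close>

lemma w_image: "w ` P \<subseteq> carrier T"
  using w_closed by blast

lemma w_one: "w \<one> = \<one>\<^bsub>T\<^esub>"
proof -
  have "w \<one> \<ominus>\<^bsub>T\<^esub> \<one>\<^bsub>T\<^esub> = \<zero>\<^bsub>T\<^esub>"
    using relators_zero by (simp add: toeplitz_relators_def)
  then show ?thesis
    by (simp add: T.minus_eq_zero_iff w_closed P.one_closed)
qed

lemma t_empty:
  assumes "\<alpha> \<in> W" "constr_ideal G P \<alpha> = {}" shows "t \<alpha> = \<zero>\<^bsub>T\<^esub>"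
proof -
  have "t \<alpha> \<in> toeplitz_relators G P T w"
    using assms unfolding toeplitz_relators_def by blast
  then show ?thesis
    using relators_zero by blast
qed

lemma t_closed [simp]: "\<alpha> \<in> W \<Longrightarrow> t \<alpha> \<in> carrier T"
  using T.word_op_closed[OF w_image, of \<alpha>] by (simp add: neutral_wordsD)

lemma t_eq:
  assumes "\<alpha> \<in> W" "\<beta> \<in> W" "constr_ideal G P \<alpha> = constr_ideal G P \<beta>" shows "t \<alpha> = t \<beta>"
proof -
  have "t \<alpha> \<ominus>\<^bsub>T\<^esub> t \<beta> \<in> toeplitz_relators G P T w"
    using assms unfolding toeplitz_relators_def by blast
  then show ?thesis
    using relators_zero assms T.minus_eq_zero_iff[of "t \<alpha>" "t \<beta>"] by auto
qed

lemma t_cover: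
  assumes "\<alpha> \<in> W" "F \<noteq> []" "distinct F" "set F \<subseteq> W"
    "constr_ideal G P \<alpha> = (\<Union>\<beta>\<in>set F. constr_ideal G P \<beta>)"
  shows "list_mult T (map (\<lambda>\<beta>. t \<alpha> \<ominus>\<^bsub>T\<^esub> t \<beta>) F) = \<zero>\<^bsub>T\<^esub>"
proof -
  have "list_mult T (map (\<lambda>\<beta>. t \<alpha> \<ominus>\<^bsub>T\<^esub> t \<beta>) F) \<in> toeplitz_relators G P T w"
    using assms unfolding toeplitz_relators_def by blast
  then show ?thesis
    using relators_zero by blast
qed

lemma t_append:
  "set \<alpha> \<subseteq> P \<times> P \<Longrightarrow> set \<beta> \<subseteq> P \<times> P \<Longrightarrow> t (\<alpha> @ \<beta>) = t \<alpha> \<otimes>\<^bsub>T\<^esub> t \<beta>"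
  by (rule T.word_op_append[OF w_image])

lemma t_mult: "\<alpha> \<in> W \<Longrightarrow> \<beta> \<in> W \<Longrightarrow> t \<alpha> \<otimes>\<^bsub>T\<^esub> t \<beta> = t (\<alpha> @ \<beta>)"
  by (simp add: t_append neutral_wordsD)

text \<open>A product of neutral words is a neutral word whose ideal is the intersection, so
  commutation and idempotence are instances of (T3).\<close>

lemma t_commute: "\<alpha> \<in> W \<Longrightarrow> \<beta> \<in> W \<Longrightarrow> t \<alpha> \<otimes>\<^bsub>T\<^esub> t \<beta> = t \<beta> \<otimes>\<^bsub>T\<^esub> t \<alpha>"
  unfolding t_mult by (rule t_eq) (auto simp: constr_ideal_append)

lemma t_idem: "\<alpha> \<in> W \<Longrightarrow> t \<alpha> \<otimes>\<^bsub>T\<^esub> t \<alpha> = t \<alpha>"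
  unfolding t_mult by (rule t_eq) (auto simp: constr_ideal_append)

text \<open>(T3) again: reversing a neutral word keeps its ideal.\<close>

lemma t_adj: "\<alpha> \<in> W \<Longrightarrow> cadj T (t \<alpha>) = t \<alpha>"
  using T.word_op_rev[OF w_image, of \<alpha>] t_eq[of "word_rev \<alpha>" \<alpha>]
  by (simp add: neutral_wordsD constr_ideal_rev)

lemma compl_idem: "\<alpha> \<in> W \<Longrightarrow> t\<^sup>\<bottom> \<alpha> \<otimes>\<^bsub>T\<^esub> t\<^sup>\<bottom> \<alpha> = t\<^sup>\<bottom> \<alpha>"
  by (simp add: T.minus_mult_left T.minus_mult_right t_idem)
    (simp add: a_minus_def T.r_neg)

lemma compl_adj: "\<alpha> \<in> W \<Longrightarrow> cadj T (t\<^sup>\<bottom> \<alpha>) = t\<^sup>\<bottom> \<alpha>"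
  by (simp add: T.cadj_minus t_adj)

lemma compl_commute:
  "\<alpha> \<in> W \<Longrightarrow> y \<in> carrier T \<Longrightarrow> t \<alpha> \<otimes>\<^bsub>T\<^esub> y = y \<otimes>\<^bsub>T\<^esub> t \<alpha> \<Longrightarrow> t\<^sup>\<bottom> \<alpha> \<otimes>\<^bsub>T\<^esub> y = y \<otimes>\<^bsub>T\<^esub> t\<^sup>\<bottom> \<alpha>"
  by (simp add: T.minus_mult_left T.minus_mult_right)

lemma prod_compl_simps [simp]:
  "prod_compl [] = \<one>\<^bsub>T\<^esub>" "prod_compl (\<gamma> # F) = t\<^sup>\<bottom> \<gamma> \<otimes>\<^bsub>T\<^esub> prod_compl F"
  by (simp_all add: prod_compl_def)

lemma prod_compl_closed [simp]: "set F \<subseteq> W \<Longrightarrow> prod_compl F \<in> carrier T"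
  by (induction F) simp_all

lemma prod_compl_commute:
  "set F \<subseteq> W \<Longrightarrow> \<alpha> \<in> W \<Longrightarrow> t \<alpha> \<otimes>\<^bsub>T\<^esub> prod_compl F = prod_compl F \<otimes>\<^bsub>T\<^esub> t \<alpha>"
proof (induction F)
  case (Cons \<gamma> F)
  have "t \<alpha> \<otimes>\<^bsub>T\<^esub> (t\<^sup>\<bottom> \<gamma> \<otimes>\<^bsub>T\<^esub> prod_compl F) = (t \<alpha> \<otimes>\<^bsub>T\<^esub> t\<^sup>\<bottom> \<gamma>) \<otimes>\<^bsub>T\<^esub> prod_compl F"
    using Cons.prems by (simp add: T.m_assoc)
  also have "t \<alpha> \<otimes>\<^bsub>T\<^esub> t\<^sup>\<bottom> \<gamma> = t\<^sup>\<bottom> \<gamma> \<otimes>\<^bsub>T\<^esub> t \<alpha>"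
    using compl_commute[of \<gamma> "t \<alpha>"] t_commute[of \<gamma> \<alpha>] Cons.prems by simp
  also have "t\<^sup>\<bottom> \<gamma> \<otimes>\<^bsub>T\<^esub> t \<alpha> \<otimes>\<^bsub>T\<^esub> prod_compl F = t\<^sup>\<bottom> \<gamma> \<otimes>\<^bsub>T\<^esub> (prod_compl F \<otimes>\<^bsub>T\<^esub> t \<alpha>)"
    using Cons by (simp add: T.m_assoc)
  finally show ?case
    using Cons.prems by (simp add: T.m_assoc)
qed simp

lemma compl_prod_compl_commute:
  "set F \<subseteq> W \<Longrightarrow> \<alpha> \<in> W \<Longrightarrow> t\<^sup>\<bottom> \<alpha> \<otimes>\<^bsub>T\<^esub> prod_compl F = prod_compl F \<otimes>\<^bsub>T\<^esub> t\<^sup>\<bottom> \<alpha>"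
  by (simp add: compl_commute prod_compl_commute)

lemma prod_compl_absorb:
  "\<gamma> \<in> set F \<Longrightarrow> set F \<subseteq> W \<Longrightarrow> t\<^sup>\<bottom> \<gamma> \<otimes>\<^bsub>T\<^esub> prod_compl F = prod_compl F"
proof (induction F)
  case (Cons \<delta> F)
  have [simp]: "\<gamma> \<in> W" "\<delta> \<in> W" "set F \<subseteq> W"
    using Cons.prems by auto
  show ?case
  proof (cases "\<gamma> = \<delta>")
    case True
    then show ?thesis
      by (simp add: T.m_assoc[symmetric] compl_idem)
  next
    case False
    have "t\<^sup>\<bottom> \<gamma> \<otimes>\<^bsub>T\<^esub> t\<^sup>\<bottom> \<delta> = t\<^sup>\<bottom> \<delta> \<otimes>\<^bsub>T\<^esub> t\<^sup>\<bottom> \<gamma>"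
      by (intro compl_commute) (simp_all add: t_commute compl_commute[symmetric])
    then have "t\<^sup>\<bottom> \<gamma> \<otimes>\<^bsub>T\<^esub> (t\<^sup>\<bottom> \<delta> \<otimes>\<^bsub>T\<^esub> prod_compl F) = t\<^sup>\<bottom> \<delta> \<otimes>\<^bsub>T\<^esub> (t\<^sup>\<bottom> \<gamma> \<otimes>\<^bsub>T\<^esub> prod_compl F)"
      by (simp add: T.m_assoc[symmetric])
    then show ?thesis
      using Cons False by simp
  qed
qed simp

text \<open>Refining an atom may repeat a word, whereas (T4) and joint properness are stated for
  duplicate-free lists.\<close>

lemma prod_compl_remdups: "set F \<subseteq> W \<Longrightarrow> prod_compl (remdups F) = prod_compl F"
  by (induction F) (simp_all add: prod_compl_absorb)

lemma prod_compl_idem: "set F \<subseteq> W \<Longrightarrow> prod_compl F \<otimes>\<^bsub>T\<^esub> prod_compl F = prod_compl F"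
proof (induction F)
  case (Cons \<gamma> F)
  have [simp]: "\<gamma> \<in> W" "set F \<subseteq> W"
    using Cons.prems by auto
  have "prod_compl (\<gamma> # F) \<otimes>\<^bsub>T\<^esub> prod_compl (\<gamma> # F) =
      t\<^sup>\<bottom> \<gamma> \<otimes>\<^bsub>T\<^esub> (prod_compl F \<otimes>\<^bsub>T\<^esub> t\<^sup>\<bottom> \<gamma>) \<otimes>\<^bsub>T\<^esub> prod_compl F"
    by (simp add: T.m_assoc)
  also have "\<dots> = (t\<^sup>\<bottom> \<gamma> \<otimes>\<^bsub>T\<^esub> t\<^sup>\<bottom> \<gamma>) \<otimes>\<^bsub>T\<^esub> (prod_compl F \<otimes>\<^bsub>T\<^esub> prod_compl F)"
    unfolding compl_prod_compl_commute[symmetric, OF \<open>set F \<subseteq> W\<close> \<open>\<gamma> \<in> W\<close>] by (simp add: T.m_assoc)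
  also have "\<dots> = prod_compl (\<gamma> # F)"
    using Cons.IH by (simp add: compl_idem)
  finally show ?case .
qed simp

lemma norm_t_le: "\<alpha> \<in> W \<Longrightarrow> cnorm T (t \<alpha>) \<le> 1"
  by (intro T.norm_projection_le) (simp_all add: t_adj t_idem)

lemma norm_compl_le: "\<alpha> \<in> W \<Longrightarrow> cnorm T (t\<^sup>\<bottom> \<alpha>) \<le> 1"
  by (intro T.norm_projection_le) (simp_all add: compl_adj compl_idem)

lemma norm_prod_compl_le: "set F \<subseteq> W \<Longrightarrow> cnorm T (prod_compl F) \<le> 1"
proof (induction F)
  case Nil
  then show ?case by (simp add: T.norm_one_le)
next
  case (Cons \<gamma> F)
  have "cnorm T (prod_compl (\<gamma> # F)) \<le> cnorm T (t\<^sup>\<bottom> \<gamma>) * cnorm T (prod_compl F)"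
    using Cons.prems by (simp add: T.norm_mult)
  also have "\<dots> \<le> 1 * 1"
    using Cons by (intro mult_mono norm_compl_le) simp_all
  finally show ?case by simp
qed

section \<open>Atoms of the diagonal\<close>

lemma atom_closed [simp]: "\<alpha> \<in> W \<Longrightarrow> set F \<subseteq> W \<Longrightarrow> atom \<alpha> F \<in> carrier T"
  by (simp add: atom_def)

lemma norm_atom_le:
  assumes "\<alpha> \<in> W" "set F \<subseteq> W" shows "cnorm T (atom \<alpha> F) \<le> 1"
proof -
  have "cnorm T (atom \<alpha> F) \<le> cnorm T (t \<alpha>) * cnorm T (prod_compl F)"
    using assms by (simp add: atom_def T.norm_mult)
  also have "\<dots> \<le> 1 * 1"
    using assms by (intro mult_mono norm_t_le norm_prod_compl_le) simp_all
  finally show ?thesis by simp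
qed

lemma atom_commute:
  assumes "\<alpha> \<in> W" "set F \<subseteq> W" "\<beta> \<in> W"
  shows "t \<beta> \<otimes>\<^bsub>T\<^esub> atom \<alpha> F = atom \<alpha> F \<otimes>\<^bsub>T\<^esub> t \<beta>"
proof -
  have "t \<beta> \<otimes>\<^bsub>T\<^esub> atom \<alpha> F = t \<beta> \<otimes>\<^bsub>T\<^esub> t \<alpha> \<otimes>\<^bsub>T\<^esub> prod_compl F"
    using assms by (simp add: atom_def T.m_assoc)
  also have "\<dots> = t \<alpha> \<otimes>\<^bsub>T\<^esub> (t \<beta> \<otimes>\<^bsub>T\<^esub> prod_compl F)"
    using assms t_commute[of \<beta> \<alpha>] by (simp add: T.m_assoc)
  also have "\<dots> = atom \<alpha> F \<otimes>\<^bsub>T\<^esub> t \<beta>"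
    using assms by (simp add: prod_compl_commute[OF assms(2,3)] atom_def T.m_assoc)
  finally show ?thesis .
qed

lemma atom_idem:
  assumes "\<alpha> \<in> W" "set F \<subseteq> W"
  shows "atom \<alpha> F \<otimes>\<^bsub>T\<^esub> atom \<alpha> F = atom \<alpha> F"
proof -
  have "atom \<alpha> F \<otimes>\<^bsub>T\<^esub> atom \<alpha> F = (atom \<alpha> F \<otimes>\<^bsub>T\<^esub> t \<alpha>) \<otimes>\<^bsub>T\<^esub> prod_compl F"
    using assms by (simp add: atom_def T.m_assoc)
  also have "\<dots> = (t \<alpha> \<otimes>\<^bsub>T\<^esub> t \<alpha>) \<otimes>\<^bsub>T\<^esub> (prod_compl F \<otimes>\<^bsub>T\<^esub> prod_compl F)"
    using assms unfolding atom_commute[symmetric, OF assms assms(1)] by (simp add: atom_def T.m_assoc)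
  finally show ?thesis
    using assms by (simp add: t_idem prod_compl_idem atom_def)
qed

text \<open>Cutting an atom by \<open>t \<beta>\<close> or by its complement gives atoms again; the
  induction over the span refines its atom in this way.\<close>

lemma atom_mult_t:
  assumes "\<alpha> \<in> W" "set F \<subseteq> W" "\<beta> \<in> W"
  shows "atom \<alpha> F \<otimes>\<^bsub>T\<^esub> t \<beta> = atom (\<alpha> @ \<beta>) F"
proof -
  have "atom \<alpha> F \<otimes>\<^bsub>T\<^esub> t \<beta> = t \<alpha> \<otimes>\<^bsub>T\<^esub> (t \<beta> \<otimes>\<^bsub>T\<^esub> prod_compl F)"
    using assms by (simp add: atom_def T.m_assoc prod_compl_commute[OF assms(2,3)])
  also have "\<dots> = t \<alpha> \<otimes>\<^bsub>T\<^esub> t \<beta> \<otimes>\<^bsub>T\<^esub> prod_compl F"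
    using assms by (simp add: T.m_assoc)
  finally show ?thesis
    using assms by (simp add: t_mult atom_def)
qed

lemma atom_mult_compl:
  assumes "\<alpha> \<in> W" "set F \<subseteq> W" "\<beta> \<in> W"
  shows "atom \<alpha> F \<otimes>\<^bsub>T\<^esub> t\<^sup>\<bottom> \<beta> = atom \<alpha> (\<beta> # F)"
  using assms by (simp add: atom_def T.m_assoc compl_prod_compl_commute)

text \<open>This is where the relations (T4) enter.\<close>

lemma atom_cover_zero:
  assumes \<alpha>: "\<alpha> \<in> W" and F: "set F \<subseteq> W" "distinct F"
    and cover: "constr_ideal G P \<alpha> \<subseteq> (\<Union>\<gamma>\<in>set F. constr_ideal G P \<gamma>)"
  shows "atom \<alpha> F = \<zero>\<^bsub>T\<^esub>"
proof (cases "F = []")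
  \<comment> \<open>Here \<open>K(\<alpha>)\<close> is empty and (T2) takes the place of (T4), which
    is stated for nonempty lists.\<close>
  case True
  then show ?thesis
    using t_empty[OF \<alpha>] cover \<alpha> by (simp add: atom_def)
next
  case False
  \<comment> \<open>(T4) asks for a union equal to \<open>K(\<alpha>)\<close>, not for a cover.
    Prefixing \<open>\<alpha>\<close> cuts each ideal of \<open>F\<close> down to
    \<open>K(\<alpha>)\<close>.\<close>
  have "list_mult T (map (\<lambda>\<beta>. t \<alpha> \<ominus>\<^bsub>T\<^esub> t \<beta>) (map ((@) \<alpha>) F)) = \<zero>\<^bsub>T\<^esub>"
  proof (rule t_cover[OF \<alpha>])
    show "set (map ((@) \<alpha>) F) \<subseteq> W"
      using \<alpha> F by auto
    have "constr_ideal G P (\<alpha> @ \<gamma>) = constr_ideal G P \<alpha> \<inter> constr_ideal G P \<gamma>" if "\<gamma> \<in> set F" for \<gamma>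
      using that F \<alpha> by (intro constr_ideal_append) auto
    then show "constr_ideal G P \<alpha> = (\<Union>\<beta>\<in>set (map ((@) \<alpha>) F). constr_ideal G P \<beta>)"
      using cover by auto
  qed (use False F in \<open>simp_all add: distinct_map inj_on_def\<close>)
  \<comment> \<open>Every factor is \<open>t \<alpha>\<close> times a complement, and the copies of
    \<open>t \<alpha>\<close> merge into one; at least one copy is present because \<open>F\<close>
    is nonempty.\<close>
  moreover have "list_mult T (map (\<lambda>\<beta>. t \<alpha> \<ominus>\<^bsub>T\<^esub> t \<beta>) (map ((@) \<alpha>) F)) = atom \<alpha> F"
    using False F(1)
  proof (induction F rule: list_nonempty_induct)
    case (single \<gamma>)
    then show ?case
      using \<alpha> by (simp add: atom_def T.minus_mult_right t_mult)
  next
    case (cons \<gamma> F)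
    have [simp]: "\<gamma> \<in> W" "set F \<subseteq> W"
      using cons.prems by auto
    have "t \<alpha> \<ominus>\<^bsub>T\<^esub> t (\<alpha> @ \<gamma>) = t \<alpha> \<otimes>\<^bsub>T\<^esub> t\<^sup>\<bottom> \<gamma>"
      using \<alpha> by (simp add: T.minus_mult_right t_mult)
    then have "list_mult T (map (\<lambda>\<beta>. t \<alpha> \<ominus>\<^bsub>T\<^esub> t \<beta>) (map ((@) \<alpha>) (\<gamma> # F))) =
        t \<alpha> \<otimes>\<^bsub>T\<^esub> t\<^sup>\<bottom> \<gamma> \<otimes>\<^bsub>T\<^esub> (t \<alpha> \<otimes>\<^bsub>T\<^esub> prod_compl F)"
      using cons.IH by (simp add: atom_def)
    also have "\<dots> = t \<alpha> \<otimes>\<^bsub>T\<^esub> (t\<^sup>\<bottom> \<gamma> \<otimes>\<^bsub>T\<^esub> t \<alpha>) \<otimes>\<^bsub>T\<^esub> prod_compl F"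
      using \<alpha> by (simp add: T.m_assoc)
    also have "t\<^sup>\<bottom> \<gamma> \<otimes>\<^bsub>T\<^esub> t \<alpha> = t \<alpha> \<otimes>\<^bsub>T\<^esub> t\<^sup>\<bottom> \<gamma>"
      using \<alpha> by (intro compl_commute t_commute) simp_all
    also have "t \<alpha> \<otimes>\<^bsub>T\<^esub> (t \<alpha> \<otimes>\<^bsub>T\<^esub> t\<^sup>\<bottom> \<gamma>) \<otimes>\<^bsub>T\<^esub> prod_compl F = atom \<alpha> (\<gamma> # F)"
      using \<alpha> by (simp add: atom_def T.m_assoc[symmetric] t_idem)
    finally show ?case .
  qed
  ultimately show ?thesis by simp
qed

section \<open>Compression by the generating isometries\<close>

lemma isometry: "x \<in> P \<Longrightarrow> cadj T (w x) \<otimes>\<^bsub>T\<^esub> w x = \<one>\<^bsub>T\<^esub>"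
proof -
  assume x: "x \<in> P"
  have [simp]: "[(x, x)] \<in> W"
    using x by (simp add: neutral_words_def)
  have "constr_ideal G P [(x, x)] = P"
    using x by (simp add: constr_ideal_eq_P_iff mem_constr_ideal_pair P.one_closed del: constr_ideal.simps)
  then have "t [(x, x)] = t []"
    by (intro t_eq) simp_all
  then show ?thesis
    using x by (simp add: w_closed)
qed

text \<open>The range projection of \<open>w x\<close> belongs to the neutral word
  \<open>[(\<one>, x), (x, \<one>)]\<close> and so commutes with \<open>t \<gamma>\<close>; this
  lets \<open>w x\<close> pass to the left.\<close>

lemma t_mult_w:
  assumes x: "x \<in> P" and \<gamma>: "\<gamma> \<in> W"
  shows "t \<gamma> \<otimes>\<^bsub>T\<^esub> w x = w x \<otimes>\<^bsub>T\<^esub> t (word_conj x \<gamma>)"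
proof -
  note [simp] = w_closed x \<gamma> P.one_closed
  let ?v = "w x" and ?v' = "cadj T (w x)"
  have conj: "t (word_conj x \<gamma>) = ?v' \<otimes>\<^bsub>T\<^esub> (t \<gamma> \<otimes>\<^bsub>T\<^esub> ?v)"
    using t_append[of "[(x, \<one>)]" "\<gamma> @ [(\<one>, x)]"] t_append[of \<gamma> "[(\<one>, x)]"] neutral_wordsD[OF \<gamma>]
    by (simp add: word_conj_def w_one)
  have range_word: "[(\<one>, x), (x, \<one>)] \<in> W"
    by (simp add: neutral_words_def)
  have range_proj: "t [(\<one>, x), (x, \<one>)] = ?v \<otimes>\<^bsub>T\<^esub> ?v'"
    by (simp add: w_one)
  have "?v \<otimes>\<^bsub>T\<^esub> ?v' \<otimes>\<^bsub>T\<^esub> t \<gamma> = t \<gamma> \<otimes>\<^bsub>T\<^esub> (?v \<otimes>\<^bsub>T\<^esub> ?v')"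
    using t_commute[OF range_word \<gamma>] unfolding range_proj .
  then have "?v \<otimes>\<^bsub>T\<^esub> t (word_conj x \<gamma>) = t \<gamma> \<otimes>\<^bsub>T\<^esub> (?v \<otimes>\<^bsub>T\<^esub> ?v') \<otimes>\<^bsub>T\<^esub> ?v"
    unfolding conj by (simp add: T.m_assoc[symmetric])
  also have "\<dots> = t \<gamma> \<otimes>\<^bsub>T\<^esub> (?v \<otimes>\<^bsub>T\<^esub> (?v' \<otimes>\<^bsub>T\<^esub> ?v))"
    by (simp add: T.m_assoc)
  finally show ?thesis
    by (simp add: isometry)
qed

lemma prod_compl_mult_w:
  assumes x: "x \<in> P" shows "set F \<subseteq> W \<Longrightarrow>
    prod_compl F \<otimes>\<^bsub>T\<^esub> w x = w x \<otimes>\<^bsub>T\<^esub> prod_compl (map (word_conj x) F)"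
proof (induction F)
  case Nil
  then show ?case using x by (simp add: w_closed)
next
  case (Cons \<gamma> F)
  note [simp] = w_closed[OF x]
  have [simp]: "\<gamma> \<in> W" "set F \<subseteq> W" "word_conj x \<gamma> \<in> W" "set (map (word_conj x) F) \<subseteq> W"
    using Cons.prems neutral_word_conj[OF x] by auto
  have "prod_compl (\<gamma> # F) \<otimes>\<^bsub>T\<^esub> w x = t\<^sup>\<bottom> \<gamma> \<otimes>\<^bsub>T\<^esub> w x \<otimes>\<^bsub>T\<^esub> prod_compl (map (word_conj x) F)"
    using Cons.IH by (simp add: T.m_assoc del: set_map)
  also have "t\<^sup>\<bottom> \<gamma> \<otimes>\<^bsub>T\<^esub> w x = w x \<otimes>\<^bsub>T\<^esub> t\<^sup>\<bottom> (word_conj x \<gamma>)"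
    by (simp add: T.minus_mult_left T.minus_mult_right t_mult_w x)
  finally show ?case
    by (simp add: T.m_assoc del: set_map)
qed

end


section \<open>The diagonal\<close>

context toeplitz_family
begin

lemma t_image: "t ` W \<subseteq> carrier T"
  by (rule image_subsetI) simp

lemma span_commute:
  assumes "\<beta> \<in> W" "y \<in> clin_span T (t ` W)"
  shows "t \<beta> \<otimes>\<^bsub>T\<^esub> y = y \<otimes>\<^bsub>T\<^esub> t \<beta>"
  using assms(2)
proof (induction rule: clin_span.induct)
  case zero
  then show ?case using assms(1) by simp
next
  case (step s v c)
  then obtain \<alpha> where \<alpha>: "\<alpha> \<in> W" "s = t \<alpha>" by blast
  have "v \<in> carrier T"
    using T.clin_span_closed[OF t_image step(2)] .
  then show ?case
    using step(3) \<alpha> assms(1) t_commute[OF assms(1) \<alpha>(1)]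
    by (simp add: T.r_distr T.l_distr T.cscale_mult_left T.cscale_mult_right)
qed

lemma atom_Nil: "atom [] [] = \<one>\<^bsub>T\<^esub>"
  by (simp add: atom_def)

text \<open>Places the products of joint properness inside the diagonal, where faithfulness applies
  to them.\<close>

lemma prod_compl_in_span: "set F \<subseteq> W \<Longrightarrow> prod_compl F \<in> clin_span T (t ` W)"
proof (induction F)
  case Nil
  have "t [] \<in> clin_span T (t ` W)"
    by (intro T.clin_span_base t_image imageI neutral_Nil)
  then show ?case by simp
next
  case (Cons \<gamma> F)
  have [simp]: "\<gamma> \<in> W"
    using Cons.prems by simp
  \<comment> \<open>The span is stable under multiplication by \<open>t \<gamma>\<close>, since
    concatenated neutral words are neutral.\<close>
  have "t \<gamma> \<otimes>\<^bsub>T\<^esub> v \<in> clin_span T (t ` W)" if "v \<in> clin_span T (t ` W)" for v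
    using that
  proof (induction rule: clin_span.induct)
    case zero
    then show ?case by (simp add: clin_span.zero)
  next
    case (step s v c)
    then obtain \<alpha> where \<alpha>: "\<alpha> \<in> W" "s = t \<alpha>" by blast
    have "t \<gamma> \<otimes>\<^bsub>T\<^esub> (cscale T c s \<oplus>\<^bsub>T\<^esub> v) = cscale T c (t (\<gamma> @ \<alpha>)) \<oplus>\<^bsub>T\<^esub> t \<gamma> \<otimes>\<^bsub>T\<^esub> v"
      using \<alpha> T.clin_span_closed[OF t_image step(2)]
      by (simp add: T.r_distr T.cscale_mult_right t_mult[symmetric])
    then show ?case
      using clin_span.step[OF _ step(3), of "t (\<gamma> @ \<alpha>)" c] \<alpha> by simp
  qed
  then have "prod_compl F \<ominus>\<^bsub>T\<^esub> t \<gamma> \<otimes>\<^bsub>T\<^esub> prod_compl F \<in> clin_span T (t ` W)"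
    using Cons by (intro T.clin_span_minus[OF t_image]) simp_all
  then show ?case
    using Cons.prems by (simp add: T.minus_mult_left)
qed

end

section \<open>Homomorphisms restricted to the diagonal\<close>

locale toeplitz_hom = toeplitz_family G P T w + star_homomorphism T B \<rho>
  for G :: "('g, 'm) monoid_scheme" (structure) and P and T :: "('a, 'n) cstar_ring_scheme"
    and w and B :: "('b, 'k) star_ring_scheme" and \<rho>
begin

definition jointly_proper_on :: bool where
  "jointly_proper_on \<longleftrightarrow>
     (\<forall>F. distinct F \<and> set F \<subseteq> W \<and> (\<forall>\<alpha>\<in>set F. constr_ideal G P \<alpha> \<noteq> P) \<longrightarrow>
        list_mult B (map (\<lambda>\<alpha>. \<one>\<^bsub>B\<^esub> \<ominus>\<^bsub>B\<^esub> \<rho> (t \<alpha>)) F) \<noteq> \<zero>\<^bsub>B\<^esub>)"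

lemma hom_prod_compl:
  "set F \<subseteq> W \<Longrightarrow> \<rho> (prod_compl F) = list_mult B (map (\<lambda>\<alpha>. \<one>\<^bsub>B\<^esub> \<ominus>\<^bsub>B\<^esub> \<rho> (t \<alpha>)) F)"
  by (induction F) (simp_all add: hom_mult hom_minus)

text \<open>
  If no ideal of \<open>F\<close> contains the point \<open>x\<close> of \<open>K(\<alpha>)\<close>, then conjugation by the isometry \<open>w x\<close>
  turns the atom into a product as in the definition of joint properness.
\<close>

lemma atom_eq_zero:
  assumes jp: jointly_proper_on and \<alpha>: "\<alpha> \<in> W" and F: "set F \<subseteq> W"
    and zero: "\<rho> (atom \<alpha> F) = \<zero>\<^bsub>B\<^esub>"
  shows "atom \<alpha> F = \<zero>\<^bsub>T\<^esub>"
proof -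
  define F' where "F' = remdups F"
  have F': "set F' = set F" "set F' \<subseteq> W" "distinct F'"
    using F by (auto simp: F'_def)
  have atom: "atom \<alpha> F = atom \<alpha> F'"
    using F by (simp add: atom_def F'_def prod_compl_remdups)
  have "constr_ideal G P \<alpha> \<subseteq> (\<Union>\<gamma>\<in>set F'. constr_ideal G P \<gamma>)"
  proof
    fix x assume x\<alpha>: "x \<in> constr_ideal G P \<alpha>"
    then have x: "x \<in> P" by (rule mem_constr_ideal_P)
    note [simp] = w_closed[OF x]
    let ?F = "map (word_conj x) F'"
    have FW: "set ?F \<subseteq> W"
      using F'(2) neutral_word_conj[OF x] by auto
    \<comment> \<open>As \<open>x\<close> lies in the right ideal \<open>K(\<alpha>)\<close>, its
      quotient by \<open>x\<close> is everything, so the factor \<open>t \<alpha>\<close> disappears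
      under compression.\<close>
    have "constr_ideal G P (word_conj x \<alpha>) = P"
      using constr_ideal_word_conj[OF x \<alpha>] constr_ideal_mult_right[OF neutral_wordsD(1)[OF \<alpha>] x\<alpha>]
      by auto
    then have "t (word_conj x \<alpha>) = \<one>\<^bsub>T\<^esub>"
      using t_eq[OF neutral_word_conj[OF x \<alpha>] neutral_Nil] by simp
    then have tw: "t \<alpha> \<otimes>\<^bsub>T\<^esub> w x = w x"
      by (simp add: t_mult_w[OF x \<alpha>])
    have "atom \<alpha> F' \<otimes>\<^bsub>T\<^esub> w x = t \<alpha> \<otimes>\<^bsub>T\<^esub> (prod_compl F' \<otimes>\<^bsub>T\<^esub> w x)"
      using \<alpha> F' by (simp add: atom_def T.m_assoc)
    also have "\<dots> = w x \<otimes>\<^bsub>T\<^esub> prod_compl ?F"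
      unfolding prod_compl_mult_w[OF x F'(2)] using \<alpha> FW tw
      by (simp add: T.m_assoc[symmetric] del: set_map)
    finally have "cadj T (w x) \<otimes>\<^bsub>T\<^esub> (atom \<alpha> F' \<otimes>\<^bsub>T\<^esub> w x) = prod_compl ?F"
      using FW by (simp add: T.m_assoc[symmetric] isometry[OF x] del: set_map)
    then have "\<rho> (prod_compl ?F) = \<rho> (cadj T (w x)) \<otimes>\<^bsub>B\<^esub> (\<rho> (atom \<alpha> F') \<otimes>\<^bsub>B\<^esub> \<rho> (w x))"
      using \<alpha> F' by (simp add: hom_mult[symmetric])
    then have "\<rho> (prod_compl ?F) = \<zero>\<^bsub>B\<^esub>"
      using zero by (simp add: atom)
    moreover have "distinct ?F"
      using F'(3) inj_word_conj[of x] by (simp add: distinct_map inj_on_def)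
    \<comment> \<open>Joint properness in contrapositive form: the product vanishes, so one of the
      quotient ideals is all of \<open>P\<close>. It contains the identity, which puts
      \<open>x\<close> into the ideal of \<open>\<gamma>\<close>.\<close>
    ultimately obtain \<delta> where \<delta>: "\<delta> \<in> set ?F" "constr_ideal G P \<delta> = P"
      using jp FW unfolding jointly_proper_on_def hom_prod_compl[OF FW] by blast
    then obtain \<gamma> where \<gamma>: "\<gamma> \<in> set F'" "\<delta> = word_conj x \<gamma>"
      by auto
    then have "\<gamma> \<in> W"
      using F' by blast
    then have "\<one> \<in> {z \<in> P. x \<otimes> z \<in> constr_ideal G P \<gamma>}"
      using constr_ideal_word_conj[OF x, of \<gamma>] \<delta>(2) \<gamma>(2) P.one_closed by simp
    then show "x \<in> (\<Union>\<gamma>\<in>set F'. constr_ideal G P \<gamma>)"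
      using \<gamma> x by auto
  qed
  then show ?thesis
    unfolding atom using \<alpha> F' by (intro atom_cover_zero)
qed

text \<open>
  If \<open>\<bar>c\<bar>\<close> were larger, then \<open>u = q - c\<^sup>-\<^sup>1xq\<close> would have norm less than \<open>1\<close>, so \<open>1 - u\<close> and its
  image \<open>1 - \<rho> q\<close> would be invertible, which is impossible for an idempotent \<open>\<rho> q \<noteq> 0\<close>.
\<close>

lemma cmod_le_norm_diff:
  assumes x: "x \<in> carrier T" "\<rho> x = \<zero>\<^bsub>B\<^esub>"
    and q: "q \<in> carrier T" "q \<otimes>\<^bsub>T\<^esub> q = q" "\<rho> q \<noteq> \<zero>\<^bsub>B\<^esub>"
  shows "cmod c \<le> cnorm T (cscale T c q \<ominus>\<^bsub>T\<^esub> x \<otimes>\<^bsub>T\<^esub> q)"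
proof (rule ccontr)
  assume "\<not> cmod c \<le> cnorm T (cscale T c q \<ominus>\<^bsub>T\<^esub> x \<otimes>\<^bsub>T\<^esub> q)"
  then have less: "cnorm T (cscale T c q \<ominus>\<^bsub>T\<^esub> x \<otimes>\<^bsub>T\<^esub> q) < cmod c" by simp
  moreover have "0 \<le> cnorm T (cscale T c q \<ominus>\<^bsub>T\<^esub> x \<otimes>\<^bsub>T\<^esub> q)"
    using x q by (intro T.norm_nonneg) simp
  ultimately have "0 < cmod c" by linarith
  then have c: "c \<noteq> 0" by simp
  define u where "u = q \<ominus>\<^bsub>T\<^esub> cscale T (inverse c) (x \<otimes>\<^bsub>T\<^esub> q)"
  have u: "u \<in> carrier T"
    using x q by (simp add: u_def)
  have "u = cscale T (inverse c) (cscale T c q) \<ominus>\<^bsub>T\<^esub> cscale T (inverse c) (x \<otimes>\<^bsub>T\<^esub> q)"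
    using c q by (simp add: u_def T.cscale_cscale T.cscale_one)
  then have "cnorm T u = cmod (inverse c) * cnorm T (cscale T c q \<ominus>\<^bsub>T\<^esub> x \<otimes>\<^bsub>T\<^esub> q)"
    using x q by (simp add: T.norm_cscale_diff)
  also have "\<dots> < cmod (inverse c) * cmod c"
    using c less by (intro mult_strict_left_mono) simp_all
  also have "\<dots> = 1"
    using c by (simp add: norm_mult[symmetric])
  finally obtain v where v: "v \<in> carrier T" "(\<one>\<^bsub>T\<^esub> \<ominus>\<^bsub>T\<^esub> u) \<otimes>\<^bsub>T\<^esub> v = \<one>\<^bsub>T\<^esub>"
    using T.neumann_series[OF u] by blast
  have "\<rho> (cscale T (inverse c) (x \<otimes>\<^bsub>T\<^esub> q)) = \<rho> x \<otimes>\<^bsub>B\<^esub> \<rho> (cscale T (inverse c) q)"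
    using x q by (simp add: T.cscale_mult_right[symmetric] hom_mult)
  then have "\<rho> u = \<rho> q"
    using x q by (simp add: u_def hom_minus) (simp add: a_minus_def)
  then have "(\<one>\<^bsub>B\<^esub> \<ominus>\<^bsub>B\<^esub> \<rho> q) \<otimes>\<^bsub>B\<^esub> \<rho> v = \<one>\<^bsub>B\<^esub>"
    using arg_cong[OF v(2), of \<rho>] u v(1) by (simp add: hom_mult hom_minus)
  \<comment> \<open>Multiplying on the left by the idempotent \<open>\<rho> q\<close> annihilates
    \<open>1 - \<rho> q\<close>.\<close>
  then have "\<rho> q = \<rho> q \<otimes>\<^bsub>B\<^esub> ((\<one>\<^bsub>B\<^esub> \<ominus>\<^bsub>B\<^esub> \<rho> q) \<otimes>\<^bsub>B\<^esub> \<rho> v)"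
    using q by simp
  also have "\<dots> = (\<rho> q \<otimes>\<^bsub>B\<^esub> (\<one>\<^bsub>B\<^esub> \<ominus>\<^bsub>B\<^esub> \<rho> q)) \<otimes>\<^bsub>B\<^esub> \<rho> v"
    using q v by (simp add: B.m_assoc)
  also have "\<dots> = \<zero>\<^bsub>B\<^esub>"
    using q v by (simp add: B.minus_mult_right hom_mult[symmetric])
  finally show False
    using q(3) by simp
qed

text \<open>The scalar \<open>c\<close> and the atom vary so that the induction can absorb a term
  \<open>d t(\<beta>)\<close>: below \<open>t \<beta>\<close> it adds \<open>d\<close> to the
  scalar, and on the complementary part it vanishes. Both branches carry the same
  \<open>\<epsilon>\<close>, because \<open>norm_le_projection\<close> takes their maximum.\<close>

lemma norm_span_le:
  assumes jp: jointly_proper_on and x: "x \<in> carrier T" "\<rho> x = \<zero>\<^bsub>B\<^esub>"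
  shows "y \<in> clin_span T (t ` W) \<Longrightarrow> \<alpha> \<in> W \<Longrightarrow> set F \<subseteq> W \<Longrightarrow>
    cnorm T ((cscale T c \<one>\<^bsub>T\<^esub> \<oplus>\<^bsub>T\<^esub> y) \<otimes>\<^bsub>T\<^esub> atom \<alpha> F \<ominus>\<^bsub>T\<^esub> x \<otimes>\<^bsub>T\<^esub> atom \<alpha> F) \<le> \<epsilon> \<Longrightarrow>
    cnorm T ((cscale T c \<one>\<^bsub>T\<^esub> \<oplus>\<^bsub>T\<^esub> y) \<otimes>\<^bsub>T\<^esub> atom \<alpha> F) \<le> \<epsilon>"
proof (induction arbitrary: c \<alpha> F rule: clin_span.induct)
  case zero
  let ?q = "atom \<alpha> F"
  note q [simp] = atom_closed[OF zero(1,2)]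
  have eq: "(cscale T c \<one>\<^bsub>T\<^esub> \<oplus>\<^bsub>T\<^esub> \<zero>\<^bsub>T\<^esub>) \<otimes>\<^bsub>T\<^esub> ?q = cscale T c ?q"
    by (simp add: T.cscale_mult_left)
  show ?case
  proof (cases "?q = \<zero>\<^bsub>T\<^esub>")
    case True
    then show ?thesis
      using zero(3) x by simp
  next
    case False
    \<comment> \<open>A nonzero atom has nonzero image by \<open>atom_eq_zero\<close>, so the bound
      on the scalar applies.\<close>
    then have "cmod c \<le> cnorm T (cscale T c ?q \<ominus>\<^bsub>T\<^esub> x \<otimes>\<^bsub>T\<^esub> ?q)"
      using atom_eq_zero[OF jp zero(1,2)] x atom_idem[OF zero(1,2)]
      by (intro cmod_le_norm_diff) auto
    moreover have "cmod c * cnorm T ?q \<le> cmod c * 1"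
      by (intro mult_left_mono norm_atom_le zero) simp
    ultimately show ?thesis
      using zero(3) unfolding eq by (simp add: T.norm_cscale)
  qed
next
  case (step s y d)
  obtain \<beta> where \<beta> [simp]: "\<beta> \<in> W" and s: "s = t \<beta>"
    using step(1) by blast
  let ?q = "atom \<alpha> F"
  note [simp] = step.prems(1,2) x(1)
  have y [simp]: "y \<in> carrier T"
    using T.clin_span_closed[OF t_image step(2)] .
  define Y where "Y = cscale T c \<one>\<^bsub>T\<^esub> \<oplus>\<^bsub>T\<^esub> (cscale T d s \<oplus>\<^bsub>T\<^esub> y)"
  have Y [simp]: "Y \<in> carrier T"
    by (simp add: Y_def s)
  have tY: "t \<beta> \<otimes>\<^bsub>T\<^esub> Y = Y \<otimes>\<^bsub>T\<^esub> t \<beta>"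
    using span_commute[OF \<beta> step(2)]
    by (simp add: Y_def s T.r_distr T.l_distr T.cscale_mult_left T.cscale_mult_right)
  have Y_mult: "Y \<otimes>\<^bsub>T\<^esub> r = cscale T c r \<oplus>\<^bsub>T\<^esub> (cscale T d (t \<beta> \<otimes>\<^bsub>T\<^esub> r) \<oplus>\<^bsub>T\<^esub> y \<otimes>\<^bsub>T\<^esub> r)"
    if "r \<in> carrier T" for r
    using that by (simp add: Y_def s T.l_distr T.cscale_mult_left)
  \<comment> \<open>Cutting by a contraction \<open>e\<close> does not enlarge the distance;
    \<open>e\<close> will be \<open>t \<beta>\<close> and its complement.\<close>
  have diff: "cnorm T (Y \<otimes>\<^bsub>T\<^esub> (?q \<otimes>\<^bsub>T\<^esub> e) \<ominus>\<^bsub>T\<^esub> x \<otimes>\<^bsub>T\<^esub> (?q \<otimes>\<^bsub>T\<^esub> e)) \<le> \<epsilon>"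
    if e: "e \<in> carrier T" "cnorm T e \<le> 1" for e
  proof -
    have "Y \<otimes>\<^bsub>T\<^esub> (?q \<otimes>\<^bsub>T\<^esub> e) \<ominus>\<^bsub>T\<^esub> x \<otimes>\<^bsub>T\<^esub> (?q \<otimes>\<^bsub>T\<^esub> e) = (Y \<otimes>\<^bsub>T\<^esub> ?q \<ominus>\<^bsub>T\<^esub> x \<otimes>\<^bsub>T\<^esub> ?q) \<otimes>\<^bsub>T\<^esub> e"
      using e by (simp add: T.minus_mult_left T.m_assoc)
    then have "cnorm T (Y \<otimes>\<^bsub>T\<^esub> (?q \<otimes>\<^bsub>T\<^esub> e) \<ominus>\<^bsub>T\<^esub> x \<otimes>\<^bsub>T\<^esub> (?q \<otimes>\<^bsub>T\<^esub> e)) \<le>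
        cnorm T (Y \<otimes>\<^bsub>T\<^esub> ?q \<ominus>\<^bsub>T\<^esub> x \<otimes>\<^bsub>T\<^esub> ?q) * cnorm T e"
      using e T.norm_mult[of "Y \<otimes>\<^bsub>T\<^esub> ?q \<ominus>\<^bsub>T\<^esub> x \<otimes>\<^bsub>T\<^esub> ?q" e] by simp
    also have "\<dots> \<le> cnorm T (Y \<otimes>\<^bsub>T\<^esub> ?q \<ominus>\<^bsub>T\<^esub> x \<otimes>\<^bsub>T\<^esub> ?q) * 1"
      using e by (intro mult_left_mono) simp_all
    also have "\<dots> \<le> \<epsilon>"
      using step.prems(3) by (simp add: Y_def)
    finally show ?thesis .
  qed
  \<comment> \<open>Below \<open>t \<beta>\<close> the term \<open>d t(\<beta>)\<close> acts as
    \<open>d\<close>, whence the new scalar \<open>c + d\<close>.\<close>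
  have in_corner: "cnorm T (Y \<otimes>\<^bsub>T\<^esub> ?q \<otimes>\<^bsub>T\<^esub> t \<beta>) \<le> \<epsilon>"
  proof -
    have q': "?q \<otimes>\<^bsub>T\<^esub> t \<beta> = atom (\<alpha> @ \<beta>) F"
      by (simp add: atom_mult_t)
    have "t \<beta> \<otimes>\<^bsub>T\<^esub> (?q \<otimes>\<^bsub>T\<^esub> t \<beta>) = ?q \<otimes>\<^bsub>T\<^esub> t \<beta>"
      by (simp add: T.m_assoc[symmetric] atom_commute) (simp add: T.m_assoc t_idem)
    then have "Y \<otimes>\<^bsub>T\<^esub> (?q \<otimes>\<^bsub>T\<^esub> t \<beta>) =
        (cscale T (c + d) \<one>\<^bsub>T\<^esub> \<oplus>\<^bsub>T\<^esub> y) \<otimes>\<^bsub>T\<^esub> (?q \<otimes>\<^bsub>T\<^esub> t \<beta>)"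
      by (simp add: Y_mult T.l_distr T.cscale_mult_left T.cscale_add_left T.a_assoc)
    then show ?thesis
      using step.IH[of "\<alpha> @ \<beta>" F "c + d"] diff[of "t \<beta>"] norm_t_le[OF \<beta>]
      by (simp add: T.m_assoc q')
  qed
  \<comment> \<open>Here the term is annihilated and \<open>c\<close> stays, while
    \<open>\<beta>\<close> joins the removed words.\<close>
  have off_corner: "cnorm T (Y \<otimes>\<^bsub>T\<^esub> ?q \<otimes>\<^bsub>T\<^esub> t\<^sup>\<bottom> \<beta>) \<le> \<epsilon>"
  proof -
    have q': "?q \<otimes>\<^bsub>T\<^esub> t\<^sup>\<bottom> \<beta> = atom \<alpha> (\<beta> # F)"
      by (rule atom_mult_compl) simp_all
    have "t \<beta> \<otimes>\<^bsub>T\<^esub> t\<^sup>\<bottom> \<beta> = \<zero>\<^bsub>T\<^esub>"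
      by (simp add: T.minus_mult_right t_idem)
    then have "t \<beta> \<otimes>\<^bsub>T\<^esub> (?q \<otimes>\<^bsub>T\<^esub> t\<^sup>\<bottom> \<beta>) = \<zero>\<^bsub>T\<^esub>"
      by (simp add: T.m_assoc[symmetric] atom_commute) (simp add: T.m_assoc)
    then have "Y \<otimes>\<^bsub>T\<^esub> (?q \<otimes>\<^bsub>T\<^esub> t\<^sup>\<bottom> \<beta>) = (cscale T c \<one>\<^bsub>T\<^esub> \<oplus>\<^bsub>T\<^esub> y) \<otimes>\<^bsub>T\<^esub> (?q \<otimes>\<^bsub>T\<^esub> t\<^sup>\<bottom> \<beta>)"
      by (simp add: Y_mult T.l_distr T.cscale_mult_left)
    then show ?thesis
      using step.IH[of \<alpha> "\<beta> # F" c] diff[of "t\<^sup>\<bottom> \<beta>"] norm_compl_le[OF \<beta>]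
      by (simp add: T.m_assoc q')
  qed
  have comm: "t \<beta> \<otimes>\<^bsub>T\<^esub> (Y \<otimes>\<^bsub>T\<^esub> ?q) = Y \<otimes>\<^bsub>T\<^esub> ?q \<otimes>\<^bsub>T\<^esub> t \<beta>"
    by (simp add: T.m_assoc[symmetric] tY) (simp add: T.m_assoc atom_commute)
  have "cnorm T (Y \<otimes>\<^bsub>T\<^esub> ?q) \<le> \<epsilon>"
    by (rule T.norm_le_projection[OF _ _ _ _ comm in_corner off_corner]) (simp_all add: t_adj t_idem)
  then show ?case
    by (simp add: Y_def)
qed

lemma diagonal_kernel_zero:
  assumes jp: jointly_proper_on
    and x: "x \<in> cnorm_closure T (clin_span T (t ` W))" "\<rho> x = \<zero>\<^bsub>B\<^esub>"
  shows "x = \<zero>\<^bsub>T\<^esub>"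
proof -
  have xT: "x \<in> carrier T"
    using x by (simp add: cnorm_closure_def)
  have "cnorm T x \<le> 0 + \<epsilon>" if "0 < \<epsilon>" for \<epsilon>
  proof -
    \<comment> \<open>One half for the distance from \<open>x\<close> to \<open>s\<close>, the other
      for the norm of \<open>s\<close>, which that distance bounds as well.\<close>
    have "0 < \<epsilon> / 2" using that by simp
    then obtain s where s: "s \<in> clin_span T (t ` W)" "cnorm T (x \<ominus>\<^bsub>T\<^esub> s) < \<epsilon> / 2"
      using x unfolding cnorm_closure_def by blast
    have sT: "s \<in> carrier T"
      using T.clin_span_closed[OF t_image s(1)] .
    have "cnorm T (s \<ominus>\<^bsub>T\<^esub> x) \<le> \<epsilon> / 2"
      using s(2) T.norm_minus_commute[OF xT sT] by simp
    \<comment> \<open>The induction starts from the scalar 0 and the trivial atom, which is 1; its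
      hypothesis is then the approximation itself.\<close>
    then have "cnorm T s \<le> \<epsilon> / 2"
      using norm_span_le[OF jp xT x(2) s(1), of "[]" "[]" 0 "\<epsilon> / 2"] sT xT
      by (simp add: atom_Nil)
    then show ?thesis
      using T.norm_le_minus[OF xT sT] s(2) by simp
  qed
  then have "cnorm T x \<le> 0"
    by (rule field_le_epsilon)
  then show ?thesis
    using xT T.norm_nonneg[OF xT] by (intro T.cnorm_eq_zero) simp_all
qed

theorem inj_on_diagonal:
  assumes jp: jointly_proper_on
  shows "inj_on \<rho> (cnorm_closure T (clin_span T (t ` W)))"
proof (rule inj_onI)
  let ?D = "cnorm_closure T (clin_span T (t ` W))"
  fix x y assume xy: "x \<in> ?D" "y \<in> ?D" "\<rho> x = \<rho> y"
  then have [simp]: "x \<in> carrier T" "y \<in> carrier T"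
    by (simp_all add: cnorm_closure_def)
  \<comment> \<open>Passing from injectivity to the kernel requires that the closed span contain
    differences.\<close>
  have "\<exists>s\<in>clin_span T (t ` W). cnorm T (x \<ominus>\<^bsub>T\<^esub> y \<ominus>\<^bsub>T\<^esub> s) < \<epsilon>" if "0 < \<epsilon>" for \<epsilon>
  proof -
    have "0 < \<epsilon> / 2" using that by simp
    then obtain a b where ab: "a \<in> clin_span T (t ` W)" "cnorm T (x \<ominus>\<^bsub>T\<^esub> a) < \<epsilon> / 2"
      "b \<in> clin_span T (t ` W)" "cnorm T (y \<ominus>\<^bsub>T\<^esub> b) < \<epsilon> / 2"
      using xy unfolding cnorm_closure_def by blast
    have [simp]: "a \<in> carrier T" "b \<in> carrier T"
      using ab T.clin_span_closed[OF t_image] by blast+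
    have "x \<ominus>\<^bsub>T\<^esub> y \<ominus>\<^bsub>T\<^esub> (a \<ominus>\<^bsub>T\<^esub> b) = (x \<ominus>\<^bsub>T\<^esub> a) \<ominus>\<^bsub>T\<^esub> (y \<ominus>\<^bsub>T\<^esub> b)"
      by (simp add: a_minus_def T.minus_add T.a_ac)
    then have "cnorm T (x \<ominus>\<^bsub>T\<^esub> y \<ominus>\<^bsub>T\<^esub> (a \<ominus>\<^bsub>T\<^esub> b)) < \<epsilon>"
      using ab T.norm_minus_le[of "x \<ominus>\<^bsub>T\<^esub> a" "y \<ominus>\<^bsub>T\<^esub> b"] by simp
    then show ?thesis
      using T.clin_span_minus[OF t_image ab(1,3)] by blast
  qed
  then have "x \<ominus>\<^bsub>T\<^esub> y \<in> ?D"
    by (simp add: cnorm_closure_def)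
  then have "x \<ominus>\<^bsub>T\<^esub> y = \<zero>\<^bsub>T\<^esub>"
    using xy by (intro diagonal_kernel_zero[OF jp]) (simp_all add: hom_minus)
  then show "x = y"
    by (simp add: T.minus_eq_zero_iff)
qed

text \<open>Nonvanishing in \<open>T\<close> is assumed, as it may fail for a family: all relations
  hold in the zero algebra. For the universal family the regular representation provides it.\<close>

theorem jointly_proper_of_inj_on:
  assumes inj: "inj_on \<rho> (cnorm_closure T (clin_span T (t ` W)))"
    and nonzero: "\<And>F. set F \<subseteq> W \<Longrightarrow> \<forall>\<alpha>\<in>set F. constr_ideal G P \<alpha> \<noteq> P \<Longrightarrow> prod_compl F \<noteq> \<zero>\<^bsub>T\<^esub>"
  shows jointly_proper_on
  unfolding jointly_proper_on_def
proof (intro allI impI notI)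
  fix F assume F: "distinct F \<and> set F \<subseteq> W \<and> (\<forall>\<alpha>\<in>set F. constr_ideal G P \<alpha> \<noteq> P)"
    and zero: "list_mult B (map (\<lambda>\<alpha>. \<one>\<^bsub>B\<^esub> \<ominus>\<^bsub>B\<^esub> \<rho> (t \<alpha>)) F) = \<zero>\<^bsub>B\<^esub>"
  have sub: "v \<in> cnorm_closure T (clin_span T (t ` W))" if "v \<in> clin_span T (t ` W)" for v
  proof -
    have "v \<in> carrier T"
      using T.clin_span_closed[OF t_image that] .
    then show ?thesis
      using that by (auto simp: cnorm_closure_def intro!: bexI[of _ v])
  qed
  have "\<rho> (prod_compl F) = \<rho> \<zero>\<^bsub>T\<^esub>"
    using F zero by (simp add: hom_prod_compl)
  then have "prod_compl F = \<zero>\<^bsub>T\<^esub>"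
    using F by (intro inj_onD[OF inj] sub prod_compl_in_span clin_span.zero) simp_all
  then show False
    using nonzero F by blast
qed

end


section \<open>Operator seminorms\<close>

text \<open>Models the length of \<open>f v\<close> for a fixed vector \<open>v\<close> of a
  representation. No inner product is recorded: \<open>s_adj\<close> keeps what Cauchy-Schwarz says
  about \<open><f g v, f g v> = <g v, f^* f g v>\<close>, and this is enough for the
  C*-identity.\<close>

locale left_seminorm = unital_star_algebra A for A (structure) +
  fixes s :: "'a \<Rightarrow> real"
  assumes s_nonneg: "g \<in> carrier A \<Longrightarrow> 0 \<le> s g"
    and s_add: "f \<in> carrier A \<Longrightarrow> g \<in> carrier A \<Longrightarrow> s (f \<oplus> g) \<le> s f + s g"
    and s_cscale: "g \<in> carrier A \<Longrightarrow> s (cscale A c g) = cmod c * s g"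
    and s_adj: "f \<in> carrier A \<Longrightarrow> g \<in> carrier A \<Longrightarrow> (s (f \<otimes> g))\<^sup>2 \<le> s g * s (cadj A f \<otimes> (f \<otimes> g))"
    and s_bounded: "f \<in> carrier A \<Longrightarrow> \<exists>C. \<forall>g\<in>carrier A. s (f \<otimes> g) \<le> C * s g"
begin

definition operator_seminorm :: "'a \<Rightarrow> real" where
  "operator_seminorm f = (SUP g\<in>{g \<in> carrier A. s g \<le> 1}. s (f \<otimes> g))"

lemma s_zero: "s \<zero> = 0"
  using s_cscale[of \<zero> 0] by simp

lemma operator_seminorm_upper:
  assumes f: "f \<in> carrier A" and g: "g \<in> carrier A" "s g \<le> 1"
  shows "s (f \<otimes> g) \<le> operator_seminorm f"
proof -
  obtain C where C: "\<forall>g\<in>carrier A. s (f \<otimes> g) \<le> C * s g"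
    using s_bounded[OF f] by blast
  have "s (f \<otimes> x) \<le> \<bar>C\<bar>" if x: "x \<in> carrier A" "s x \<le> 1" for x
  proof -
    have "s (f \<otimes> x) \<le> C * s x"
      using C x by blast
    also have "\<dots> \<le> \<bar>C\<bar> * 1"
      using x s_nonneg[OF x(1)] by (intro mult_mono) simp_all
    finally show ?thesis by simp
  qed
  then have "bdd_above ((\<lambda>g. s (f \<otimes> g)) ` {g \<in> carrier A. s g \<le> 1})"
    by (intro bdd_aboveI2[where M = "\<bar>C\<bar>"]) simp
  then show ?thesis
    unfolding operator_seminorm_def using g by (intro cSUP_upper) simp_all
qed

lemma operator_seminorm_least:
  assumes "\<And>g. g \<in> carrier A \<Longrightarrow> s g \<le> 1 \<Longrightarrow> s (f \<otimes> g) \<le> C"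
  shows "operator_seminorm f \<le> C"
proof -
  have "\<zero> \<in> {g \<in> carrier A. s g \<le> 1}"
    by (simp add: s_zero)
  then show ?thesis
    unfolding operator_seminorm_def using assms by (intro cSUP_least) auto
qed

lemma operator_seminorm_nonneg: "f \<in> carrier A \<Longrightarrow> 0 \<le> operator_seminorm f"
  using operator_seminorm_upper[of f \<zero>] by (simp add: s_zero)

lemma operator_seminorm_mult_le:
  assumes f: "f \<in> carrier A" and g: "g \<in> carrier A"
  shows "s (f \<otimes> g) \<le> operator_seminorm f * s g"
proof (cases "s g = 0")
  case True
  \<comment> \<open>A null element cannot be normalised, but boundedness sends it to a null
    element.\<close>
  obtain C where "s (f \<otimes> g) \<le> C * s g"
    using s_bounded[OF f] g by blast
  with True show ?thesis by simp
next
  case False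
  then have pos: "0 < s g"
    using s_nonneg[OF g] by simp
  let ?c = "complex_of_real (inverse (s g))"
  have c: "cmod ?c = inverse (s g)"
    using pos by (simp del: of_real_inverse)
  have "s (f \<otimes> cscale A ?c g) \<le> operator_seminorm f"
    using pos g c by (intro operator_seminorm_upper f) (simp_all add: s_cscale del: of_real_inverse)
  then have "inverse (s g) * s (f \<otimes> g) \<le> operator_seminorm f"
    using f g c by (simp add: cscale_mult_right s_cscale del: of_real_inverse)
  then show ?thesis
    using pos by (simp add: field_simps)
qed

lemma cstar_seminorm_operator_seminorm: "cstar_seminorm A operator_seminorm"
proof -
  let ?N = operator_seminorm
  have add: "?N (f \<oplus> g) \<le> ?N f + ?N g" if fg: "f \<in> carrier A" "g \<in> carrier A" for f g
  proof (rule operator_seminorm_least)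
    fix x assume x: "x \<in> carrier A" "s x \<le> 1"
    have "s ((f \<oplus> g) \<otimes> x) \<le> s (f \<otimes> x) + s (g \<otimes> x)"
      using fg x s_add[of "f \<otimes> x" "g \<otimes> x"] by (simp add: l_distr)
    then show "s ((f \<oplus> g) \<otimes> x) \<le> ?N f + ?N g"
      using operator_seminorm_upper[OF fg(1) x] operator_seminorm_upper[OF fg(2) x] by simp
  qed
  have scale_le: "?N (cscale A c f) \<le> cmod c * ?N f" if f: "f \<in> carrier A" for c f
  proof (rule operator_seminorm_least)
    fix x assume x: "x \<in> carrier A" "s x \<le> 1"
    show "s (cscale A c f \<otimes> x) \<le> cmod c * ?N f"
      using mult_left_mono[OF operator_seminorm_upper[OF f x], of "cmod c"] f x
      by (simp add: cscale_mult_left s_cscale)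
  qed
  have scale: "?N (cscale A c f) = cmod c * ?N f" if f: "f \<in> carrier A" for c f
  proof (cases "c = 0")
    case True
    then show ?thesis
      using scale_le[OF f, of 0] operator_seminorm_nonneg[OF zero_closed] f by simp
  next
    case False
    have "?N f = ?N (cscale A (inverse c) (cscale A c f))"
      using False f by (simp add: cscale_cscale cscale_one)
    also have "\<dots> \<le> cmod (inverse c) * ?N (cscale A c f)"
      using f by (intro scale_le) simp
    finally have "cmod c * ?N f \<le> cmod c * (cmod (inverse c) * ?N (cscale A c f))"
      by (rule mult_left_mono) simp
    also have "\<dots> = ?N (cscale A c f)"
      using False by (simp add: norm_inverse mult.assoc[symmetric])
    finally show ?thesis
      using scale_le[OF f, of c] by simp
  qed
  have mult: "?N (f \<otimes> g) \<le> ?N f * ?N g" if fg: "f \<in> carrier A" "g \<in> carrier A" for f g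
  proof (rule operator_seminorm_least)
    fix x assume x: "x \<in> carrier A" "s x \<le> 1"
    have "s (f \<otimes> (g \<otimes> x)) \<le> ?N f * s (g \<otimes> x)"
      using fg x by (intro operator_seminorm_mult_le) simp_all
    also have "\<dots> \<le> ?N f * ?N g"
      by (intro mult_left_mono operator_seminorm_upper operator_seminorm_nonneg fg x)
    finally show "s (f \<otimes> g \<otimes> x) \<le> ?N f * ?N g"
      using fg x by (simp add: m_assoc)
  qed
  \<comment> \<open>\<open>s_adj\<close> yields only this half of the C*-identity. It forces the
    star to be isometric, and submultiplicativity then gives the other half.\<close>
  have star_ge: "(?N f)\<^sup>2 \<le> ?N (cadj A f \<otimes> f)" if f: "f \<in> carrier A" for f
  proof -
    have f': "cadj A f \<otimes> f \<in> carrier A"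
      using f by simp
    have "?N f \<le> sqrt (?N (cadj A f \<otimes> f))"
    proof (rule operator_seminorm_least)
      fix x assume x: "x \<in> carrier A" "s x \<le> 1"
      have "(s (f \<otimes> x))\<^sup>2 \<le> s x * s (cadj A f \<otimes> f \<otimes> x)"
        using s_adj[OF f x(1)] f x by (simp add: m_assoc)
      also have "\<dots> \<le> 1 * ?N (cadj A f \<otimes> f)"
        using x f' operator_seminorm_upper[OF f' x]
        by (intro mult_mono) (simp_all add: s_nonneg f)
      finally show "s (f \<otimes> x) \<le> sqrt (?N (cadj A f \<otimes> f))"
        by (intro real_le_rsqrt) simp
    qed
    then have "(?N f)\<^sup>2 \<le> (sqrt (?N (cadj A f \<otimes> f)))\<^sup>2"
      by (intro power_mono operator_seminorm_nonneg f)
    then show ?thesis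
      using operator_seminorm_nonneg[OF f'] by simp
  qed
  have adj_le: "?N f \<le> ?N (cadj A f)" if f: "f \<in> carrier A" for f
  proof (cases "?N f = 0")
    case True
    then show ?thesis
      using f by (simp add: operator_seminorm_nonneg)
  next
    case False
    then have "0 < ?N f"
      using operator_seminorm_nonneg[OF f] by simp
    moreover have "?N f * ?N f \<le> ?N (cadj A f) * ?N f"
      using star_ge[OF f] mult[OF _ f, of "cadj A f"] f by (simp add: power2_eq_square)
    ultimately show ?thesis by simp
  qed
  have star: "?N (cadj A f \<otimes> f) = (?N f)\<^sup>2" if f: "f \<in> carrier A" for f
  proof (rule antisym)
    have "?N (cadj A f) \<le> ?N f"
      using adj_le[of "cadj A f"] f by (simp add: cadj_cadj)
    then show "?N (cadj A f \<otimes> f) \<le> (?N f)\<^sup>2"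
      using mult[of "cadj A f" f] f mult_right_mono[OF _ operator_seminorm_nonneg[OF f], of "?N (cadj A f)" "?N f"]
      by (simp add: power2_eq_square)
  qed (rule star_ge[OF f])
  show ?thesis
    unfolding cstar_seminorm_def
    by (intro conjI ballI allI operator_seminorm_nonneg add scale mult star)
qed

end

section \<open>Linear functionals on the free algebra, given by their values on words\<close>

definition word_sum :: "('x letter list \<Rightarrow> complex) \<Rightarrow> ('x letter list \<Rightarrow> complex) \<Rightarrow> complex" where
  "word_sum c f = (\<Sum>w | f w \<noteq> 0. f w * c w)"

lemma word_sum_superset:
  assumes "finite S" "{w. f w \<noteq> 0} \<subseteq> S" shows "word_sum c f = (\<Sum>w\<in>S. f w * c w)"
  unfolding word_sum_def by (rule sum.mono_neutral_left) (use assms in auto)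

lemma word_sum_zero: "word_sum c \<zero>\<^bsub>free_star_algebra X\<^esub> = 0"
  by (simp add: word_sum_def free_zero)

lemma word_sum_add:
  assumes "f \<in> carrier (free_star_algebra X)" "g \<in> carrier (free_star_algebra X)"
  shows "word_sum c (f \<oplus>\<^bsub>free_star_algebra X\<^esub> g) = word_sum c f + word_sum c g"
proof -
  let ?S = "{w. f w \<noteq> 0} \<union> {w. g w \<noteq> 0}"
  have S: "finite ?S"
    using assms by (simp add: carrier_free_iff)
  have "word_sum c (\<lambda>w. f w + g w) = (\<Sum>w\<in>?S. (f w + g w) * c w)"
    by (rule word_sum_superset[OF S]) auto
  also have "\<dots> = (\<Sum>w\<in>?S. f w * c w) + (\<Sum>w\<in>?S. g w * c w)"
    by (simp add: distrib_right sum.distrib)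
  also have "\<dots> = word_sum c f + word_sum c g"
    using word_sum_superset[OF S, of f c] word_sum_superset[OF S, of g c] by simp
  finally show ?thesis
    by (simp add: free_add)
qed

lemma word_sum_cscale:
  assumes "f \<in> carrier (free_star_algebra X)"
  shows "word_sum c (cscale (free_star_algebra X) a f) = a * word_sum c f"
proof -
  have S: "finite {w. f w \<noteq> 0}"
    using assms by (simp add: carrier_free_iff)
  have "word_sum c (\<lambda>w. a * f w) = (\<Sum>w | f w \<noteq> 0. a * f w * c w)"
    by (rule word_sum_superset[OF S]) auto
  then show ?thesis
    by (simp add: free_cscale word_sum_def sum_distrib_left mult.assoc)
qed

lemma word_sum_word_basis: "word_sum c (word_basis w) = c w"
  using word_sum_superset[of "{w}" "word_basis w" c] by (simp add: word_basis_def)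

lemma word_sum_cong: "(\<And>w. f w \<noteq> 0 \<Longrightarrow> c w = d w) \<Longrightarrow> word_sum c f = word_sum d f"
  unfolding word_sum_def by (rule sum.cong) auto

lemma word_sum_linear:
  "word_sum (\<lambda>w. a * c w + d w) f = a * word_sum c f + word_sum d f"
  by (simp add: word_sum_def sum_distrib_left sum.distrib algebra_simps)

lemma word_sum_mult_basis:
  assumes u: "set u \<subseteq> letters X" and g: "g \<in> carrier (free_star_algebra X)"
  shows "word_sum c (word_basis u \<otimes>\<^bsub>free_star_algebra X\<^esub> g) = word_sum (\<lambda>v. c (u @ v)) g"
  using g
proof (induction rule: free_star_induct)
  case zero
  interpret F: unital_star_algebra "free_star_algebra X"
    by (rule unital_star_algebra_free)
  show ?case
    using u by (simp add: word_sum_zero word_basis_closed)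
next
  case (add a v g)
  interpret F: unital_star_algebra "free_star_algebra X"
    by (rule unital_star_algebra_free)
  have "word_basis u \<otimes>\<^bsub>free_star_algebra X\<^esub>
      (cscale (free_star_algebra X) a (word_basis v) \<oplus>\<^bsub>free_star_algebra X\<^esub> g) =
    cscale (free_star_algebra X) a (word_basis (u @ v)) \<oplus>\<^bsub>free_star_algebra X\<^esub>
      word_basis u \<otimes>\<^bsub>free_star_algebra X\<^esub> g"
    using add u by (simp add: F.r_distr F.cscale_mult_right word_basis_mult word_basis_closed)
  then show ?case
    using add u by (simp add: word_sum_add word_sum_cscale word_sum_word_basis word_basis_closed)
qed

lemma word_sum_mult:
  assumes f: "f \<in> carrier (free_star_algebra X)" and g: "g \<in> carrier (free_star_algebra X)"
  shows "word_sum c (f \<otimes>\<^bsub>free_star_algebra X\<^esub> g) = word_sum (\<lambda>u. word_sum (\<lambda>v. c (u @ v)) g) f"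
  using f
proof (induction rule: free_star_induct)
  case zero
  interpret F: unital_star_algebra "free_star_algebra X"
    by (rule unital_star_algebra_free)
  show ?case
    using g by (simp add: word_sum_zero)
next
  case (add a u f)
  interpret F: unital_star_algebra "free_star_algebra X"
    by (rule unital_star_algebra_free)
  have "(cscale (free_star_algebra X) a (word_basis u) \<oplus>\<^bsub>free_star_algebra X\<^esub> f) \<otimes>\<^bsub>free_star_algebra X\<^esub> g =
    cscale (free_star_algebra X) a (word_basis u \<otimes>\<^bsub>free_star_algebra X\<^esub> g) \<oplus>\<^bsub>free_star_algebra X\<^esub>
      f \<otimes>\<^bsub>free_star_algebra X\<^esub> g"
    using add g by (simp add: F.l_distr F.cscale_mult_left word_basis_closed)
  then show ?case
    using add g
    by (simp add: word_sum_add word_sum_cscale word_sum_word_basis word_sum_mult_basis word_basis_closed)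
qed

lemma word_sum_cadj:
  "word_sum c (cadj (free_star_algebra X) f) = cnj (word_sum (\<lambda>w. cnj (c (star_word w))) f)"
proof -
  have "word_sum c (\<lambda>w. cnj (f (star_word w))) = (\<Sum>w | f w \<noteq> 0. cnj (f w) * c (star_word w))"
    unfolding word_sum_def
    by (rule sum.reindex_bij_witness[of _ star_word star_word]) auto
  then show ?thesis
    by (simp add: free_cadj word_sum_def cnj_sum)
qed


section \<open>The left regular representation\<close>

context submonoid_of_group
begin

abbreviation "F \<equiv> free_star_algebra P"

sublocale F: unital_star_algebra F
  by (rule unital_star_algebra_free)

text \<open>The image of a basis vector; \<open>None\<close> stands for the zero vector.\<close>

fun act_letter :: "'a letter \<Rightarrow> 'a \<Rightarrow> 'a option" where
  "act_letter (Gen p) x = Some (p \<otimes> x)"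
| "act_letter (Adj p) x = (if inv p \<otimes> x \<in> P then Some (inv p \<otimes> x) else None)"

fun act_word :: "'a letter list \<Rightarrow> 'a \<Rightarrow> 'a option" where
  "act_word [] x = Some x"
| "act_word (l # w) x = Option.bind (act_word w x) (act_letter l)"

lemma act_word_append: "act_word (u @ v) x = Option.bind (act_word v x) (act_word u)"
proof (induction u)
  case Nil
  then show ?case by (cases "act_word v x") simp_all
next
  case (Cons l u)
  then show ?case by (cases "act_word v x") simp_all
qed

lemma act_letter_closed:
  "l \<in> letters P \<Longrightarrow> x \<in> P \<Longrightarrow> act_letter l x = Some y \<Longrightarrow> y \<in> P"
  by (cases l) (auto simp: letters_def P.m_closed split: if_splits)

lemma act_word_closed:
  "set w \<subseteq> letters P \<Longrightarrow> x \<in> P \<Longrightarrow> act_word w x = Some y \<Longrightarrow> y \<in> P"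
proof (induction w arbitrary: y)
  case (Cons l w)
  then obtain z where z: "act_word w x = Some z" "act_letter l z = Some y"
    by (cases "act_word w x") simp_all
  then have "z \<in> P"
    using Cons.IH Cons.prems by simp
  then show ?case
    using act_letter_closed[OF _ _ z(2)] Cons.prems by simp
qed simp

text \<open>Letters act as partial injections of \<open>P\<close>, and flipping inverts them; on
  basis vectors this is adjointness.\<close>

lemma act_letter_flip:
  assumes "l \<in> letters P" "x \<in> P" "y \<in> P"
  shows "act_letter l x = Some y \<longleftrightarrow> act_letter (flip_letter l) y = Some x"
proof (cases l)
  case (Gen p)
  then have "p \<in> P" using assms by (auto simp: letters_def)
  then have "p \<otimes> x = y \<longleftrightarrow> inv p \<otimes> y = x"
    using assms inv_solve_left'[of x p y] by auto
  then show ?thesis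
    using Gen assms by auto
next
  case (Adj p)
  then have "p \<in> P" using assms by (auto simp: letters_def)
  then have "inv p \<otimes> x = y \<longleftrightarrow> p \<otimes> y = x"
    using assms inv_solve_left'[of y p x] by auto
  then show ?thesis
    using Adj assms by auto
qed

lemma act_word_star:
  "set w \<subseteq> letters P \<Longrightarrow> x \<in> P \<Longrightarrow> y \<in> P \<Longrightarrow>
    act_word w x = Some y \<longleftrightarrow> act_word (star_word w) y = Some x"
proof (induction w arbitrary: y)
  case Nil
  then show ?case by (auto simp: star_word_def)
next
  case (Cons l w)
  then have l: "l \<in> letters P" and w: "set w \<subseteq> letters P" by auto
  have "act_word (l # w) x = Some y \<longleftrightarrow> (\<exists>z\<in>P. act_word w x = Some z \<and> act_letter l z = Some y)"
    using act_word_closed[OF w Cons.prems(2)] by (cases "act_word w x") auto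
  also have "\<dots> \<longleftrightarrow> (\<exists>z\<in>P. act_letter (flip_letter l) y = Some z \<and> act_word (star_word w) z = Some x)"
    using Cons.IH[OF w Cons.prems(2)] act_letter_flip[OF l _ Cons.prems(3)] by blast
  also have "\<dots> \<longleftrightarrow> Option.bind (act_letter (flip_letter l) y) (act_word (star_word w)) = Some x"
    using act_letter_closed[of "flip_letter l" y] l Cons.prems(3)
    by (cases "act_letter (flip_letter l) y") auto
  also have "\<dots> \<longleftrightarrow> act_word (star_word w @ [flip_letter l]) y = Some x"
    by (simp add: act_word_append)
  finally show ?case
    by (simp add: star_word_def)
qed

text \<open>The coordinates of the vector \<open>f \<delta>\<^sub>1\<close>.\<close>

definition vec :: "('a letter list \<Rightarrow> complex) \<Rightarrow> 'a \<Rightarrow> complex" where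
  "vec f x = word_sum (\<lambda>w. of_bool (act_word w \<one> = Some x)) f"

text \<open>A finite superset of the support of \<open>vec f\<close>; coordinates in it may still
  cancel to zero.\<close>

definition reach :: "('a letter list \<Rightarrow> complex) \<Rightarrow> 'a set" where
  "reach f = {x. \<exists>w. f w \<noteq> 0 \<and> act_word w \<one> = Some x}"

lemma finite_reach:
  assumes "f \<in> carrier F" shows "finite (reach f)"
proof (rule finite_subset)
  show "reach f \<subseteq> (\<lambda>w. the (act_word w \<one>)) ` {w. f w \<noteq> 0}"
  proof
    fix x assume "x \<in> reach f"
    then obtain w where "f w \<noteq> 0" "act_word w \<one> = Some x"
      by (auto simp: reach_def)
    then show "x \<in> (\<lambda>w. the (act_word w \<one>)) ` {w. f w \<noteq> 0}"
      by (intro image_eqI[of _ _ w]) simp_all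
  qed
  show "finite ((\<lambda>w. the (act_word w \<one>)) ` {w. f w \<noteq> 0})"
    using assms by (simp add: carrier_free_iff)
qed

lemma reach_subset: "f \<in> carrier F \<Longrightarrow> reach f \<subseteq> P"
  using act_word_closed[OF _ P.one_closed] by (auto simp: reach_def carrier_free_iff)

lemma vec_outside_reach: "x \<notin> reach f \<Longrightarrow> vec f x = 0"
  by (auto simp: vec_def word_sum_def reach_def intro!: sum.neutral)

lemma vec_add: "f \<in> carrier F \<Longrightarrow> g \<in> carrier F \<Longrightarrow> vec (f \<oplus>\<^bsub>F\<^esub> g) x = vec f x + vec g x"
  by (simp add: vec_def word_sum_add)

lemma vec_cscale: "f \<in> carrier F \<Longrightarrow> vec (cscale F a f) x = a * vec f x"
  by (simp add: vec_def word_sum_cscale)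

lemma vec_minus: "f \<in> carrier F \<Longrightarrow> g \<in> carrier F \<Longrightarrow> vec (f \<ominus>\<^bsub>F\<^esub> g) x = vec f x - vec g x"
  by (simp add: F.minus_eq_cscale vec_add vec_cscale)

lemma vec_one: "vec \<one>\<^bsub>F\<^esub> x = of_bool (x = \<one>)"
  by (auto simp: vec_def free_one word_sum_word_basis)

lemma vec_word_basis_mult:
  assumes "set w \<subseteq> letters P" "g \<in> carrier F"
  shows "vec (word_basis w \<otimes>\<^bsub>F\<^esub> g) x =
    word_sum (\<lambda>v. of_bool (Option.bind (act_word v \<one>) (act_word w) = Some x)) g"
  using assms by (simp add: vec_def word_sum_mult_basis act_word_append)

text \<open>Serves the neutral words: they act as partial identities with domain
  \<open>K(\<alpha>)\<close>, so on vectors they are coordinate projections.\<close>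

lemma vec_partial_identity_mult:
  assumes w: "set w \<subseteq> letters P" and g: "g \<in> carrier F"
    and act: "\<And>y. y \<in> P \<Longrightarrow> act_word w y = (if y \<in> K then Some y else None)"
  shows "vec (word_basis w \<otimes>\<^bsub>F\<^esub> g) x = of_bool (x \<in> K) * vec g x"
proof -
  \<comment> \<open>The summand 0 brings the function into the shape of
    \<open>word_sum_linear\<close>.\<close>
  have "word_sum (\<lambda>v. of_bool (Option.bind (act_word v \<one>) (act_word w) = Some x)) g =
      word_sum (\<lambda>v. of_bool (x \<in> K) * of_bool (act_word v \<one> = Some x) + 0) g"
  proof (rule word_sum_cong)
    fix v assume "g v \<noteq> 0"
    then have v: "set v \<subseteq> letters P"
      using g by (simp add: carrier_free_iff)
    show "(of_bool (Option.bind (act_word v \<one>) (act_word w) = Some x) :: complex) =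
        of_bool (x \<in> K) * of_bool (act_word v \<one> = Some x) + 0"
    proof (cases "act_word v \<one>")
      case (Some y)
      then have "y \<in> P"
        using act_word_closed[OF v P.one_closed] by simp
      then show ?thesis
        using act Some by auto
    qed simp
  qed
  also have "\<dots> = of_bool (x \<in> K) * vec g x"
    unfolding word_sum_linear vec_def by (simp add: word_sum_def)
  finally show ?thesis
    using vec_word_basis_mult[OF w g] by simp
qed

lemma cnj_of_bool: "cnj (of_bool b) = of_bool b"
  by (cases b) simp_all

text \<open>\<open>f \<mapsto> vec f \<one>\<close> is the vector state of the basis vector at the
  identity, so its value at \<open>h^* g\<close> is the inner product of two vectors. The set
  \<open>X\<close> is left free so that both can be summed over a common index set.\<close>

lemma inner_eq:
  assumes h: "h \<in> carrier F" and g: "g \<in> carrier F" and X: "finite X" "reach g \<subseteq> X"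
  shows "vec (cadj F h \<otimes>\<^bsub>F\<^esub> g) \<one> = (\<Sum>x\<in>X. cnj (vec h x) * vec g x)"
proof -
  \<comment> \<open>On words, both sides test whether \<open>u\<close> and \<open>v\<close> send the
    identity to the same point.\<close>
  have key: "(of_bool (act_word (star_word u @ v) \<one> = Some \<one>) :: complex) =
      (\<Sum>x\<in>X. of_bool (act_word u \<one> = Some x) * of_bool (act_word v \<one> = Some x))"
    if u: "h u \<noteq> 0" and v: "g v \<noteq> 0" for u v
  proof (cases "act_word v \<one>")
    case None
    then show ?thesis by (simp add: act_word_append)
  next
    case (Some y)
    have "y \<in> reach g"
      using v Some by (auto simp: reach_def)
    then have y: "y \<in> X" "y \<in> P"
      using X reach_subset[OF g] by auto
    have "set u \<subseteq> letters P"
      using h u by (simp add: carrier_free_iff)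
    then have "act_word u \<one> = Some y \<longleftrightarrow> act_word (star_word u) y = Some \<one>"
      using y P.one_closed by (intro act_word_star)
    moreover have "(\<Sum>x\<in>X. of_bool (act_word u \<one> = Some x) * of_bool (act_word v \<one> = Some x)) =
        (\<Sum>x\<in>X. if x = y then of_bool (act_word u \<one> = Some y) else (0 :: complex))"
      using Some by (intro sum.cong) auto
    ultimately show ?thesis
      using X y Some by (simp add: act_word_append)
  qed
  have "vec (cadj F h \<otimes>\<^bsub>F\<^esub> g) \<one> =
      cnj (word_sum (\<lambda>u. cnj (word_sum (\<lambda>v. of_bool (act_word (star_word u @ v) \<one> = Some \<one>)) g)) h)"
    using h g by (simp add: vec_def word_sum_mult word_sum_cadj)
  also have "\<dots> = (\<Sum>u | h u \<noteq> 0. \<Sum>v | g v \<noteq> 0.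
      cnj (h u) * (g v * of_bool (act_word (star_word u @ v) \<one> = Some \<one>)))"
    by (simp add: word_sum_def sum_distrib_left)
  also have "\<dots> = (\<Sum>u | h u \<noteq> 0. \<Sum>v | g v \<noteq> 0. \<Sum>x\<in>X.
      cnj (h u * of_bool (act_word u \<one> = Some x)) * (g v * of_bool (act_word v \<one> = Some x)))"
    using key by (intro sum.cong) (simp_all add: sum_distrib_left cnj_of_bool mult_ac)
  also have "\<dots> = (\<Sum>u | h u \<noteq> 0. \<Sum>x\<in>X. \<Sum>v | g v \<noteq> 0.
      cnj (h u * of_bool (act_word u \<one> = Some x)) * (g v * of_bool (act_word v \<one> = Some x)))"
    by (intro sum.cong refl sum.swap)
  also have "\<dots> = (\<Sum>x\<in>X. \<Sum>u | h u \<noteq> 0. \<Sum>v | g v \<noteq> 0.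
      cnj (h u * of_bool (act_word u \<one> = Some x)) * (g v * of_bool (act_word v \<one> = Some x)))"
    by (rule sum.swap)
  also have "\<dots> = (\<Sum>x\<in>X. cnj (vec h x) * vec g x)"
    by (simp only: vec_def word_sum_def cnj_sum sum_product)
  finally show ?thesis .
qed

section \<open>The norm of a vector and its behaviour under multiplication\<close>

definition vec_norm :: "('a letter list \<Rightarrow> complex) \<Rightarrow> real" where
  "vec_norm f = L2_set (\<lambda>x. cmod (vec f x)) (reach f)"

lemma vec_norm_superset:
  assumes "finite X" "reach f \<subseteq> X" shows "vec_norm f = L2_set (\<lambda>x. cmod (vec f x)) X"
  unfolding vec_norm_def L2_set_def
  by (intro arg_cong[of _ _ sqrt] sum.mono_neutral_left assms) (auto simp: vec_outside_reach)

lemma vec_norm_nonneg: "0 \<le> vec_norm f"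
  by (simp add: vec_norm_def L2_set_nonneg)

lemma vec_norm_sq:
  assumes "f \<in> carrier F" shows "vec (cadj F f \<otimes>\<^bsub>F\<^esub> f) \<one> = of_real ((vec_norm f)\<^sup>2)"
proof -
  have "(vec_norm f)\<^sup>2 = (\<Sum>x\<in>reach f. (cmod (vec f x))\<^sup>2)"
    by (simp add: vec_norm_def L2_set_def sum_nonneg)
  then show ?thesis
    unfolding inner_eq[OF assms assms finite_reach[OF assms] order_refl]
    by (simp only: of_real_sum complex_norm_square mult.commute)
qed

lemma cmod_inner_le:
  assumes h: "h \<in> carrier F" and g: "g \<in> carrier F"
  shows "cmod (vec (cadj F h \<otimes>\<^bsub>F\<^esub> g) \<one>) \<le> vec_norm h * vec_norm g"
proof -
  let ?X = "reach h \<union> reach g"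
  have X: "finite ?X"
    using h g by (simp add: finite_reach)
  have "cmod (vec (cadj F h \<otimes>\<^bsub>F\<^esub> g) \<one>) \<le> (\<Sum>x\<in>?X. cmod (cnj (vec h x) * vec g x))"
    unfolding inner_eq[OF h g X Un_upper2] by (rule norm_sum)
  also have "\<dots> = (\<Sum>x\<in>?X. \<bar>cmod (vec h x)\<bar> * \<bar>cmod (vec g x)\<bar>)"
    by (simp add: norm_mult)
  also have "\<dots> \<le> L2_set (\<lambda>x. cmod (vec h x)) ?X * L2_set (\<lambda>x. cmod (vec g x)) ?X"
    by (rule L2_set_mult_ineq)
  also have "\<dots> = vec_norm h * vec_norm g"
    using vec_norm_superset[OF X, of h] vec_norm_superset[OF X, of g] by simp
  finally show ?thesis .
qed

lemma vec_norm_add: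
  assumes f: "f \<in> carrier F" and g: "g \<in> carrier F"
  shows "vec_norm (f \<oplus>\<^bsub>F\<^esub> g) \<le> vec_norm f + vec_norm g"
proof -
  let ?X = "reach f \<union> reach g \<union> reach (f \<oplus>\<^bsub>F\<^esub> g)"
  have X: "finite ?X"
    using f g by (simp add: finite_reach)
  have "vec_norm (f \<oplus>\<^bsub>F\<^esub> g) = L2_set (\<lambda>x. cmod (vec f x + vec g x)) ?X"
    using vec_norm_superset[OF X, of "f \<oplus>\<^bsub>F\<^esub> g"] f g by (simp add: vec_add)
  also have "\<dots> \<le> L2_set (\<lambda>x. cmod (vec f x) + cmod (vec g x)) ?X"
    by (intro L2_set_mono norm_triangle_ineq norm_ge_zero)
  also have "\<dots> \<le> L2_set (\<lambda>x. cmod (vec f x)) ?X + L2_set (\<lambda>x. cmod (vec g x)) ?X"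
    by (rule L2_set_triangle_ineq)
  also have "L2_set (\<lambda>x. cmod (vec f x)) ?X = vec_norm f"
    by (rule vec_norm_superset[symmetric, OF X]) auto
  also have "L2_set (\<lambda>x. cmod (vec g x)) ?X = vec_norm g"
    by (rule vec_norm_superset[symmetric, OF X]) auto
  finally show ?thesis .
qed

lemma vec_norm_cscale:
  assumes f: "f \<in> carrier F" shows "vec_norm (cscale F c f) = cmod c * vec_norm f"
proof -
  let ?X = "reach f \<union> reach (cscale F c f)"
  have X: "finite ?X"
    using f by (simp add: finite_reach)
  have "vec_norm (cscale F c f) = L2_set (\<lambda>x. cmod c * cmod (vec f x)) ?X"
    using vec_norm_superset[OF X, of "cscale F c f"] f by (simp add: vec_cscale norm_mult)
  also have "\<dots> = cmod c * L2_set (\<lambda>x. cmod (vec f x)) ?X"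
    by (rule L2_set_right_distrib[symmetric]) simp
  finally show ?thesis
    using vec_norm_superset[OF X, of f] by simp
qed

lemma vec_norm_zero: "vec_norm \<zero>\<^bsub>F\<^esub> = 0"
  using vec_norm_cscale[of "\<zero>\<^bsub>F\<^esub>" 0] by simp

text \<open>Cauchy-Schwarz applied to \<open><f g, f g> = <g, f^* f g>\<close>.\<close>

lemma vec_norm_adj:
  assumes f: "f \<in> carrier F" and g: "g \<in> carrier F"
  shows "(vec_norm (f \<otimes>\<^bsub>F\<^esub> g))\<^sup>2 \<le> vec_norm g * vec_norm (cadj F f \<otimes>\<^bsub>F\<^esub> (f \<otimes>\<^bsub>F\<^esub> g))"
proof -
  have "cadj F (f \<otimes>\<^bsub>F\<^esub> g) \<otimes>\<^bsub>F\<^esub> (f \<otimes>\<^bsub>F\<^esub> g) = cadj F g \<otimes>\<^bsub>F\<^esub> (cadj F f \<otimes>\<^bsub>F\<^esub> (f \<otimes>\<^bsub>F\<^esub> g))"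
    using f g by (simp add: F.cadj_mult F.m_assoc)
  then have "cmod (of_real ((vec_norm (f \<otimes>\<^bsub>F\<^esub> g))\<^sup>2)) \<le>
      vec_norm g * vec_norm (cadj F f \<otimes>\<^bsub>F\<^esub> (f \<otimes>\<^bsub>F\<^esub> g))"
    using cmod_inner_le[OF g, of "cadj F f \<otimes>\<^bsub>F\<^esub> (f \<otimes>\<^bsub>F\<^esub> g)"] f g vec_norm_sq[of "f \<otimes>\<^bsub>F\<^esub> g"]
    by simp
  then show ?thesis
    by (simp del: of_real_power)
qed

lemma vec_norm_contraction:
  assumes f: "f \<in> carrier F" and g: "g \<in> carrier F"
    and le: "vec_norm (cadj F f \<otimes>\<^bsub>F\<^esub> (f \<otimes>\<^bsub>F\<^esub> g)) \<le> vec_norm g"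
  shows "vec_norm (f \<otimes>\<^bsub>F\<^esub> g) \<le> vec_norm g"
proof -
  have "(vec_norm (f \<otimes>\<^bsub>F\<^esub> g))\<^sup>2 \<le> vec_norm g * vec_norm g"
    using vec_norm_adj[OF f g] mult_left_mono[OF le vec_norm_nonneg[of g]] by linarith
  then show ?thesis
    by (intro power2_le_imp_le[OF _ vec_norm_nonneg]) (simp add: power2_eq_square)
qed

text \<open>\<open>Adj p\<close> undoes \<open>Gen p\<close> on basis vectors, so
  \<open>f^* f g\<close> and \<open>g\<close> have the same coordinates.\<close>

lemma vec_norm_gen_mult:
  assumes p: "p \<in> P" and g: "g \<in> carrier F"
  shows "vec_norm (word_basis [Gen p] \<otimes>\<^bsub>F\<^esub> g) \<le> vec_norm g"
proof (rule vec_norm_contraction)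
  have l: "[Gen p] \<in> lists (letters P)" "set [Adj p, Gen p] \<subseteq> letters P"
    using p by (auto simp: letters_def)
  show f: "word_basis [Gen p] \<in> carrier F"
    using l by (auto intro: word_basis_closed)
  have "cadj F (word_basis [Gen p]) \<otimes>\<^bsub>F\<^esub> (word_basis [Gen p] \<otimes>\<^bsub>F\<^esub> g) =
      word_basis [Adj p, Gen p] \<otimes>\<^bsub>F\<^esub> g"
    using f g F.cadj_closed[OF f]
    by (simp add: F.m_assoc[symmetric]) (simp add: word_basis_cadj star_word_def word_basis_mult)
  moreover have "vec (word_basis [Adj p, Gen p] \<otimes>\<^bsub>F\<^esub> g) x = of_bool (x \<in> P) * vec g x" for x
    by (rule vec_partial_identity_mult[OF l(2) g]) (simp add: p m_assoc[symmetric])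
  moreover have "of_bool (x \<in> P) * vec g x = vec g x" for x
    using vec_outside_reach[of x g] reach_subset[OF g] by auto
  ultimately have eq: "vec (cadj F (word_basis [Gen p]) \<otimes>\<^bsub>F\<^esub> (word_basis [Gen p] \<otimes>\<^bsub>F\<^esub> g)) x = vec g x" for x
    by simp
  let ?h = "cadj F (word_basis [Gen p]) \<otimes>\<^bsub>F\<^esub> (word_basis [Gen p] \<otimes>\<^bsub>F\<^esub> g)"
  have "finite (reach ?h \<union> reach g)"
    using f g by (simp add: finite_reach)
  then show "vec_norm ?h \<le> vec_norm g"
    using vec_norm_superset[of "reach ?h \<union> reach g" ?h] vec_norm_superset[of "reach ?h \<union> reach g" g]
    by (simp add: eq)
qed (rule g)

text \<open>For an \<open>Adj\<close> letter the outer factor of \<open>f^* f\<close> is a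
  generator, already known to contract; one factor \<open>vec_norm (f g)\<close> then cancels in
  \<open>vec_norm_adj\<close>.\<close>

lemma vec_norm_letter_mult:
  assumes l: "l \<in> letters P" and g: "g \<in> carrier F"
  shows "vec_norm (word_basis [l] \<otimes>\<^bsub>F\<^esub> g) \<le> vec_norm g"
proof (cases l)
  case (Gen p)
  then show ?thesis
    using vec_norm_gen_mult[OF _ g, of p] l by (auto simp: letters_def)
next
  case (Adj p)
  then have p: "p \<in> P"
    using l by (auto simp: letters_def)
  have f: "word_basis [l] \<in> carrier F"
    using l by (intro word_basis_closed) simp
  have "cadj F (word_basis [l]) = word_basis [Gen p]"
    by (simp add: Adj word_basis_cadj star_word_def)
  then have "vec_norm (cadj F (word_basis [l]) \<otimes>\<^bsub>F\<^esub> (word_basis [l] \<otimes>\<^bsub>F\<^esub> g)) \<le>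
      vec_norm (word_basis [l] \<otimes>\<^bsub>F\<^esub> g)"
    using f g vec_norm_gen_mult[OF p] by simp
  then have "(vec_norm (word_basis [l] \<otimes>\<^bsub>F\<^esub> g))\<^sup>2 \<le> vec_norm g * vec_norm (word_basis [l] \<otimes>\<^bsub>F\<^esub> g)"
    using vec_norm_adj[OF f g] mult_left_mono[OF _ vec_norm_nonneg[of g]] by (meson order_trans)
  then show ?thesis
    using vec_norm_nonneg[of "word_basis [l] \<otimes>\<^bsub>F\<^esub> g"] vec_norm_nonneg[of g]
    by (cases "vec_norm (word_basis [l] \<otimes>\<^bsub>F\<^esub> g) = 0") (simp_all add: power2_eq_square)
qed

lemma vec_norm_word_mult:
  "set w \<subseteq> letters P \<Longrightarrow> g \<in> carrier F \<Longrightarrow> vec_norm (word_basis w \<otimes>\<^bsub>F\<^esub> g) \<le> vec_norm g"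
proof (induction w)
  case Nil
  then show ?case
    using F.l_one[of g, unfolded free_one] by simp
next
  case (Cons l w)
  then have c: "word_basis [l] \<in> carrier F" "word_basis w \<in> carrier F" "l \<in> letters P"
    by (auto intro: word_basis_closed)
  have "word_basis (l # w) \<otimes>\<^bsub>F\<^esub> g = word_basis [l] \<otimes>\<^bsub>F\<^esub> (word_basis w \<otimes>\<^bsub>F\<^esub> g)"
    using c Cons.prems by (simp add: F.m_assoc[symmetric] word_basis_mult)
  then show ?case
    using vec_norm_letter_mult[OF c(3), of "word_basis w \<otimes>\<^bsub>F\<^esub> g"] c Cons by simp
qed

lemma vec_norm_bounded:
  "f \<in> carrier F \<Longrightarrow> \<exists>C. \<forall>g\<in>carrier F. vec_norm (f \<otimes>\<^bsub>F\<^esub> g) \<le> C * vec_norm g"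
proof (induction rule: free_star_induct)
  case zero
  then show ?case
    by (intro exI[of _ 0]) (simp add: vec_norm_zero)
next
  case (add c w f)
  then obtain C where C: "\<forall>g\<in>carrier F. vec_norm (f \<otimes>\<^bsub>F\<^esub> g) \<le> C * vec_norm g"
    by blast
  have w: "word_basis w \<in> carrier F"
    using add by (simp add: word_basis_closed)
  have "vec_norm ((cscale F c (word_basis w) \<oplus>\<^bsub>F\<^esub> f) \<otimes>\<^bsub>F\<^esub> g) \<le> (cmod c + C) * vec_norm g"
    if g: "g \<in> carrier F" for g
  proof -
    have "(cscale F c (word_basis w) \<oplus>\<^bsub>F\<^esub> f) \<otimes>\<^bsub>F\<^esub> g = cscale F c (word_basis w \<otimes>\<^bsub>F\<^esub> g) \<oplus>\<^bsub>F\<^esub> f \<otimes>\<^bsub>F\<^esub> g"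
      using w g add by (simp add: F.l_distr F.cscale_mult_left)
    then have "vec_norm ((cscale F c (word_basis w) \<oplus>\<^bsub>F\<^esub> f) \<otimes>\<^bsub>F\<^esub> g) \<le>
        cmod c * vec_norm (word_basis w \<otimes>\<^bsub>F\<^esub> g) + vec_norm (f \<otimes>\<^bsub>F\<^esub> g)"
      using vec_norm_add[of "cscale F c (word_basis w \<otimes>\<^bsub>F\<^esub> g)" "f \<otimes>\<^bsub>F\<^esub> g"] w g add
      by (simp add: vec_norm_cscale)
    also have "\<dots> \<le> cmod c * vec_norm g + C * vec_norm g"
      using C g add by (intro add_mono mult_left_mono vec_norm_word_mult) simp_all
    finally show ?thesis
      by (simp add: distrib_right)
  qed
  then show ?case by blast
qed

lemma left_seminorm_vec_norm: "left_seminorm F vec_norm"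
  by (intro left_seminorm.intro left_seminorm_axioms.intro unital_star_algebra_free
      vec_norm_nonneg vec_norm_add vec_norm_cscale vec_norm_adj vec_norm_bounded)

end


section \<open>The universal Toeplitz algebra\<close>

lemma (in star_algebra_seminorm) star_homomorphism_completion:
  "star_homomorphism A (cstar_completion A N) (\<lambda>a. cauchy_class A N (\<lambda>n. a))"
proof (intro star_homomorphism.intro star_homomorphism_axioms.intro unital_star_algebra_completion)
  show "(\<lambda>a. cauchy_class A N (\<lambda>n. a)) \<in> unital_star_hom A (cstar_completion A N)"
    unfolding unital_star_hom_def ring_hom_def by (auto simp: completion_simps)
qed (rule unital_star_algebra_axioms)

lemma (in unital_star_algebra) toeplitz_relators_closed:
  assumes "one_in": "\<one>\<^bsub>G\<^esub> \<in> P" and w: "w ` P \<subseteq> carrier A"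
  shows "toeplitz_relators G P A w \<subseteq> carrier A"
proof -
  have op: "word_op A w \<alpha> \<in> carrier A" if "\<alpha> \<in> neutral_words G P" for \<alpha>
    using word_op_closed[OF w] that by (simp add: neutral_words_def)
  have "list_mult A (map (\<lambda>\<beta>. word_op A w \<alpha> \<ominus> word_op A w \<beta>) F) \<in> carrier A"
    if "\<alpha> \<in> neutral_words G P" "set F \<subseteq> neutral_words G P" for \<alpha> F
    using that op by (intro list_mult_closed) auto
  moreover have "w \<one>\<^bsub>G\<^esub> \<in> carrier A"
    using assms by blast
  ultimately show ?thesis
    using op by (auto simp: toeplitz_relators_def)
qed

text \<open>Relators are star polynomials in the generators, so a homomorphism that kills those of
  \<open>w\<close> makes the image family satisfy the relations.\<close>

lemma (in star_homomorphism) toeplitz_relators_image: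
  assumes one_in: "\<one>\<^bsub>G\<^esub> \<in> P" and w: "w ` P \<subseteq> carrier A"
  shows "toeplitz_relators G P B (\<lambda>p. h (w p)) \<subseteq> h ` toeplitz_relators G P A w"
proof
  have closed: "word_op A w \<alpha> \<in> carrier A"
    and op: "word_op B (\<lambda>p. h (w p)) \<alpha> = h (word_op A w \<alpha>)" if "\<alpha> \<in> neutral_words G P" for \<alpha>
    using A.word_op_closed[OF w] hom_word_op[OF w] that by (simp_all add: neutral_words_def)
  fix r assume "r \<in> toeplitz_relators G P B (\<lambda>p. h (w p))"
  then consider "r = h (w \<one>\<^bsub>G\<^esub>) \<ominus>\<^bsub>B\<^esub> \<one>\<^bsub>B\<^esub>"
    | \<alpha> where "\<alpha> \<in> neutral_words G P" "constr_ideal G P \<alpha> = {}" "r = word_op B (\<lambda>p. h (w p)) \<alpha>"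
    | \<alpha> \<beta> where "\<alpha> \<in> neutral_words G P" "\<beta> \<in> neutral_words G P"
        "constr_ideal G P \<alpha> = constr_ideal G P \<beta>"
        "r = word_op B (\<lambda>p. h (w p)) \<alpha> \<ominus>\<^bsub>B\<^esub> word_op B (\<lambda>p. h (w p)) \<beta>"
    | \<alpha> F where "\<alpha> \<in> neutral_words G P" "F \<noteq> []" "distinct F" "set F \<subseteq> neutral_words G P"
        "constr_ideal G P \<alpha> = (\<Union>\<beta>\<in>set F. constr_ideal G P \<beta>)"
        "r = list_mult B (map (\<lambda>\<beta>. word_op B (\<lambda>p. h (w p)) \<alpha> \<ominus>\<^bsub>B\<^esub> word_op B (\<lambda>p. h (w p)) \<beta>) F)"
    unfolding toeplitz_relators_def by blast
  then show "r \<in> h ` toeplitz_relators G P A w"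
  proof cases
    case 1
    have "w \<one>\<^bsub>G\<^esub> \<in> carrier A"
      using assms by blast
    then have "r = h (w \<one>\<^bsub>G\<^esub> \<ominus>\<^bsub>A\<^esub> \<one>\<^bsub>A\<^esub>)"
      by (simp add: 1 hom_minus)
    then show ?thesis
      by (rule image_eqI) (simp add: toeplitz_relators_def)
  next
    case (2 \<alpha>)
    then have "r = h (word_op A w \<alpha>)"
      by (simp add: op)
    then show ?thesis
      by (rule image_eqI) (use 2 in \<open>unfold toeplitz_relators_def, blast\<close>)
  next
    case (3 \<alpha> \<beta>)
    then have "r = h (word_op A w \<alpha> \<ominus>\<^bsub>A\<^esub> word_op A w \<beta>)"
      by (simp add: op closed hom_minus)
    then show ?thesis
      by (rule image_eqI) (use 3 in \<open>unfold toeplitz_relators_def, blast\<close>)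
  next
    case (4 \<alpha> F)
    have sub: "set (map (\<lambda>\<beta>. word_op A w \<alpha> \<ominus>\<^bsub>A\<^esub> word_op A w \<beta>) F) \<subseteq> carrier A"
      using 4 closed by auto
    have "h (word_op A w \<alpha> \<ominus>\<^bsub>A\<^esub> word_op A w \<beta>) =
        word_op B (\<lambda>p. h (w p)) \<alpha> \<ominus>\<^bsub>B\<^esub> word_op B (\<lambda>p. h (w p)) \<beta>" if "\<beta> \<in> set F" for \<beta>
      using that 4 op closed by (simp add: hom_minus subset_iff)
    then have "r = h (list_mult A (map (\<lambda>\<beta>. word_op A w \<alpha> \<ominus>\<^bsub>A\<^esub> word_op A w \<beta>) F))"
      unfolding hom_list_mult[OF sub] 4(6)
      by (simp add: comp_def cong: map_cong)
    then show ?thesis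
      by (rule image_eqI) (use 4 in \<open>unfold toeplitz_relators_def, blast\<close>)
  qed
qed

context submonoid_of_group
begin

abbreviation "R \<equiv> free_toeplitz_relators G P"

abbreviation "T \<equiv> toeplitz_univ G P"

lemma free_gen_image: "free_gen ` P \<subseteq> carrier F"
  by (auto simp: free_gen_eq letters_def intro!: word_basis_closed)

lemma free_relators_closed: "R \<subseteq> carrier F"
  unfolding free_toeplitz_relators_def
  by (rule F.toeplitz_relators_closed[OF P.one_closed free_gen_image])

section \<open>The relators in the regular representation\<close>

fun word_letters :: "('a \<times> 'a) list \<Rightarrow> 'a letter list" where
  "word_letters [] = []"
| "word_letters ((p, q) # \<alpha>) = Adj p # Gen q # word_letters \<alpha>"

lemma set_word_letters: "set \<alpha> \<subseteq> P \<times> P \<Longrightarrow> set (word_letters \<alpha>) \<subseteq> letters P"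
proof (induction \<alpha>)
  case (Cons a \<alpha>)
  then show ?case by (cases a) (auto simp: letters_def)
qed simp

lemma free_word_op: "word_op F free_gen \<alpha> = word_basis (word_letters \<alpha>)"
proof (induction \<alpha>)
  case Nil
  then show ?case by (simp add: free_one)
next
  case (Cons a \<alpha>)
  then show ?case
    by (cases a) (simp add: free_gen_eq word_basis_cadj word_basis_mult star_word_def)
qed

lemma act_word_letters:
  "set \<alpha> \<subseteq> P \<times> P \<Longrightarrow> y \<in> P \<Longrightarrow>
    act_word (word_letters \<alpha>) y = (if y \<in> constr_ideal G P \<alpha> then Some (word_val G \<alpha> \<otimes> y) else None)"
proof (induction \<alpha>)
  case (Cons a \<alpha>)
  obtain p q where a: "a = (p, q)" by force
  have pq: "p \<in> P" "q \<in> P" "set \<alpha> \<subseteq> P \<times> P"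
    using Cons.prems a by auto
  have mem: "y \<in> constr_ideal G P (a # \<alpha>) \<longleftrightarrow>
      y \<in> constr_ideal G P \<alpha> \<and> word_val G (a # \<alpha>) \<otimes> y \<in> P"
    using Cons.prems by (intro mem_constr_ideal_Cons) simp_all
  have val: "word_val G (a # \<alpha>) \<otimes> y = inv p \<otimes> (q \<otimes> (word_val G \<alpha> \<otimes> y))"
    using pq Cons.prems a by (simp add: m_assoc)
  show ?case
    using Cons.IH[OF pq(3) Cons.prems(2)] unfolding mem val by (simp add: a)
qed simp

text \<open>In the regular representation \<open>d\<close> is multiplication by
  \<open>\<chi>\<close>. The condition runs over all \<open>g\<close> because vectors are present
  only as images of algebra elements.\<close>

definition diagonal_with :: "('a \<Rightarrow> complex) \<Rightarrow> ('a letter list \<Rightarrow> complex) \<Rightarrow> bool" where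
  "diagonal_with \<chi> d \<longleftrightarrow>
     d \<in> carrier F \<and> (\<forall>g\<in>carrier F. \<forall>x\<in>P. vec (d \<otimes>\<^bsub>F\<^esub> g) x = \<chi> x * vec g x)"

lemma diagonal_with_word_op:
  assumes \<alpha>: "\<alpha> \<in> neutral_words G P"
  shows "diagonal_with (\<lambda>x. of_bool (x \<in> constr_ideal G P \<alpha>)) (word_op F free_gen \<alpha>)"
proof -
  have w: "set (word_letters \<alpha>) \<subseteq> letters P"
    using \<alpha> by (simp add: neutral_wordsD set_word_letters)
  have "act_word (word_letters \<alpha>) y = (if y \<in> constr_ideal G P \<alpha> then Some y else None)"
    if "y \<in> P" for y
    using act_word_letters[of \<alpha> y] neutral_wordsD[OF \<alpha>] that by simp
  then show ?thesis
    using w by (simp add: diagonal_with_def free_word_op word_basis_closed vec_partial_identity_mult)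
qed

lemma diagonal_with_one: "diagonal_with (\<lambda>x. 1) \<one>\<^bsub>F\<^esub>"
  by (simp add: diagonal_with_def)

lemma diagonal_with_minus:
  "diagonal_with \<chi> d \<Longrightarrow> diagonal_with \<psi> e \<Longrightarrow> diagonal_with (\<lambda>x. \<chi> x - \<psi> x) (d \<ominus>\<^bsub>F\<^esub> e)"
  by (simp add: diagonal_with_def F.minus_mult_left vec_minus left_diff_distrib)

lemma diagonal_with_mult:
  "diagonal_with \<chi> d \<Longrightarrow> diagonal_with \<psi> e \<Longrightarrow> diagonal_with (\<lambda>x. \<chi> x * \<psi> x) (d \<otimes>\<^bsub>F\<^esub> e)"
  by (simp add: diagonal_with_def F.m_assoc mult.assoc)

lemma diagonal_with_list_mult:
  "(\<And>\<beta>. \<beta> \<in> set L \<Longrightarrow> diagonal_with (\<chi> \<beta>) (d \<beta>)) \<Longrightarrow>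
    diagonal_with (\<lambda>x. \<Prod>\<beta>\<leftarrow>L. \<chi> \<beta> x) (list_mult F (map d L))"
  by (induction L) (simp_all add: diagonal_with_one diagonal_with_mult)

text \<open>A neutral word acts as the indicator function of its ideal, so each relation turns into
  an identity between indicator functions on \<open>P\<close>.\<close>

lemma relator_diagonal:
  assumes "r \<in> R"
  obtains \<chi> where "diagonal_with \<chi> r" "\<And>x. x \<in> P \<Longrightarrow> \<chi> x = 0"
proof -
  note word = diagonal_with_word_op
  consider "r = free_gen \<one> \<ominus>\<^bsub>F\<^esub> \<one>\<^bsub>F\<^esub>"
    | \<alpha> where "\<alpha> \<in> neutral_words G P" "constr_ideal G P \<alpha> = {}" "r = word_op F free_gen \<alpha>"
    | \<alpha> \<beta> where "\<alpha> \<in> neutral_words G P" "\<beta> \<in> neutral_words G P"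
        "constr_ideal G P \<alpha> = constr_ideal G P \<beta>"
        "r = word_op F free_gen \<alpha> \<ominus>\<^bsub>F\<^esub> word_op F free_gen \<beta>"
    | \<alpha> L where "\<alpha> \<in> neutral_words G P" "L \<noteq> []" "set L \<subseteq> neutral_words G P"
        "constr_ideal G P \<alpha> = (\<Union>\<beta>\<in>set L. constr_ideal G P \<beta>)"
        "r = list_mult F (map (\<lambda>\<beta>. word_op F free_gen \<alpha> \<ominus>\<^bsub>F\<^esub> word_op F free_gen \<beta>) L)"
    using assms unfolding free_toeplitz_relators_def toeplitz_relators_def by blast
  then show thesis
  proof cases
    case 1
    have l: "set [Gen \<one>] \<subseteq> letters P"
      using P.one_closed by (simp add: letters_def)
    have "act_word [Gen \<one>] y = (if y \<in> P then Some y else None)" if "y \<in> P" for y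
      using that by simp
    then have "diagonal_with (\<lambda>x. of_bool (x \<in> P)) (free_gen \<one>)"
      using l vec_partial_identity_mult[OF l, of _ P]
      by (simp add: diagonal_with_def free_gen_eq word_basis_closed)
    then have "diagonal_with (\<lambda>x. of_bool (x \<in> P) - 1) r"
      unfolding 1 by (rule diagonal_with_minus[OF _ diagonal_with_one])
    then show thesis
      by (rule that) simp
  next
    case (2 \<alpha>)
    show thesis
      using word[OF 2(1)] unfolding 2(3)[symmetric] by (rule that) (simp add: 2)
  next
    case (3 \<alpha> \<beta>)
    show thesis
      using diagonal_with_minus[OF word[OF 3(1)] word[OF 3(2)]] unfolding 3(4)[symmetric]
      by (rule that) (simp add: 3)
  next
    case (4 \<alpha> L)
    let ?K = "\<lambda>\<beta> x. of_bool (x \<in> constr_ideal G P \<beta>) :: complex"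
    have "diagonal_with (\<lambda>x. \<Prod>\<beta>\<leftarrow>L. ?K \<alpha> x - ?K \<beta> x) r"
      unfolding 4(5)
    proof (rule diagonal_with_list_mult)
      fix \<beta> assume "\<beta> \<in> set L"
      then have "\<beta> \<in> neutral_words G P"
        using 4(3) by blast
      then show "diagonal_with (\<lambda>x. ?K \<alpha> x - ?K \<beta> x) (word_op F free_gen \<alpha> \<ominus>\<^bsub>F\<^esub> word_op F free_gen \<beta>)"
        by (rule diagonal_with_minus[OF word[OF 4(1)] word])
    qed
    moreover have "(\<Prod>\<beta>\<leftarrow>L. ?K \<alpha> x - ?K \<beta> x) = 0" for x
    proof -
      \<comment> \<open>Inside \<open>K(\<alpha>)\<close> some ideal of the list contains
        \<open>x\<close>. Outside none does, and any member of the nonempty list will do.\<close>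
      have "\<exists>\<beta>\<in>set L. ?K \<alpha> x = ?K \<beta> x"
      proof (cases "x \<in> constr_ideal G P \<alpha>")
        case True
        then show ?thesis
          using 4(4) by auto
      next
        case False
        have "hd L \<in> set L"
          using 4(2) by simp
        moreover have "x \<notin> constr_ideal G P (hd L)"
          using False 4(4) \<open>hd L \<in> set L\<close> by blast
        ultimately show ?thesis
          using False by (intro bexI[of _ "hd L"]) simp_all
      qed
      then show ?thesis
        by (auto simp: prod_list_zero_iff)
    qed
    ultimately show thesis
      using that by blast
  qed
qed

sublocale reg: left_seminorm F vec_norm
  by (rule left_seminorm_vec_norm)

lemma vec_eq_zero_outside: "g \<in> carrier F \<Longrightarrow> x \<notin> P \<Longrightarrow> vec g x = 0"
  using vec_outside_reach[of x g] reach_subset[of g] by blast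

text \<open>Admits the regular seminorm to the supremum that defines the universal one.\<close>

lemma regular_seminorm_relator:
  assumes "r \<in> R" shows "reg.operator_seminorm r = 0"
proof (rule antisym)
  have r: "r \<in> carrier F"
    using assms free_relators_closed by blast
  then show "0 \<le> reg.operator_seminorm r"
    by (rule reg.operator_seminorm_nonneg)
  obtain \<chi> where \<chi>: "diagonal_with \<chi> r" "\<And>x. x \<in> P \<Longrightarrow> \<chi> x = 0"
    using relator_diagonal[OF assms] by blast
  have "vec_norm (r \<otimes>\<^bsub>F\<^esub> g) \<le> 0" if g: "g \<in> carrier F" for g
  proof -
    have "vec (r \<otimes>\<^bsub>F\<^esub> g) x = 0" for x
      using \<chi> g r vec_eq_zero_outside[of "r \<otimes>\<^bsub>F\<^esub> g" x] by (cases "x \<in> P") (simp_all add: diagonal_with_def)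
    then show ?thesis
      by (simp add: vec_norm_def L2_set_def)
  qed
  then show "reg.operator_seminorm r \<le> 0"
    by (intro reg.operator_seminorm_least)
qed

lemma regular_seminorm_prod_compl:
  assumes L: "set L \<subseteq> neutral_words G P" "\<forall>\<alpha>\<in>set L. constr_ideal G P \<alpha> \<noteq> P"
  shows "0 < reg.operator_seminorm (list_mult F (map (\<lambda>\<alpha>. \<one>\<^bsub>F\<^esub> \<ominus>\<^bsub>F\<^esub> word_op F free_gen \<alpha>) L))"
    (is "0 < reg.operator_seminorm ?d")
proof -
  let ?\<chi> = "\<lambda>x. \<Prod>\<alpha>\<leftarrow>L. 1 - of_bool (x \<in> constr_ideal G P \<alpha>) :: complex"
  have d: "diagonal_with ?\<chi> ?d"
  proof (rule diagonal_with_list_mult)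
    fix \<alpha> assume "\<alpha> \<in> set L"
    then have "\<alpha> \<in> neutral_words G P"
      using L(1) by blast
    then show "diagonal_with (\<lambda>x. 1 - of_bool (x \<in> constr_ideal G P \<alpha>)) (\<one>\<^bsub>F\<^esub> \<ominus>\<^bsub>F\<^esub> word_op F free_gen \<alpha>)"
      by (rule diagonal_with_minus[OF diagonal_with_one diagonal_with_word_op])
  qed
  then have dF: "?d \<in> carrier F"
    by (simp add: diagonal_with_def)
  have "\<one> \<notin> constr_ideal G P \<alpha>" if "\<alpha> \<in> set L" for \<alpha>
  proof -
    have "\<alpha> \<in> neutral_words G P"
      using that L(1) by blast
    then show ?thesis
      using that L(2) constr_ideal_eq_P_iff[OF neutral_wordsD(1)] by blast
  qed
  then have "?\<chi> \<one> = (\<Prod>\<alpha>\<leftarrow>L. 1)"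
    by (intro arg_cong[of _ _ prod_list] map_cong) simp_all
  then have "?\<chi> \<one> = 1"
    by (simp add: map_replicate_const)
  moreover have "vec (?d \<otimes>\<^bsub>F\<^esub> \<one>\<^bsub>F\<^esub>) \<one> = ?\<chi> \<one> * vec \<one>\<^bsub>F\<^esub> \<one>"
    using d P.one_closed F.one_closed unfolding diagonal_with_def by blast
  ultimately have v: "vec (?d \<otimes>\<^bsub>F\<^esub> \<one>\<^bsub>F\<^esub>) \<one> = 1"
    by (simp only: vec_one) simp
  have pos: "0 < vec_norm (?d \<otimes>\<^bsub>F\<^esub> \<one>\<^bsub>F\<^esub>)"
  proof -
    \<comment> \<open>Inserting the identity makes it an index of the sum without computing
      \<open>reach\<close>.\<close>
    let ?X = "insert \<one> (reach (?d \<otimes>\<^bsub>F\<^esub> \<one>\<^bsub>F\<^esub>))"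
    have X: "finite ?X"
      using dF by (simp add: finite_reach)
    have "cmod (vec (?d \<otimes>\<^bsub>F\<^esub> \<one>\<^bsub>F\<^esub>) \<one>) \<le> L2_set (\<lambda>x. cmod (vec (?d \<otimes>\<^bsub>F\<^esub> \<one>\<^bsub>F\<^esub>) x)) ?X"
      by (rule member_le_L2_set[OF X]) simp
    also have "\<dots> = vec_norm (?d \<otimes>\<^bsub>F\<^esub> \<one>\<^bsub>F\<^esub>)"
      by (rule vec_norm_superset[symmetric, OF X subset_insertI])
    finally show ?thesis
      unfolding v by simp
  qed
  have "vec_norm (?d \<otimes>\<^bsub>F\<^esub> \<one>\<^bsub>F\<^esub>) \<le> reg.operator_seminorm ?d * vec_norm \<one>\<^bsub>F\<^esub>"
    by (intro reg.operator_seminorm_mult_le dF F.one_closed)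
  with pos have "reg.operator_seminorm ?d \<noteq> 0"
    by auto
  then show ?thesis
    using reg.operator_seminorm_nonneg[OF dF] by simp
qed

lemma bounded_relators: "bounded_relators P R"
proof (rule bounded_relators.intro[OF free_relators_closed])
  fix N x assume N: "cstar_seminorm F N" "\<forall>r\<in>R. N r = 0" and x: "x \<in> P"
  interpret N: star_algebra_seminorm F N
    by (intro star_algebra_seminorm.intro star_algebra_seminorm_axioms.intro unital_star_algebra_free N)
  have g: "free_gen x \<in> carrier F"
    using x free_gen_image by blast
  have n: "[(x, x)] \<in> neutral_words G P"
    using x by (simp add: neutral_words_def)
  have "constr_ideal G P [(x, x)] = constr_ideal G P []"
    using x by (simp add: constr_ideal_eq_P_iff mem_constr_ideal_pair P.one_closed del: constr_ideal.simps(2))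
  then have "word_op F free_gen [(x, x)] \<ominus>\<^bsub>F\<^esub> word_op F free_gen [] \<in> R"
    using n neutral_Nil unfolding free_toeplitz_relators_def toeplitz_relators_def by blast
  then have "N (cadj F (free_gen x) \<otimes>\<^bsub>F\<^esub> free_gen x \<ominus>\<^bsub>F\<^esub> \<one>\<^bsub>F\<^esub>) = 0"
    using N(2) g by simp
  \<comment> \<open>The relator forces \<open>N (x^* x) \<le> N 1 \<le> 1\<close>, and the
    C*-identity rewrites the left side.\<close>
  then have "(N (free_gen x))\<^sup>2 \<le> 1"
    using N.norm_le_minus[of "cadj F (free_gen x) \<otimes>\<^bsub>F\<^esub> free_gen x" "\<one>\<^bsub>F\<^esub>"] g N.norm_one_le
    by (simp add: N.norm_cstar)
  then show "N (free_gen x) \<le> 1"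
    using N.norm_nonneg[OF g] by (simp add: power_le_one_iff abs_square_le_1)
qed

section \<open>The universal algebra as a Toeplitz family\<close>

abbreviation embed :: "('a letter list \<Rightarrow> complex) \<Rightarrow> (nat \<Rightarrow> 'a letter list \<Rightarrow> complex) set" where
  "embed a \<equiv> cauchy_class F (universal_seminorm P R) (\<lambda>n. a)"

lemma star_algebra_seminorm_univ: "star_algebra_seminorm F (universal_seminorm P R)"
  by (rule bounded_relators.star_algebra_seminorm_universal[OF bounded_relators])

lemma toeplitz_univ_eq: "T = cstar_completion F (universal_seminorm P R)"
  by (simp add: toeplitz_univ_def universal_cstar_def)

lemma unital_cstar_algebra_toeplitz_univ: "unital_cstar_algebra T"
  unfolding toeplitz_univ_def
  by (rule bounded_relators.unital_cstar_algebra_universal[OF bounded_relators])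

lemma star_homomorphism_embed: "star_homomorphism F T embed"
  unfolding toeplitz_univ_eq
  by (rule star_algebra_seminorm.star_homomorphism_completion[OF star_algebra_seminorm_univ])

lemma norm_embed: "a \<in> carrier F \<Longrightarrow> cnorm T (embed a) = universal_seminorm P R a"
  unfolding toeplitz_univ_eq
  by (rule star_algebra_seminorm.completion_norm_const[OF star_algebra_seminorm_univ])

lemma toeplitz_gen_eq: "toeplitz_gen G P = (\<lambda>p. embed (free_gen p))"
  by (simp add: toeplitz_gen_def universal_gen_def fun_eq_iff)

text \<open>Relators have universal seminorm zero, so their classes vanish in the
  completion.\<close>

lemma toeplitz_family_univ: "toeplitz_family G P T (toeplitz_gen G P)"
proof -
  interpret h: star_homomorphism F T embed
    by (rule star_homomorphism_embed)
  show ?thesis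
  proof (intro toeplitz_family.intro toeplitz_family_axioms.intro submonoid_of_group_axioms
      unital_cstar_algebra_toeplitz_univ)
    show "toeplitz_gen G P p \<in> carrier T" if "p \<in> P" for p
      unfolding toeplitz_gen_eq using free_gen_image that by (intro h.hom_closed) blast
    have "embed r = \<zero>\<^bsub>T\<^esub>" if r: "r \<in> R" for r
    proof (rule unital_cstar_algebra.cnorm_eq_zero[OF unital_cstar_algebra_toeplitz_univ])
      have rF: "r \<in> carrier F"
        using r free_relators_closed by blast
      then show "embed r \<in> carrier T"
        by (rule h.hom_closed)
      show "cnorm T (embed r) = 0"
        unfolding norm_embed[OF rF]
        by (rule bounded_relators.universal_relator[OF bounded_relators r])
    qed
    then show "toeplitz_relators G P T (toeplitz_gen G P) \<subseteq> {\<zero>\<^bsub>T\<^esub>}"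
      using h.toeplitz_relators_image[OF P.one_closed free_gen_image]
      unfolding toeplitz_gen_eq free_toeplitz_relators_def by blast
  qed
qed

sublocale toeplitz: toeplitz_family G P T "toeplitz_gen G P"
  by (rule toeplitz_family_univ)

text \<open>The norm of the product is the universal seminorm of its lift to the free algebra, which
  dominates the regular seminorm.\<close>

lemma prod_compl_nonzero:
  assumes L: "set L \<subseteq> neutral_words G P" "\<forall>\<alpha>\<in>set L. constr_ideal G P \<alpha> \<noteq> P"
  shows "toeplitz.prod_compl L \<noteq> \<zero>\<^bsub>T\<^esub>"
proof
  interpret h: star_homomorphism F T embed
    by (rule star_homomorphism_embed)
  let ?f = "\<lambda>\<alpha>. \<one>\<^bsub>F\<^esub> \<ominus>\<^bsub>F\<^esub> word_op F free_gen \<alpha>"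
  have word: "word_op F free_gen \<alpha> \<in> carrier F"
      "embed (word_op F free_gen \<alpha>) = word_op T (toeplitz_gen G P) \<alpha>"
    if "\<alpha> \<in> neutral_words G P" for \<alpha>
    unfolding toeplitz_gen_eq
    using F.word_op_closed[OF free_gen_image] h.hom_word_op[OF free_gen_image] neutral_wordsD(1)[OF that]
    by simp_all
  have f: "?f \<alpha> \<in> carrier F" "embed (?f \<alpha>) = \<one>\<^bsub>T\<^esub> \<ominus>\<^bsub>T\<^esub> word_op T (toeplitz_gen G P) \<alpha>"
    if "\<alpha> \<in> set L" for \<alpha>
  proof -
    have "\<alpha> \<in> neutral_words G P"
      using that L(1) by blast
    then show "?f \<alpha> \<in> carrier F" "embed (?f \<alpha>) = \<one>\<^bsub>T\<^esub> \<ominus>\<^bsub>T\<^esub> word_op T (toeplitz_gen G P) \<alpha>"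
      by (simp_all add: word h.hom_minus)
  qed
  let ?d = "list_mult F (map ?f L)"
  have sub: "set (map ?f L) \<subseteq> carrier F"
    using f(1) by (simp add: image_subset_iff)
  have d: "?d \<in> carrier F"
    by (rule F.list_mult_closed[OF sub])
  have "embed ?d = toeplitz.prod_compl L"
    unfolding h.hom_list_mult[OF sub] toeplitz.prod_compl_def
    by (simp add: f(2) cong: map_cong)
  moreover assume "toeplitz.prod_compl L = \<zero>\<^bsub>T\<^esub>"
  ultimately have "universal_seminorm P R ?d = 0"
    using norm_embed[OF d] by (simp add: toeplitz.T.norm_zero)
  moreover have "reg.operator_seminorm ?d \<le> universal_seminorm P R ?d"
    using reg.cstar_seminorm_operator_seminorm regular_seminorm_relator
    by (intro bounded_relators.le_universal[OF bounded_relators d]) simp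
  ultimately show False
    using regular_seminorm_prod_compl[OF L] by simp
qed

end

theorem proposition3p18:
  fixes G :: "('g, 'm) monoid_scheme"
    and P :: "'g set"
    and B :: "('b, 'n) cstar_ring_scheme"
    and \<rho> :: "(nat \<Rightarrow> 'g letter list \<Rightarrow> complex) set \<Rightarrow> 'b"
  assumes "group G"
    and "submonoid P G"
    and "unital_cstar_algebra B"
    and "\<rho> \<in> unital_star_hom (toeplitz_univ G P) B"
  shows "inj_on \<rho> (full_diagonal G P) \<longleftrightarrow> jointly_proper G P B \<rho>"
proof -
  interpret submonoid_of_group G P
    using assms by (intro submonoid_of_group.intro)
  interpret toeplitz_hom G P "toeplitz_univ G P" "toeplitz_gen G P" B \<rho>
    using assms(3,4) toeplitz_family_univ
    by (intro toeplitz_hom.intro star_homomorphism.intro star_homomorphism_axioms.intro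
        toeplitz.T.unital_star_algebra_axioms) (simp_all add: unital_cstar_algebra_def)
  have diagonal: "full_diagonal G P = cnorm_closure (toeplitz_univ G P)
      (clin_span (toeplitz_univ G P) (word_op (toeplitz_univ G P) (toeplitz_gen G P) ` neutral_words G P))"
    by (simp add: full_diagonal_def toeplitz_word_def)
  have proper: "jointly_proper G P B \<rho> \<longleftrightarrow> jointly_proper_on"
    by (simp add: jointly_proper_def jointly_proper_on_def toeplitz_word_def)
  show ?thesis
    unfolding diagonal proper
    using inj_on_diagonal jointly_proper_of_inj_on[OF _ prod_compl_nonzero] by blast
qed

end
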